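(* Let $J$ be an r-ideal in an approximately unital operator algebra $A$. Then the following are equivalent: (i) $J$ is regular; (ii) $J$ is $1$-regular; (iii) the complement $1_{A^{**}} - p$ of the support projection $p$ of $J$ is a compact projection.
   Context: An operator algebra is a norm closed algebra $A$ of operators on a Hilbert space $H$; it is approximately unital if it has a contractive approximate identity, in which case $A^{**}$ (with its Arens product) has an identity $1_{A^{**}}$ of norm $1$. The unitization $A^1$ equals $A$ if $A$ has an identity of norm $1$, and otherwise is $A + \mathbb{C} I_H$; $1$ is its identity, and $(1-x)A = \{a - xa : a \in A\}$. An r-ideal is a closed right ideal $J$ of $A$ with a left contractive approximate identity (a net $(e_t)$ in the closed unit ball of $J$ with $e_t y \to y$ for all $y \in J$); the weak* limit in $A^{**}$ of such a net is a projection $p$, called the support projection of $J$, and $J = pA^{**} \cap A$. A right ideal $J$ of $A$ is regular (resp. $1$-regular) if there exists $x \in A$ (resp. $x \in A$ with $\Vert x \Vert \leq 1$) such that $(1-x)A \subset J$. Projections are orthogonal (self-adjoint). A projection $p \in A^{**}$ is open if there is a net $(x_t)$ in $A$ with $x_t = p x_t \to p$ weak*; $q \in A^{**}$ is closed if $1_{A^{**}} - q$ is open; and, for approximately unital $A$, $q$ is compact if it is closed and $q = qa$ for some $a$ in the closed unit ball of $A$ (equivalently, $q$ is closed in $(A^1)^{**}$ with respect to $A^1$). *)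

theory Defs
  imports "HOL-Analysis.Analysis"
begin

section \<open>Complex Hilbert spaces and their bounded operators\<close>

class complex_hilbert_space = real_inner + complete_space +
  fixes scaleC :: "complex \<Rightarrow> 'a \<Rightarrow> 'a" (infixr "*\<^sub>C" 75)
    and cinner :: "'a \<Rightarrow> 'a \<Rightarrow> complex"
  assumes scaleC_add_right: "c *\<^sub>C (x + y) = c *\<^sub>C x + c *\<^sub>C y"
    and scaleC_add_left: "(c + d) *\<^sub>C x = c *\<^sub>C x + d *\<^sub>C x"
    and scaleC_scaleC: "c *\<^sub>C d *\<^sub>C x = (c * d) *\<^sub>C x"
    and scaleC_of_real: "complex_of_real r *\<^sub>C x = r *\<^sub>R x"
    and cinner_commute: "cinner x y = cnj (cinner y x)"
    and cinner_add_left: "cinner (x + y) z = cinner x z + cinner y z"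
    and cinner_scaleC_left: "cinner (c *\<^sub>C x) y = c * cinner x y"
    and inner_eq_Re_cinner: "inner x y = Re (cinner x y)"

instantiation complex :: complex_hilbert_space
begin
definition scaleC_complex :: "complex \<Rightarrow> complex \<Rightarrow> complex"
  where "scaleC_complex c x = c * x"
definition cinner_complex :: "complex \<Rightarrow> complex \<Rightarrow> complex"
  where "cinner_complex x y = x * cnj y"
instance
  by standard
    (auto simp: scaleC_complex_def cinner_complex_def algebra_simps scaleR_conv_of_real
      inner_complex_def)
end

lemma norm_scaleC:
  fixes x :: "'h::complex_hilbert_space"
  shows "norm (c *\<^sub>C x) = cmod c * norm x"
proof -
  have im: "Im (cinner x x) = 0"
    using arg_cong[OF cinner_commute[of x x], of Im] by simp
  have "cinner (c *\<^sub>C x) (c *\<^sub>C x) = c * cnj c * cinner x x"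
    by (metis cinner_commute cinner_scaleC_left complex_cnj_mult mult.assoc)
  then have "inner (c *\<^sub>C x) (c *\<^sub>C x) = (cmod c)\<^sup>2 * inner x x"
    by (simp add: inner_eq_Re_cinner im complex_mult_cnj cmod_power2)
  then show ?thesis
    by (simp add: norm_eq_sqrt_inner real_sqrt_mult)
qed

text \<open>Operators are elements of the type of bounded real-linear maps; on the complex-linear
  ones its norm is the usual operator norm.\<close>

definition bounded_operators :: "('h::complex_hilbert_space \<Rightarrow>\<^sub>L 'h) set" where
  "bounded_operators = {T. \<forall>c x. blinfun_apply T (c *\<^sub>C x) = c *\<^sub>C blinfun_apply T x}"

lift_definition scaleC_op ::
  "complex \<Rightarrow> ('h::complex_hilbert_space \<Rightarrow>\<^sub>L 'h) \<Rightarrow> ('h \<Rightarrow>\<^sub>L 'h)"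
  is "\<lambda>c T x. c *\<^sub>C T x"
proof -
  fix c :: complex and T :: "'h \<Rightarrow> 'h"
  assume T: "bounded_linear T"
  have "bounded_linear (\<lambda>x::'h. c *\<^sub>C x)"
  proof (rule bounded_linear_intro[where K = "cmod c"])
    fix r :: real and x :: 'h
    show "c *\<^sub>C (r *\<^sub>R x) = r *\<^sub>R (c *\<^sub>C x)"
      by (simp add: scaleC_of_real[symmetric] scaleC_scaleC mult.commute)
  qed (simp_all add: scaleC_add_right norm_scaleC mult.commute)
  then show "bounded_linear (\<lambda>x. c *\<^sub>C T x)"
    using T bounded_linear_compose by blast
qed

definition adjoint_op :: "('h::complex_hilbert_space \<Rightarrow>\<^sub>L 'h) \<Rightarrow> ('h \<Rightarrow>\<^sub>L 'h)" where
  "adjoint_op T = (THE S. S \<in> bounded_operators \<and>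
     (\<forall>x y. cinner (blinfun_apply T x) y = cinner x (blinfun_apply S y)))"

definition complex_subspace :: "('h::complex_hilbert_space \<Rightarrow>\<^sub>L 'h) set \<Rightarrow> bool" where
  "complex_subspace V \<longleftrightarrow>
     0 \<in> V \<and> (\<forall>a\<in>V. \<forall>b\<in>V. a + b \<in> V) \<and> (\<forall>c. \<forall>a\<in>V. scaleC_op c a \<in> V)"

definition operator_algebra :: "('h::complex_hilbert_space \<Rightarrow>\<^sub>L 'h) set \<Rightarrow> bool" where
  "operator_algebra A \<longleftrightarrow>
     A \<subseteq> bounded_operators \<and> complex_subspace A \<and> (\<forall>a\<in>A. \<forall>b\<in>A. a o\<^sub>L b \<in> A) \<and> closed A"

text \<open>A net in a set \<open>S\<close> is represented by the filter it generates on \<open>S\<close>, i.e. by a proper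
  filter \<open>F\<close> with \<open>F \<le> principal S\<close>; every such filter arises from a net with the same limits.\<close>

definition net_in :: "'b set \<Rightarrow> 'b filter \<Rightarrow> bool" where
  "net_in S F \<longleftrightarrow> F \<noteq> bot \<and> F \<le> principal S"

definition contractive_approx_identity ::
  "('h::complex_hilbert_space \<Rightarrow>\<^sub>L 'h) set \<Rightarrow> ('h \<Rightarrow>\<^sub>L 'h) filter \<Rightarrow> bool" where
  "contractive_approx_identity A F \<longleftrightarrow> net_in {e \<in> A. norm e \<le> 1} F \<and>
     (\<forall>a\<in>A. ((\<lambda>e. e o\<^sub>L a) \<longlongrightarrow> a) F \<and> ((\<lambda>e. a o\<^sub>L e) \<longlongrightarrow> a) F)"

definition left_contractive_approx_identity ::
  "('h::complex_hilbert_space \<Rightarrow>\<^sub>L 'h) set \<Rightarrow> ('h \<Rightarrow>\<^sub>L 'h) filter \<Rightarrow> bool" where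
  "left_contractive_approx_identity J F \<longleftrightarrow> net_in {e \<in> J. norm e \<le> 1} F \<and>
     (\<forall>y\<in>J. ((\<lambda>e. e o\<^sub>L y) \<longlongrightarrow> y) F)"

definition approximately_unital :: "('h::complex_hilbert_space \<Rightarrow>\<^sub>L 'h) set \<Rightarrow> bool" where
  "approximately_unital A \<longleftrightarrow> (\<exists>F. contractive_approx_identity A F)"

section \<open>The bidual with its Arens product\<close>

text \<open>Functionals on a carrier set are total functions that vanish off the carrier, so that
  equality of functionals is equality of functions.\<close>

definition extend0 :: "'b set \<Rightarrow> ('b \<Rightarrow> complex) \<Rightarrow> 'b \<Rightarrow> complex" where
  "extend0 S f = (\<lambda>x. if x \<in> S then f x else 0)"

type_synonym 'h functional = "('h \<Rightarrow>\<^sub>L 'h) \<Rightarrow> complex"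

definition dual :: "('h::complex_hilbert_space \<Rightarrow>\<^sub>L 'h) set \<Rightarrow> 'h functional set" where
  "dual A = {\<phi>.
     (\<forall>a\<in>A. \<forall>b\<in>A. \<phi> (a + b) = \<phi> a + \<phi> b) \<and>
     (\<forall>c. \<forall>a\<in>A. \<phi> (scaleC_op c a) = c * \<phi> a) \<and>
     (\<exists>K. \<forall>a\<in>A. cmod (\<phi> a) \<le> K * norm a) \<and>
     (\<forall>a. a \<notin> A \<longrightarrow> \<phi> a = 0)}"

definition dual_norm :: "('h::complex_hilbert_space \<Rightarrow>\<^sub>L 'h) set \<Rightarrow> 'h functional \<Rightarrow> real" where
  "dual_norm A \<phi> = (SUP a\<in>{a \<in> A. norm a \<le> 1}. cmod (\<phi> a))"

definition bidual ::
  "('h::complex_hilbert_space \<Rightarrow>\<^sub>L 'h) set \<Rightarrow> ('h functional \<Rightarrow> complex) set" where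
  "bidual A = {\<Phi>.
     (\<forall>\<phi>\<in>dual A. \<forall>\<psi>\<in>dual A. \<Phi> (\<lambda>a. \<phi> a + \<psi> a) = \<Phi> \<phi> + \<Phi> \<psi>) \<and>
     (\<forall>c. \<forall>\<phi>\<in>dual A. \<Phi> (\<lambda>a. c * \<phi> a) = c * \<Phi> \<phi>) \<and>
     (\<exists>K. \<forall>\<phi>\<in>dual A. cmod (\<Phi> \<phi>) \<le> K * dual_norm A \<phi>) \<and>
     (\<forall>\<phi>. \<phi> \<notin> dual A \<longrightarrow> \<Phi> \<phi> = 0)}"

definition canonical_embedding ::
  "('h::complex_hilbert_space \<Rightarrow>\<^sub>L 'h) set \<Rightarrow> ('h \<Rightarrow>\<^sub>L 'h) \<Rightarrow> 'h functional \<Rightarrow> complex" where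
  "canonical_embedding A a = extend0 (dual A) (\<lambda>\<phi>. \<phi> a)"

text \<open>The first Arens product:
  \<open>(\<Phi> \<Psi>)(\<phi>) = \<Phi>(\<Psi>\<cdot>\<phi>)\<close>, \<open>(\<Psi>\<cdot>\<phi>)(a) = \<Psi>(\<phi>\<cdot>a)\<close>, \<open>(\<phi>\<cdot>a)(b) = \<phi>(a b)\<close>.
  (Operator algebras are Arens regular, so the second Arens product is the same.)\<close>

definition arens_product ::
  "('h::complex_hilbert_space \<Rightarrow>\<^sub>L 'h) set \<Rightarrow> ('h functional \<Rightarrow> complex) \<Rightarrow>
   ('h functional \<Rightarrow> complex) \<Rightarrow> 'h functional \<Rightarrow> complex" where
  "arens_product A \<Phi> \<Psi> = extend0 (dual A)
     (\<lambda>\<phi>. \<Phi> (extend0 A (\<lambda>a. \<Psi> (extend0 A (\<lambda>b. \<phi> (a o\<^sub>L b))))))"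

definition bidual_one ::
  "('h::complex_hilbert_space \<Rightarrow>\<^sub>L 'h) set \<Rightarrow> 'h functional \<Rightarrow> complex" where
  "bidual_one A = (THE E. E \<in> bidual A \<and>
     (\<forall>\<Phi>\<in>bidual A. arens_product A E \<Phi> = \<Phi> \<and> arens_product A \<Phi> E = \<Phi>))"

definition weak_star_limit ::
  "('h::complex_hilbert_space \<Rightarrow>\<^sub>L 'h) set \<Rightarrow> ('h \<Rightarrow>\<^sub>L 'h) filter \<Rightarrow>
   ('h functional \<Rightarrow> complex) \<Rightarrow> bool" where
  "weak_star_limit A F \<Phi> \<longleftrightarrow> \<Phi> \<in> bidual A \<and>
     (\<forall>\<phi>\<in>dual A. ((\<lambda>x. canonical_embedding A x \<phi>) \<longlongrightarrow> \<Phi> \<phi>) F)"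

text \<open>Self-adjointness in \<open>A\<^sup>*\<^sup>*\<close> refers to the C*-algebra \<open>B(H)\<^sup>*\<^sup>*\<close>, in which
  \<open>A\<^sup>*\<^sup>*\<close> sits via the second transpose of the inclusion of \<open>A\<close> in \<open>B(H)\<close>. The
  involution of \<open>B(H)\<^sup>*\<^sup>*\<close> is the weak* continuous extension of that of \<open>B(H)\<close>:
  \<open>\<Phi>\<^sup>*(\<psi>) = cnj (\<Phi>(\<psi>\<^sup>*))\<close> with \<open>\<psi>\<^sup>*(T) = cnj (\<psi>(T\<^sup>*))\<close>.\<close>

definition bidual_inclusion ::
  "('h::complex_hilbert_space \<Rightarrow>\<^sub>L 'h) set \<Rightarrow> ('h functional \<Rightarrow> complex) \<Rightarrow>
   'h functional \<Rightarrow> complex" where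
  "bidual_inclusion A \<Phi> = extend0 (dual bounded_operators) (\<lambda>\<psi>. \<Phi> (extend0 A \<psi>))"

definition bidual_adjoint ::
  "('h::complex_hilbert_space functional \<Rightarrow> complex) \<Rightarrow> 'h functional \<Rightarrow> complex" where
  "bidual_adjoint \<Phi> = extend0 (dual bounded_operators)
     (\<lambda>\<psi>. cnj (\<Phi> (extend0 bounded_operators (\<lambda>T. cnj (\<psi> (adjoint_op T))))))"

definition is_projection ::
  "('h::complex_hilbert_space \<Rightarrow>\<^sub>L 'h) set \<Rightarrow> ('h functional \<Rightarrow> complex) \<Rightarrow> bool" where
  "is_projection A p \<longleftrightarrow> p \<in> bidual A \<and> arens_product A p p = p \<and>
     bidual_adjoint (bidual_inclusion A p) = bidual_inclusion A p"

definition bidual_complement ::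
  "('h::complex_hilbert_space \<Rightarrow>\<^sub>L 'h) set \<Rightarrow> ('h functional \<Rightarrow> complex) \<Rightarrow>
   'h functional \<Rightarrow> complex" where
  "bidual_complement A q = (\<lambda>\<phi>. bidual_one A \<phi> - q \<phi>)"

definition open_projection ::
  "('h::complex_hilbert_space \<Rightarrow>\<^sub>L 'h) set \<Rightarrow> ('h functional \<Rightarrow> complex) \<Rightarrow> bool" where
  "open_projection A p \<longleftrightarrow> is_projection A p \<and>
     (\<exists>F. net_in {x \<in> A. canonical_embedding A x = arens_product A p (canonical_embedding A x)} F \<and>
          weak_star_limit A F p)"

definition closed_projection ::
  "('h::complex_hilbert_space \<Rightarrow>\<^sub>L 'h) set \<Rightarrow> ('h functional \<Rightarrow> complex) \<Rightarrow> bool" where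
  "closed_projection A q \<longleftrightarrow> is_projection A q \<and> open_projection A (bidual_complement A q)"

definition compact_projection ::
  "('h::complex_hilbert_space \<Rightarrow>\<^sub>L 'h) set \<Rightarrow> ('h functional \<Rightarrow> complex) \<Rightarrow> bool" where
  "compact_projection A q \<longleftrightarrow> closed_projection A q \<and>
     (\<exists>a\<in>A. norm a \<le> 1 \<and> q = arens_product A q (canonical_embedding A a))"

section \<open>Right ideals\<close>

definition right_ideal ::
  "('h::complex_hilbert_space \<Rightarrow>\<^sub>L 'h) set \<Rightarrow> ('h \<Rightarrow>\<^sub>L 'h) set \<Rightarrow> bool" where
  "right_ideal A J \<longleftrightarrow> complex_subspace J \<and> J \<subseteq> A \<and> (\<forall>j\<in>J. \<forall>a\<in>A. j o\<^sub>L a \<in> J)"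

definition r_ideal ::
  "('h::complex_hilbert_space \<Rightarrow>\<^sub>L 'h) set \<Rightarrow> ('h \<Rightarrow>\<^sub>L 'h) set \<Rightarrow> bool" where
  "r_ideal A J \<longleftrightarrow> right_ideal A J \<and> closed J \<and>
     (\<exists>F. left_contractive_approx_identity J F)"

definition support_projection ::
  "('h::complex_hilbert_space \<Rightarrow>\<^sub>L 'h) set \<Rightarrow> ('h \<Rightarrow>\<^sub>L 'h) set \<Rightarrow> 'h functional \<Rightarrow> complex" where
  "support_projection A J =
     (THE p. \<exists>F. left_contractive_approx_identity J F \<and> weak_star_limit A F p)"

definition regular_right_ideal ::
  "('h::complex_hilbert_space \<Rightarrow>\<^sub>L 'h) set \<Rightarrow> ('h \<Rightarrow>\<^sub>L 'h) set \<Rightarrow> bool" where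
  "regular_right_ideal A J \<longleftrightarrow> right_ideal A J \<and> (\<exists>x\<in>A. {a - (x o\<^sub>L a) | a. a \<in> A} \<subseteq> J)"

definition one_regular_right_ideal ::
  "('h::complex_hilbert_space \<Rightarrow>\<^sub>L 'h) set \<Rightarrow> ('h \<Rightarrow>\<^sub>L 'h) set \<Rightarrow> bool" where
  "one_regular_right_ideal A J \<longleftrightarrow> right_ideal A J \<and>
     (\<exists>x\<in>A. norm x \<le> 1 \<and> {a - (x o\<^sub>L a) | a. a \<in> A} \<subseteq> J)"

end

theory Submission
  imports Defs
begin

text \<open>Let \<open>p\<close> be the support projection of \<open>J\<close>, let \<open>q = 1 - p\<close>, and let \<open>e\<close> run through a left
  contractive approximate identity of \<open>J\<close>. Everything rests on one elementary observation about operators on a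
  Hilbert space: if \<open>e y \<rightarrow> y\<close>, then also \<open>e\<^sup>* y \<rightarrow> y\<close>, because \<open>e\<close> is a contraction. Hence
  suitable families built from \<open>e\<close> have asymptotically orthogonal ranges, and averages of \<open>N\<close>
  bounded operators with almost orthogonal ranges have norm of order \<open>1 / sqrt N\<close>. Such a family
  therefore tends to \<open>0\<close> weakly (\<open>functional_tendsto_0_if_almost_orthogonal\<close>).

  Applied to \<open>e - e'\<close> for two approximate identities, this shows that \<open>e\<close> converges weak* to a
  limit \<open>p\<close> that depends only on \<open>J\<close>. Applied to \<open>e - e e\<^sup>*\<close>, it shows that \<open>p\<close> is self-adjoint.
  Applied to \<open>b - e b\<close> with \<open>b\<close> chosen along with \<open>e\<close> in the unit ball of \<open>J\<close>, it shows that the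
  translates \<open>\<phi>(e \<cdot>)\<close> of a functional converge to \<open>\<phi>\<close> in norm on \<open>J\<close>. So \<open>p \<Psi> = \<Psi>\<close> for
  all \<open>\<Psi>\<close> in the weak* closure of \<open>J\<close> (\<open>support_projection_left_identity\<close>), which contains
  the idempotence of \<open>p\<close> and, for \<open>J = A\<close>, the existence of the identity of the bidual.
  Thus \<open>q\<close> is always a closed projection, and it is compact if and only if \<open>q = q x\<close> for some
  \<open>x\<close> in the unit ball of \<open>A\<close>.

  If \<open>(1 - x) A \<subseteq> J\<close>, then \<open>1 - x\<close> is in the weak* closure of \<open>J\<close>, so \<open>p (1 - x) = 1 - x\<close>, which
  says \<open>q x = q\<close>. Conversely, \<open>q x = q\<close> implies that every functional on \<open>A\<close> that vanishes on \<open>J\<close>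
  vanishes on \<open>(1 - x) A\<close>, so \<open>(1 - x) A \<subseteq> J\<close> by the Hahn-Banach theorem.

  It remains to find \<open>x\<close> in the unit ball if some \<open>x\<close> with \<open>(1 - x) A \<subseteq> J\<close> exists. Were \<open>p\<close> an
  element of \<open>J\<close>, the projection \<open>q = x - p x\<close> would serve. In general one replaces \<open>p\<close> by
  long averages along the approximate identity and reduces the norm in steps: an element of norm at most
  \<open>1 + \<epsilon>\<close> is changed within its coset modulo \<open>J\<close> to one of norm at most \<open>1 + \<eta>\<close>, for any
  \<open>\<eta> > 0\<close>, with a displacement of order \<open>sqrt \<epsilon>\<close> for small \<open>\<epsilon>\<close> (\<open>regular_element_improve\<close>), and
  iteration gives a Cauchy sequence whose limit has norm at most \<open>1\<close>.\<close>

section \<open>Adjoints on a real Hilbert space\<close>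

text \<open>The representing vector is a multiple of the point of least norm on the hyperplane
  \<open>f = 1\<close>; minimizing sequences are Cauchy by the parallelogram law.\<close>

lemma riesz_representation:
  fixes f :: "'h::{real_inner,complete_space} \<Rightarrow> real"
  assumes f: "bounded_linear f"
  shows "\<exists>z. \<forall>x. f x = inner x z"
proof (cases "\<forall>x. f x = 0")
  case True
  then show ?thesis by (intro exI[of _ 0]) simp
next
  case False
  interpret f: bounded_linear f by fact
  from False obtain x0 where x0: "f x0 \<noteq> 0" by blast
  define C where "C = {x. f x = 1}"
  have "x0 /\<^sub>R f x0 \<in> C" using x0 by (simp add: C_def f.scaleR)
  then have Cne: "C \<noteq> {}" by blast
  define d where "d = (INF x\<in>C. norm x)"
  have bdd: "bdd_below (norm ` C)" by (rule bdd_belowI[of _ 0]) auto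
  have dle: "d \<le> norm x" if "x \<in> C" for x
    unfolding d_def using bdd that by (rule cINF_lower)
  have d0: "0 \<le> d" unfolding d_def using Cne by (intro cINF_greatest) auto
  have "\<exists>x\<in>C. norm x < d + 1 / real (Suc n)" for n
    using cINF_less_iff[OF Cne bdd, of "d + 1 / real (Suc n)"] by (simp add: d_def)
  then obtain X where X: "\<And>n. X n \<in> C" and Xn: "\<And>n. norm (X n) < d + 1 / real (Suc n)"
    by metis
  have par: "(norm (X m - X n))\<^sup>2 \<le> 2 * (norm (X m))\<^sup>2 + 2 * (norm (X n))\<^sup>2 - 4 * d\<^sup>2" for m n
  proof -
    have "(1/2) *\<^sub>R (X m + X n) \<in> C" using X by (simp add: C_def f.scaleR f.add)
    then have "d \<le> norm ((1/2) *\<^sub>R (X m + X n))" by (rule dle)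
    then have "2 * d \<le> norm (X m + X n)" by simp
    then have "(2 * d)\<^sup>2 \<le> (norm (X m + X n))\<^sup>2" using d0 by (intro power_mono) auto
    then have "4 * d\<^sup>2 \<le> (norm (X m + X n))\<^sup>2" by (simp add: power_mult_distrib)
    then show ?thesis by (simp add: power2_norm_eq_inner inner_diff inner_add inner_commute)
  qed
  have lim2: "(\<lambda>n. (d + 1 / real (Suc n))\<^sup>2) \<longlonglongrightarrow> (d + 0)\<^sup>2"
    by (intro tendsto_intros LIMSEQ_Suc[OF lim_1_over_n])
  have "Cauchy X"
  proof (rule metric_CauchyI)
    fix e :: real assume e: "0 < e"
    have "eventually (\<lambda>n. (d + 1 / real (Suc n))\<^sup>2 < d\<^sup>2 + e\<^sup>2 / 4) sequentially"
      using lim2 by (rule order_tendstoD) (use e in simp)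
    then obtain M where M: "\<And>n. n \<ge> M \<Longrightarrow> (d + 1 / real (Suc n))\<^sup>2 < d\<^sup>2 + e\<^sup>2 / 4"
      unfolding eventually_sequentially by blast
    have small: "(norm (X n))\<^sup>2 < d\<^sup>2 + e\<^sup>2 / 4" if "n \<ge> M" for n
    proof -
      have "(norm (X n))\<^sup>2 \<le> (d + 1 / real (Suc n))\<^sup>2"
        using Xn[of n] by (intro power_mono) auto
      then show ?thesis using M[OF that] by linarith
    qed
    show "\<exists>M. \<forall>m\<ge>M. \<forall>n\<ge>M. dist (X m) (X n) < e"
    proof (intro exI[of _ M] allI impI)
      fix m n assume "M \<le> m" "M \<le> n"
      then have "(norm (X m - X n))\<^sup>2 < e\<^sup>2" using par[of m n] small[of m] small[of n] by linarith
      then show "dist (X m) (X n) < e" using e by (simp add: dist_norm power_less_imp_less_base)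
    qed
  qed
  then obtain z where z: "X \<longlonglongrightarrow> z" using Cauchy_convergent convergent_def by blast
  have fz: "f z = 1"
  proof -
    have "(\<lambda>n. f (X n)) \<longlonglongrightarrow> f z" using z by (rule f.tendsto)
    moreover have "f (X n) = 1" for n using X by (simp add: C_def)
    ultimately show ?thesis by (simp add: LIMSEQ_const_iff)
  qed
  have nz: "norm z \<le> d"
  proof (rule LIMSEQ_le)
    show "(\<lambda>n. norm (X n)) \<longlonglongrightarrow> norm z" using z by (rule tendsto_norm)
    show "(\<lambda>n. d + 1 / real (Suc n)) \<longlonglongrightarrow> d"
      using tendsto_add[OF tendsto_const LIMSEQ_Suc[OF lim_1_over_n], of d] by simp
    show "\<exists>N. \<forall>n\<ge>N. norm (X n) \<le> d + 1 / real (Suc n)" using Xn by (intro exI[of _ 0]) (auto intro: less_imp_le)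
  qed
  have orth: "inner v z = 0" if v: "f v = 0" for v
  proof (rule ccontr)
    assume ne: "inner v z \<noteq> 0"
    then have v0: "inner v v > 0" by auto
    define t where "t = - inner v z / inner v v"
    have "z + t *\<^sub>R v \<in> C" using fz v by (simp add: C_def f.add f.scaleR)
    then have "norm z \<le> norm (z + t *\<^sub>R v)" using dle nz by (meson order_trans)
    then have "inner z z \<le> inner (z + t *\<^sub>R v) (z + t *\<^sub>R v)" by (simp add: norm_le)
    also have "\<dots> = inner z z + 2 * t * inner v z + t * t * inner v v"
      by (simp add: inner_add inner_commute algebra_simps)
    finally have "0 \<le> 2 * t * inner v z + t * t * inner v v" by simp
    moreover have "2 * t * inner v z + t * t * inner v v = - (inner v z)\<^sup>2 / inner v v"
      using v0 by (simp add: t_def field_simps power2_eq_square)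
    ultimately have "(inner v z)\<^sup>2 / inner v v \<le> 0" by simp
    moreover have "(inner v z)\<^sup>2 / inner v v > 0" using ne v0 by simp
    ultimately show False by linarith
  qed
  have z0: "inner z z \<noteq> 0" using fz f.zero by auto
  have "f x = inner x ((1 / inner z z) *\<^sub>R z)" for x
  proof -
    have "f (x - f x *\<^sub>R z) = 0" by (simp add: f.diff f.scaleR fz)
    then have "inner (x - f x *\<^sub>R z) z = 0" by (rule orth)
    then have "inner x z = f x * inner z z" by (simp add: inner_diff_left)
    then show ?thesis using z0 by simp
  qed
  then show ?thesis by blast
qed

lemma inner_eqI: "a = b" if "\<And>x. inner x a = inner x b" for a b :: "'a::real_inner"
proof -
  have "inner (a - b) (a - b) = 0" using that by (simp add: inner_diff_right)
  then show ?thesis by simp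
qed

text \<open>Since \<open>inner\<close> is the real part of \<open>cinner\<close>, the adjoint of a complex-linear operator with
  respect to the real inner product is also its adjoint with respect to the complex one; taking the
  real one gives an involution on all bounded real-linear maps.\<close>

definition adj :: "('h::{real_inner,complete_space} \<Rightarrow>\<^sub>L 'h) \<Rightarrow> 'h \<Rightarrow>\<^sub>L 'h" where
  "adj T = (SOME S. \<forall>x y. inner (blinfun_apply T x) y = inner x (blinfun_apply S y))"

lemma inner_adj: "inner (blinfun_apply T x) y = inner x (blinfun_apply (adj T) y)"
proof -
  have "\<exists>z. \<forall>x. inner (T x) y = inner x z" for y
    by (rule riesz_representation)
       (intro bounded_linear_intros blinfun.bounded_linear_right)
  then obtain g where g: "\<And>x y. inner (T x) y = inner x (g y)" by metis
  have "bounded_linear g"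
  proof (rule bounded_linear_intro[where K = "norm T"])
    show "g (x + y) = g x + g y" for x y
      by (rule inner_eqI) (metis g inner_add_right)
    show "g (r *\<^sub>R x) = r *\<^sub>R g x" for r x
      by (rule inner_eqI) (metis g inner_scaleR_right)
    show "norm (g x) \<le> norm x * norm T" for x
    proof (cases "g x = 0")
      case False
      have "(norm (g x))\<^sup>2 = inner (T (g x)) x" by (simp add: g power2_norm_eq_inner)
      also have "\<dots> \<le> norm (T (g x)) * norm x" by (rule norm_cauchy_schwarz)
      also have "\<dots> \<le> norm T * norm (g x) * norm x"
        by (intro mult_right_mono norm_blinfun) auto
      finally show ?thesis using False by (simp add: power2_eq_square mult.commute mult.left_commute)
    qed simp
  qed
  then have "\<forall>x y. inner (T x) y = inner x (blinfun_apply (Blinfun g) y)" by (simp add: bounded_linear_Blinfun_apply g)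
  then have "\<forall>x y. inner (T x) y = inner x (adj T y)" unfolding adj_def by (rule someI)
  then show ?thesis by blast
qed

lemma adj_unique: "adj T = S" if "\<And>x y. inner (blinfun_apply T x) y = inner x (blinfun_apply S y)"
  by (rule blinfun_eqI, rule inner_eqI) (simp add: that[symmetric] inner_adj)

lemma adj_adj [simp]: "adj (adj T) = T"
  by (rule adj_unique) (metis inner_adj inner_commute)

lemma adj_add: "adj (S + T) = adj S + adj T"
  by (rule adj_unique) (simp add: blinfun.add_left inner_add inner_adj)

lemma adj_diff: "adj (S - T) = adj S - adj T"
  by (rule adj_unique) (simp add: blinfun.diff_left inner_diff inner_adj)

lemma adj_scaleR: "adj (r *\<^sub>R T) = r *\<^sub>R adj T"
  by (rule adj_unique) (simp add: blinfun.scaleR_left inner_adj)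

lemma adj_compose: "adj (S o\<^sub>L T) = adj T o\<^sub>L adj S"
  by (rule adj_unique) (simp add: inner_adj)

lemma adj_zero [simp]: "adj 0 = 0"
  by (rule adj_unique) simp

lemma adj_sum: "adj (\<Sum>i\<in>I. T i) = (\<Sum>i\<in>I. adj (T i))"
  by (induction I rule: infinite_finite_induct) (auto simp: adj_add)

lemma norm_adj_le: "norm (adj T) \<le> norm T"
proof (rule norm_blinfun_bound)
  fix x
  show "norm (adj T x) \<le> norm T * norm x"
  proof (cases "adj T x = 0")
    case False
    have "(norm (adj T x))\<^sup>2 = inner (T (adj T x)) x" by (simp add: inner_adj power2_norm_eq_inner)
    also have "\<dots> \<le> norm (T (adj T x)) * norm x" by (rule norm_cauchy_schwarz)
    also have "\<dots> \<le> norm T * norm (adj T x) * norm x"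
      by (intro mult_right_mono norm_blinfun) auto
    finally show ?thesis using False by (simp add: power2_eq_square mult.commute mult.left_commute)
  qed simp
qed simp

lemma norm_adj [simp]: "norm (adj T) = norm T"
  using norm_adj_le[of T] norm_adj_le[of "adj T"] by simp

lemma power2_norm_le_adj_compose: "(norm T)\<^sup>2 \<le> norm (adj T o\<^sub>L T)"
proof -
  have "norm T \<le> sqrt (norm (adj T o\<^sub>L T))"
  proof (rule norm_blinfun_bound)
    fix x
    have "(norm (T x))\<^sup>2 = inner x ((adj T o\<^sub>L T) x)" by (simp add: inner_adj power2_norm_eq_inner)
    also have "\<dots> \<le> norm x * norm ((adj T o\<^sub>L T) x)" by (rule norm_cauchy_schwarz)
    also have "\<dots> \<le> norm x * (norm (adj T o\<^sub>L T) * norm x)"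
      by (intro mult_left_mono norm_blinfun) auto
    also have "\<dots> = (sqrt (norm (adj T o\<^sub>L T)) * norm x)\<^sup>2"
      by (simp add: power_mult_distrib power2_eq_square)
    finally show "norm (T x) \<le> sqrt (norm (adj T o\<^sub>L T)) * norm x"
      by (rule power2_le_imp_le) simp
  qed simp
  then show ?thesis by (metis norm_ge_zero power_mono real_sqrt_pow2)
qed

lemmas compose_simps =
  bounded_bilinear.add_left[OF bounded_bilinear_blinfun_compose]
  bounded_bilinear.add_right[OF bounded_bilinear_blinfun_compose]
  bounded_bilinear.diff_left[OF bounded_bilinear_blinfun_compose]
  bounded_bilinear.diff_right[OF bounded_bilinear_blinfun_compose]
  bounded_bilinear.scaleR_left[OF bounded_bilinear_blinfun_compose]
  bounded_bilinear.scaleR_right[OF bounded_bilinear_blinfun_compose]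
  bounded_bilinear.sum_left[OF bounded_bilinear_blinfun_compose]
  bounded_bilinear.sum_right[OF bounded_bilinear_blinfun_compose]

lemma blinfun_compose_assoc: "(f o\<^sub>L g) o\<^sub>L h = f o\<^sub>L (g o\<^sub>L h)"
  by (rule blinfun_eqI) simp

lemma norm_blinfun_compose_le:
  assumes "norm S \<le> a" "norm T \<le> b"
  shows "norm (S o\<^sub>L T) \<le> a * b"
proof -
  have "norm (S o\<^sub>L T) \<le> norm S * norm T" by (rule norm_blinfun_compose)
  also have "\<dots> \<le> a * b"
    using assms order_trans[OF norm_ge_zero assms(1)] by (intro mult_mono) auto
  finally show ?thesis .
qed

section \<open>Asymptotically orthogonal ranges and weak convergence\<close>

lemma norm_sum_almost_orthogonal:
  fixes y :: "nat \<Rightarrow> ('h::{real_inner,complete_space} \<Rightarrow>\<^sub>L 'h)"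
  assumes bound: "\<And>n. norm (y n) \<le> M"
    and orth: "\<And>m n. m < n \<Longrightarrow> norm (adj (y n) o\<^sub>L y m) \<le> \<tau>"
    and s: "\<And>n. \<bar>s n\<bar> \<le> 1"
    and \<tau>: "0 \<le> \<tau>"
  shows "(norm (\<Sum>n<N. s n *\<^sub>R y n))\<^sup>2 \<le> N * M\<^sup>2 + (real N)\<^sup>2 * \<tau>"
proof -
  define T where "T = (\<Sum>n<N. s n *\<^sub>R y n)"
  have orth': "norm (adj (y n) o\<^sub>L y m) \<le> \<tau> + (if m = n then M\<^sup>2 else 0)" for m n
  proof -
    consider "m < n" | "m = n" | "n < m" by linarith
    then show ?thesis
    proof cases
      case 2
      have "norm (adj (y n) o\<^sub>L y n) \<le> M * M" by (rule norm_blinfun_compose_le) (simp_all add: bound)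
      then show ?thesis using 2 \<tau> by (simp add: power2_eq_square)
    next
      case 3
      have "adj (y n) o\<^sub>L y m = adj (adj (y m) o\<^sub>L y n)" by (simp add: adj_compose)
      then show ?thesis using 3 orth[of n m] by simp
    qed (use orth in simp)
  qed
  have "(norm T)\<^sup>2 \<le> norm (adj T o\<^sub>L T)" by (rule power2_norm_le_adj_compose)
  also have "adj T o\<^sub>L T = (\<Sum>n<N. \<Sum>m<N. s m *\<^sub>R s n *\<^sub>R (adj (y n) o\<^sub>L y m))"
    by (simp add: T_def adj_sum adj_scaleR compose_simps scaleR_sum_right)
       (rule sum.swap)
  also have "norm \<dots> \<le> (\<Sum>n<N. \<Sum>m<N. norm (s m *\<^sub>R s n *\<^sub>R (adj (y n) o\<^sub>L y m)))"
    by (rule order_trans[OF norm_sum]) (intro sum_mono norm_sum)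
  also have "\<dots> \<le> (\<Sum>n<N. \<Sum>m<N. \<tau> + (if m = n then M\<^sup>2 else 0))"
  proof (intro sum_mono)
    fix m n
    have "\<bar>s m\<bar> * (\<bar>s n\<bar> * norm (adj (y n) o\<^sub>L y m)) \<le> 1 * (1 * norm (adj (y n) o\<^sub>L y m))"
      by (intro mult_mono s) auto
    then show "norm (s m *\<^sub>R s n *\<^sub>R (adj (y n) o\<^sub>L y m)) \<le> \<tau> + (if m = n then M\<^sup>2 else 0)"
      using orth'[of n m] by (auto simp: abs_mult mult.assoc)
  qed
  also have "\<dots> = N * M\<^sup>2 + (real N)\<^sup>2 * \<tau>"
    by (simp add: sum.distrib power2_eq_square algebra_simps)
  finally show ?thesis by (simp add: T_def)
qed

lemma sequence_along_filter:
  assumes "F \<noteq> bot" and Y: "eventually (\<lambda>t. t \<in> Y) F"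
    and R: "\<And>s. s \<in> Y \<Longrightarrow> eventually (\<lambda>t. R s t) F"
  shows "\<exists>t::nat \<Rightarrow> 'i. \<forall>n. t n \<in> Y \<and> (\<forall>m<n. R (t m) (t n))"
proof (rule dependent_wellorder_choice[where P = "\<lambda>f (n::nat) t. t \<in> Y \<and> (\<forall>m<n. R (f m) t)"])
    fix f :: "nat \<Rightarrow> 'i" and n :: nat
    assume *: "\<And>m. m < n \<Longrightarrow> f m \<in> Y \<and> (\<forall>k<m. R (f k) (f m))"
    have "eventually (\<lambda>t. \<forall>m\<in>{..<n}. R (f m) t) F"
      by (rule eventually_ball_finite) (use * R in auto)
    with Y have "eventually (\<lambda>t. t \<in> Y \<and> (\<forall>m\<in>{..<n}. R (f m) t)) F" by (rule eventually_conj)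
    then obtain t where "t \<in> Y \<and> (\<forall>m\<in>{..<n}. R (f m) t)"
      using assms(1) eventually_happens' by blast
    then show "\<exists>t. t \<in> Y \<and> (\<forall>m<n. R (f m) t)" by auto
qed simp

text \<open>Averages of \<open>N\<close> bounded operators with nearly orthogonal ranges have norm of order
  \<open>1 / sqrt N\<close>. A functional that stayed away from \<open>0\<close> on the family would, after a choice of
  signs, stay away from \<open>0\<close> on such averages.\<close>

lemma functional_tendsto_0_if_almost_orthogonal:
  fixes g :: "'i \<Rightarrow> ('h::{real_inner,complete_space} \<Rightarrow>\<^sub>L 'h)" and f :: "('h \<Rightarrow>\<^sub>L 'h) \<Rightarrow> real"
  assumes V: "subspace V"
    and f_add: "\<And>a b. a \<in> V \<Longrightarrow> b \<in> V \<Longrightarrow> f (a + b) = f a + f b"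
    and f_scaleR: "\<And>r a. a \<in> V \<Longrightarrow> f (r *\<^sub>R a) = r * f a"
    and f_bound: "\<And>a. a \<in> V \<Longrightarrow> \<bar>f a\<bar> \<le> K * norm a"
    and gV: "eventually (\<lambda>t. t \<in> Y) F" "\<And>t. t \<in> Y \<Longrightarrow> g t \<in> V" "\<And>t. t \<in> Y \<Longrightarrow> norm (g t) \<le> M"
    and orth: "\<And>s. s \<in> Y \<Longrightarrow> ((\<lambda>t. adj (g t) o\<^sub>L g s) \<longlongrightarrow> 0) F"
  shows "((\<lambda>t. f (g t)) \<longlongrightarrow> 0) F"
proof (rule ccontr)
  assume "\<not> ?thesis"
  then obtain \<delta> where \<delta>: "\<delta> > 0" and nev: "\<not> eventually (\<lambda>t. \<bar>f (g t)\<bar> < \<delta>) F"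
    unfolding tendsto_iff by (auto simp: dist_norm)
  (* A refinement of F along which f stays away from 0. *)
  define F' where "F' = inf F (principal {t. \<bar>f (g t)\<bar> \<ge> \<delta>})"
  have F': "F' \<noteq> bot"
    using nev unfolding F'_def trivial_limit_def eventually_inf_principal by (simp add: not_le)
  have F'F: "eventually P F'" if "eventually P F" for P
    using that unfolding F'_def eventually_inf_principal by (rule eventually_mono) simp
  define Y' where "Y' = {t \<in> Y. \<bar>f (g t)\<bar> \<ge> \<delta>}"
  have Y': "eventually (\<lambda>t. t \<in> Y') F'"
    using gV(1) unfolding F'_def eventually_inf_principal by (rule eventually_mono) (simp add: Y'_def)
  define K' M' where "K' = max K 1" and "M' = max M 1"
  have K': "\<bar>f a\<bar> \<le> K' * norm a" if "a \<in> V" for a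
    using f_bound[OF that] mult_right_mono[of K K' "norm a"] by (simp add: K'_def)
  have M': "norm (g t) \<le> M'" if "t \<in> Y" for t
    using gV(3)[OF that] by (simp add: M'_def)
  obtain N :: nat where N: "real N > K'\<^sup>2 * (M'\<^sup>2 + 1) / \<delta>\<^sup>2"
    using reals_Archimedean2 by blast
  moreover have "K'\<^sup>2 * (M'\<^sup>2 + 1) / \<delta>\<^sup>2 \<ge> 0" by simp
  ultimately have N0: "real N > 0" by linarith
  have "eventually (\<lambda>t. norm (adj (g t) o\<^sub>L g s) \<le> 1 / real N) F'" if "s \<in> Y'" for s
  proof -
    have "eventually (\<lambda>t. dist (adj (g t) o\<^sub>L g s) 0 < 1 / real N) F'"
      using that N0 by (intro F'F tendstoD[OF orth]) (auto simp: Y'_def)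
    then show ?thesis by (rule eventually_mono) simp
  qed
  then have "\<exists>t::nat \<Rightarrow> 'i. \<forall>n. t n \<in> Y' \<and> (\<forall>m<n. norm (adj (g (t n)) o\<^sub>L g (t m)) \<le> 1 / real N)"
    by (rule sequence_along_filter[OF F' Y'])
  then obtain t :: "nat \<Rightarrow> 'i" where t: "\<And>n. t n \<in> Y'"
    and to: "\<And>m n. m < n \<Longrightarrow> norm (adj (g (t n)) o\<^sub>L g (t m)) \<le> 1 / real N"
    by blast
  define s where "s n = sgn (f (g (t n)))" for n
  define T where "T = (\<Sum>n<N. s n *\<^sub>R g (t n))"
  have gtV: "g (t n) \<in> V" for n using t gV(2) by (simp add: Y'_def)
  have fT: "T \<in> V \<and> f T = (\<Sum>n<N. \<bar>f (g (t n))\<bar>)"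
    unfolding T_def
  proof (induction N)
    case 0
    show ?case using subspace_0[OF V] f_scaleR[of 0 0] by simp
  next
    case (Suc n)
    have "s n *\<^sub>R g (t n) \<in> V" using gtV V by (simp add: subspace_scale)
    moreover have "f (s n *\<^sub>R g (t n)) = \<bar>f (g (t n))\<bar>"
      using f_scaleR[OF gtV] by (simp add: s_def abs_sgn mult.commute)
    ultimately show ?case using Suc V by (simp add: f_add subspace_add)
  qed
  have "(norm T)\<^sup>2 \<le> N * M'\<^sup>2 + (real N)\<^sup>2 * (1 / real N)"
    unfolding T_def
  proof (rule norm_sum_almost_orthogonal)
    show "norm (g (t n)) \<le> M'" for n using M' t by (simp add: Y'_def)
    show "\<bar>s n\<bar> \<le> 1" for n by (simp add: s_def sgn_if)
    show "norm (adj (g (t n)) o\<^sub>L g (t m)) \<le> 1 / real N" if "m < n" for m n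
      using that by (rule to)
  qed simp
  also have "\<dots> = N * (M'\<^sup>2 + 1)" using N0 by (simp add: power2_eq_square algebra_simps)
  finally have T2: "(norm T)\<^sup>2 \<le> N * (M'\<^sup>2 + 1)" .
  have "N * \<delta> = (\<Sum>n<N. \<delta>)" by simp
  also have "\<dots> \<le> (\<Sum>n<N. \<bar>f (g (t n))\<bar>)"
    using t by (intro sum_mono) (simp add: Y'_def)
  also have "\<dots> = f T" using fT by simp
  also have "\<dots> \<le> K' * norm T" using K'[of T] fT by simp
  finally have "(N * \<delta>)\<^sup>2 \<le> (K' * norm T)\<^sup>2" using \<delta> by (intro power_mono) auto
  also have "\<dots> \<le> K'\<^sup>2 * (N * (M'\<^sup>2 + 1))"
    unfolding power_mult_distrib by (intro mult_left_mono T2) auto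
  finally have "N * (N * \<delta>\<^sup>2) \<le> N * (K'\<^sup>2 * (M'\<^sup>2 + 1))"
    by (simp add: power2_eq_square algebra_simps)
  then have "N * \<delta>\<^sup>2 \<le> K'\<^sup>2 * (M'\<^sup>2 + 1)" using N0 by simp
  moreover have "N * \<delta>\<^sup>2 > K'\<^sup>2 * (M'\<^sup>2 + 1)" using N \<delta> by (simp add: pos_divide_less_eq)
  ultimately show False by linarith
qed

section \<open>Left contractive approximate identities\<close>

lemma left_contractive_approx_identityD:
  assumes "left_contractive_approx_identity J F"
  shows "F \<noteq> bot" "eventually (\<lambda>e. e \<in> {e \<in> J. norm e \<le> 1}) F"
    "y \<in> J \<Longrightarrow> ((\<lambda>e. e o\<^sub>L y) \<longlongrightarrow> y) F"
  using assms by (auto simp: left_contractive_approx_identity_def net_in_def le_principal)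

text \<open>For a contraction \<open>e\<close>, expanding the square bounds the square of the norm of \<open>e\<^sup>* v - v\<close>
  by \<open>2 inner (v - e v) v\<close>.\<close>

lemma norm_diff_adj_compose:
  fixes e y :: "'h::{real_inner,complete_space} \<Rightarrow>\<^sub>L 'h"
  assumes e: "norm e \<le> 1"
  shows "norm ((adj e o\<^sub>L y) - y) \<le> sqrt (2 * norm y * norm ((e o\<^sub>L y) - y))"
proof (rule norm_blinfun_bound)
  fix x
  define v where "v = blinfun_apply y x"
  have ev: "norm (adj e v) \<le> norm v"
    using norm_blinfun[of "adj e" v] mult_right_mono[OF e, of "norm v"] by simp
  have "(norm (adj e v - v))\<^sup>2 = (norm (adj e v))\<^sup>2 - 2 * inner v (adj e v) + (norm v)\<^sup>2"
    by (simp add: power2_norm_eq_inner inner_diff inner_commute)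
  also have "\<dots> \<le> 2 * (norm v)\<^sup>2 - 2 * inner (e v) v"
    using power_mono[OF ev, of 2] by (simp add: inner_adj)
  also have "\<dots> = 2 * inner (v - e v) v"
    by (simp add: power2_norm_eq_inner inner_diff)
  also have "\<dots> \<le> 2 * (norm (v - e v) * norm v)"
    by (intro mult_left_mono norm_cauchy_schwarz) simp
  also have "norm (v - e v) = norm (((e o\<^sub>L y) - y) x)"
    unfolding norm_minus_commute[of v] by (simp add: v_def blinfun.bilinear_simps)
  also have "2 * (norm (((e o\<^sub>L y) - y) x) * norm v)
      \<le> 2 * ((norm ((e o\<^sub>L y) - y) * norm x) * (norm y * norm x))"
    unfolding v_def by (intro mult_left_mono mult_mono norm_blinfun) auto
  also have "\<dots> = (sqrt (2 * norm y * norm ((e o\<^sub>L y) - y)) * norm x)\<^sup>2"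
    by (simp add: power_mult_distrib) (simp add: power2_eq_square mult_ac)
  finally have "norm (adj e v - v) \<le> sqrt (2 * norm y * norm ((e o\<^sub>L y) - y)) * norm x"
    by (rule power2_le_imp_le) simp
  then show "norm (((adj e o\<^sub>L y) - y) x) \<le> sqrt (2 * norm y * norm ((e o\<^sub>L y) - y)) * norm x"
    by (simp add: v_def blinfun.bilinear_simps)
qed simp

lemma left_cai_adj_tendsto:
  assumes F: "left_contractive_approx_identity J F" and y: "y \<in> J"
  shows "((\<lambda>e. adj e o\<^sub>L y) \<longlongrightarrow> y) F"
proof -
  have "((\<lambda>e. (e o\<^sub>L y) - y) \<longlongrightarrow> 0) F"
    using left_contractive_approx_identityD(3)[OF F y] by (simp add: LIM_zero)
  then have "((\<lambda>e. sqrt (2 * norm y * norm ((e o\<^sub>L y) - y))) \<longlongrightarrow> sqrt (2 * norm y * 0)) F"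
    by (intro tendsto_real_sqrt tendsto_mult tendsto_const tendsto_norm_zero)
  then have "((\<lambda>e. sqrt (2 * norm y * norm ((e o\<^sub>L y) - y))) \<longlongrightarrow> 0) F" by simp
  moreover have "eventually (\<lambda>e. norm ((adj e o\<^sub>L y) - y) \<le> sqrt (2 * norm y * norm ((e o\<^sub>L y) - y))) F"
    using left_contractive_approx_identityD(2)[OF F]
    by (rule eventually_mono) (simp add: norm_diff_adj_compose)
  ultimately have "((\<lambda>e. (adj e o\<^sub>L y) - y) \<longlongrightarrow> 0) F"
    by (rule Lim_null_comparison[rotated])
  then show ?thesis by (simp add: LIM_zero_iff)
qed

lemma left_cai_positive_tendsto:
  assumes F: "left_contractive_approx_identity J F" and y: "y \<in> J"
  shows "((\<lambda>e. (e o\<^sub>L adj e) o\<^sub>L y) \<longlongrightarrow> y) F"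
proof -
  have "((\<lambda>e. norm ((adj e o\<^sub>L y) - y) + norm ((e o\<^sub>L y) - y)) \<longlongrightarrow> 0) F"
    using left_cai_adj_tendsto[OF F y] left_contractive_approx_identityD(3)[OF F y]
    by (intro tendsto_add_zero tendsto_norm_zero) (simp_all add: LIM_zero)
  moreover have "eventually (\<lambda>e. norm (((e o\<^sub>L adj e) o\<^sub>L y) - y)
      \<le> norm ((adj e o\<^sub>L y) - y) + norm ((e o\<^sub>L y) - y)) F"
    using left_contractive_approx_identityD(2)[OF F]
  proof (rule eventually_mono)
    fix e :: "'a \<Rightarrow>\<^sub>L 'a" assume "e \<in> {e \<in> J. norm e \<le> 1}"
    then have le: "norm (e o\<^sub>L ((adj e o\<^sub>L y) - y)) \<le> 1 * norm ((adj e o\<^sub>L y) - y)"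
      by (intro norm_blinfun_compose_le) auto
    have eq: "((e o\<^sub>L adj e) o\<^sub>L y) - y = (e o\<^sub>L ((adj e o\<^sub>L y) - y)) + ((e o\<^sub>L y) - y)"
      by (rule blinfun_eqI) (simp add: blinfun.bilinear_simps)
    show "norm (((e o\<^sub>L adj e) o\<^sub>L y) - y) \<le> norm ((adj e o\<^sub>L y) - y) + norm ((e o\<^sub>L y) - y)"
      unfolding eq using le norm_triangle_ineq[of "e o\<^sub>L ((adj e o\<^sub>L y) - y)" "(e o\<^sub>L y) - y"]
      by linarith
  qed
  ultimately have "((\<lambda>e. ((e o\<^sub>L adj e) o\<^sub>L y) - y) \<longlongrightarrow> 0) F"
    by (rule Lim_null_comparison[rotated])
  then show ?thesis by (simp add: LIM_zero_iff)
qed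

section \<open>Partitions of the identity by almost invariant positive contractions\<close>

lemma norm_positive_partition:
  fixes e :: "'h::{real_inner,complete_space} \<Rightarrow>\<^sub>L 'h"
  assumes e: "norm e \<le> 1"
  shows "(norm ((e o\<^sub>L adj e) v))\<^sup>2 + (norm (v - (e o\<^sub>L adj e) v))\<^sup>2 \<le> (norm v)\<^sup>2"
proof -
  have "norm (e (adj e v)) \<le> norm (adj e v)"
    using norm_blinfun[of e "adj e v"] mult_right_mono[OF e, of "norm (adj e v)"] by simp
  then have "inner (e (adj e v)) (e (adj e v)) \<le> inner (adj e v) (adj e v)" by (simp add: norm_le)
  also have "\<dots> = inner (e (adj e v)) v" by (simp add: inner_adj)
  finally show ?thesis
    by (simp add: power2_norm_eq_inner inner_diff inner_commute)
qed

text \<open>With \<open>h = e e\<^sup>*\<close> and \<open>h' = e' e'\<^sup>*\<close>, the operator below is the composition of the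
  contractive column \<open>(h, 1 - h)\<close>, the diagonal operator \<open>diag(S, 1)\<close> and the contractive row
  \<open>(h', 1 - h')\<close>.\<close>

lemma norm_partition_sandwich_le_1:
  fixes e e' S :: "'h::{real_inner,complete_space} \<Rightarrow>\<^sub>L 'h"
  assumes e: "norm e \<le> 1" "norm e' \<le> 1" and S: "norm S \<le> 1"
  defines "h \<equiv> e o\<^sub>L adj e" and "h' \<equiv> e' o\<^sub>L adj e'"
  shows "norm ((h' o\<^sub>L S o\<^sub>L h) + ((id_blinfun - h') o\<^sub>L (id_blinfun - h))) \<le> 1" (is "norm ?b \<le> 1")
proof (rule norm_blinfun_bound)
  fix v
  define w where "w = blinfun_apply ?b v"
  have sa: "inner (h' a) b = inner a (h' b)" for a b
    by (metis h'_def adj_adj adj_compose inner_adj)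
  have Sv: "norm (S (h v)) \<le> norm (h v)"
    using norm_blinfun[of S "h v"] mult_right_mono[OF S, of "norm (h v)"] by simp
  have "inner w w = inner (S (h v)) (h' w) + inner (v - h v) (w - h' w)"
  proof -
    have "w = h' (S (h v)) + ((v - h v) - h' (v - h v))"
      by (simp add: w_def blinfun.bilinear_simps)
    then have "inner w w = inner (h' (S (h v)) + ((v - h v) - h' (v - h v))) w" by simp
    then show ?thesis by (simp only: inner_add_left inner_diff_left inner_diff_right sa)
  qed
  also have "\<dots> \<le> norm (h v) * norm (h' w) + norm (v - h v) * norm (w - h' w)"
    using mult_right_mono[OF Sv, of "norm (h' w)"] norm_cauchy_schwarz[of "S (h v)" "h' w"]
      norm_cauchy_schwarz[of "v - h v" "w - h' w"] by simp
  also have "\<dots> \<le> norm v * norm w"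
  proof (rule power2_le_imp_le)
    have cs: "(a * b + c * d)\<^sup>2 \<le> (a\<^sup>2 + c\<^sup>2) * (b\<^sup>2 + d\<^sup>2)" for a b c d :: real
      using zero_le_power2[of "a * d - c * b"] by (simp add: power2_eq_square algebra_simps)
    have "(norm (h v) * norm (h' w) + norm (v - h v) * norm (w - h' w))\<^sup>2
        \<le> ((norm (h v))\<^sup>2 + (norm (v - h v))\<^sup>2) * ((norm (h' w))\<^sup>2 + (norm (w - h' w))\<^sup>2)"
      by (rule cs)
    also have "\<dots> \<le> (norm v)\<^sup>2 * (norm w)\<^sup>2"
      using norm_positive_partition[OF e(1), of v] norm_positive_partition[OF e(2), of w]
      by (intro mult_mono) (auto simp: h_def h'_def)
    finally show "(norm (h v) * norm (h' w) + norm (v - h v) * norm (w - h' w))\<^sup>2 \<le> (norm v * norm w)\<^sup>2"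
      by (simp add: power_mult_distrib)
  qed simp
  finally have "norm w * norm w \<le> norm v * norm w" by (simp add: power2_norm_eq_inner flip: power2_eq_square)
  then show "norm (?b v) \<le> 1 * norm v" by (cases "norm w = 0") (auto simp: w_def)
qed simp

lemma norm_id_minus_positive_le_1:
  fixes e :: "'h::{real_inner,complete_space} \<Rightarrow>\<^sub>L 'h"
  assumes "norm e \<le> 1"
  shows "norm (id_blinfun - (e o\<^sub>L adj e)) \<le> 1"
proof (rule norm_blinfun_bound)
  fix v
  have "(norm (v - (e o\<^sub>L adj e) v))\<^sup>2 \<le> (norm v)\<^sup>2"
    using norm_positive_partition[OF assms, of v] zero_le_power2[of "norm ((e o\<^sub>L adj e) v)"] by linarith
  then have "norm (v - (e o\<^sub>L adj e) v) \<le> norm v" by (rule power2_le_imp_le) simp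
  then show "norm ((id_blinfun - (e o\<^sub>L adj e)) v) \<le> 1 * norm v"
    by (simp add: blinfun.bilinear_simps)
qed simp

lemma sum_shift_telescope: "(\<Sum>n<N. f (Suc n)) = (\<Sum>n<N. f n) + f N - f 0"
  for f :: "nat \<Rightarrow> 'a::ab_group_add"
  by (induction N) (simp_all add: algebra_simps)

lemma norm_average_le:
  fixes f :: "nat \<Rightarrow> 'a::real_normed_vector"
  assumes "\<And>n. norm (f n) \<le> b" "0 < N"
  shows "norm ((1 / real N) *\<^sub>R (\<Sum>n<N. f n)) \<le> b"
proof -
  have "norm (\<Sum>n<N. f n) \<le> (\<Sum>n<N. b)"
    by (rule order_trans[OF norm_sum]) (intro sum_mono assms)
  then show ?thesis using assms(2) by (simp add: field_simps)
qed

lemma norm_average_telescope_le: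
  fixes f :: "nat \<Rightarrow> 'a::real_normed_vector"
  assumes "\<And>n. norm (f n) \<le> 1" "0 < N"
  shows "norm ((1 / real N) *\<^sub>R (\<Sum>n<N. f n - f (Suc n))) \<le> 2 / N"
proof -
  have eq: "(\<Sum>n<N. f n - f (Suc n)) = f 0 - f N"
    by (simp add: sum_subtractf sum_shift_telescope)
  have "norm (f 0 - f N) \<le> 2"
    using norm_triangle_ineq4[of "f 0" "f N"] assms(1)[of 0] assms(1)[of N] by linarith
  then show ?thesis using assms(2) unfolding eq by (simp add: divide_right_mono)
qed

section \<open>Averages along an approximate identity\<close>

text \<open>This is the passage from a regularity element \<open>x\<close> of norm at most \<open>1 + \<epsilon>\<close> to one of norm
  close to \<open>1\<close>. If \<open>Q\<close> were a projection whose range contains that of \<open>1 - x\<close>, then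
  \<open>1 - Q + c x Q\<close> with \<open>c = 1 / (1 + \<epsilon>)\<close> would be block diagonal and hence a contraction. Its
  distance to \<open>x\<close> would be of order \<open>sqrt \<epsilon>\<close>, because \<open>x\<close> is \<open>1\<close> plus an operator into the range of
  \<open>Q\<close> on the orthogonal complement of that range, and \<open>norm x \<le> 1 + \<epsilon>\<close> leaves little room for that operator.
  Such a projection is replaced by the average \<open>E\<close> of a sequence \<open>e\<close> in which \<open>h n = e n (e n)\<^sup>*\<close>
  almost fixes \<open>y = (1 - x) u\<close> and everything built from \<open>e m\<close> with \<open>m < n\<close>; the right factor \<open>u\<close>
  stands in for an identity element. As the operators \<open>e n - h n\<close> have almost orthogonal ranges,
  \<open>E\<close> is close to the average \<open>H\<close> of the positive contractions \<open>h n\<close>, and each \<open>h n\<close> acts like a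
  projection up to differences of consecutive terms, which telescope in the average.\<close>

locale averaging =
  fixes x u y E H :: "'h::{real_inner,complete_space} \<Rightarrow>\<^sub>L 'h"
    and e h d :: "nat \<Rightarrow> 'h \<Rightarrow>\<^sub>L 'h"
    and N :: nat and \<epsilon> \<tau> c \<rho> :: real
  assumes e: "\<And>n. norm (e n) \<le> 1" and u: "norm u \<le> 1" and x: "norm x \<le> 1 + \<epsilon>"
    and \<epsilon>: "0 \<le> \<epsilon>" and \<tau>: "0 \<le> \<tau>" and N: "0 < N"
    and y_def: "y = u - (x o\<^sub>L u)"
    and h_def: "\<And>n. h n = e n o\<^sub>L adj (e n)"
    and d_def: "\<And>n. d n = e n - (x o\<^sub>L e n)"
    and fix_y: "\<And>n. norm ((h n o\<^sub>L y) - y) \<le> \<tau>"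
    and fix_e: "\<And>m n. m < n \<Longrightarrow> norm ((h n o\<^sub>L e m) - e m) \<le> \<tau>"
    and fix_d: "\<And>m n. m < n \<Longrightarrow> norm ((h n o\<^sub>L d m) - d m) \<le> \<tau>"
    and orth: "\<And>m n. m < n \<Longrightarrow> norm (adj (e n - h n) o\<^sub>L (e m - h m)) \<le> \<tau>"
    and E_def: "E = (1 / real N) *\<^sub>R (\<Sum>n<N. e n)"
    and H_def: "H = (1 / real N) *\<^sub>R (\<Sum>n<N. h n)"
    and c_def: "c = 1 / (1 + \<epsilon>)"
    and \<rho>_def: "\<rho> = sqrt (4 / N + \<tau>)"
begin

lemma norm_h: "norm (h n) \<le> 1"
  using norm_blinfun_compose_le[of "e n" 1 "adj (e n)" 1] e[of n] by (simp add: h_def)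

lemma c: "0 < c" "c \<le> 1" "c * (1 + \<epsilon>) = 1" "c * norm x \<le> 1"
proof -
  show 1: "0 < c" "c \<le> 1" "c * (1 + \<epsilon>) = 1" using \<epsilon> by (auto simp: c_def)
  show "c * norm x \<le> 1" using mult_left_mono[OF x, of c] 1 by simp
qed

lemma norm_E_minus_H: "norm (E - H) \<le> \<rho>"
proof -
  have "norm (e n - h n) \<le> 2" for n
    using norm_triangle_ineq4[of "e n" "h n"] e[of n] norm_h[of n] by linarith
  then have "(norm (\<Sum>n<N. 1 *\<^sub>R (e n - h n)))\<^sup>2 \<le> real N * 2\<^sup>2 + (real N)\<^sup>2 * \<tau>"
    by (rule norm_sum_almost_orthogonal[where s = "\<lambda>_. 1"]) (simp_all add: orth \<tau>)
  also have "\<dots> = (real N)\<^sup>2 * (4 / N + \<tau>)"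
    using N by (simp add: distrib_left power2_eq_square)
  also have "\<dots> = (real N * \<rho>)\<^sup>2"
    using \<tau> by (simp add: \<rho>_def power_mult_distrib)
  finally have "norm (\<Sum>n<N. 1 *\<^sub>R (e n - h n)) \<le> real N * \<rho>"
    by (rule power2_le_imp_le) (use \<tau> in \<open>simp add: \<rho>_def\<close>)
  moreover have "E - H = (1 / real N) *\<^sub>R (\<Sum>n<N. e n - h n)"
    by (simp add: E_def H_def sum_subtractf algebra_simps)
  ultimately show ?thesis using N by (simp add: field_simps)
qed

lemma norm_h_h: "norm (h n - (h (Suc n) o\<^sub>L h n)) \<le> \<tau>"
proof -
  have "h n - (h (Suc n) o\<^sub>L h n) = - (((h (Suc n) o\<^sub>L e n) - e n) o\<^sub>L adj (e n))"
    by (rule blinfun_eqI) (simp add: blinfun.bilinear_simps h_def[of n])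
  moreover have "norm (((h (Suc n) o\<^sub>L e n) - e n) o\<^sub>L adj (e n)) \<le> \<tau> * 1"
    using fix_e[of n "Suc n"] e[of n] by (intro norm_blinfun_compose_le) auto
  ultimately show ?thesis by simp
qed

lemma norm_E_u: "norm (E o\<^sub>L u) \<le> 1"
proof -
  have "norm E \<le> 1" unfolding E_def using e N by (rule norm_average_le)
  then show ?thesis using norm_blinfun_compose_le[of E 1 u 1] u by simp
qed

lemma norm_combination_le:
  "norm (id_blinfun - H + c *\<^sub>R (x o\<^sub>L H)) \<le> 1 + 3 * \<tau> + 2 / N"
proof -
  (* h (n + 1) x h n is close to x h n, and (1 - h (n + 1)) (1 - h n) to 1 - h (n + 1), so r n is
     close to a contraction of the sandwich form. *)
  define r where "r n = id_blinfun - h (Suc n) + c *\<^sub>R (x o\<^sub>L h n)" for n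
  have r: "norm (r n) \<le> 1 + 3 * \<tau>" for n
  proof -
    define b where "b = (h (Suc n) o\<^sub>L (c *\<^sub>R x) o\<^sub>L h n)
      + ((id_blinfun - h (Suc n)) o\<^sub>L (id_blinfun - h n))"
    have b: "norm b \<le> 1"
      unfolding b_def h_def using e c by (intro norm_partition_sandwich_le_1) auto
    define s where "s = (((h (Suc n) o\<^sub>L d n) - d n) - ((h (Suc n) o\<^sub>L e n) - e n)) o\<^sub>L adj (e n)"
    have "norm (((h (Suc n) o\<^sub>L d n) - d n) - ((h (Suc n) o\<^sub>L e n) - e n)) \<le> 2 * \<tau>"
      using norm_triangle_ineq4[of "(h (Suc n) o\<^sub>L d n) - d n" "(h (Suc n) o\<^sub>L e n) - e n"]
        fix_d[of n "Suc n"] fix_e[of n "Suc n"] by simp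
    then have "norm s \<le> 2 * \<tau> * 1"
      unfolding s_def using e[of n] by (intro norm_blinfun_compose_le) auto
    then have cs: "norm (c *\<^sub>R s) \<le> 2 * \<tau>"
      using mult_mono[of c 1 "norm s" "2 * \<tau>"] c by simp
    have "r n = b + c *\<^sub>R s + (h n - (h (Suc n) o\<^sub>L h n))"
      by (rule blinfun_eqI)
         (simp add: r_def b_def s_def d_def h_def[of n] blinfun.bilinear_simps algebra_simps)
    then show ?thesis
      using b cs norm_h_h[of n] norm_triangle_ineq[of b "c *\<^sub>R s"]
        norm_triangle_ineq[of "b + c *\<^sub>R s" "h n - (h (Suc n) o\<^sub>L h n)"] by simp
  qed
  have "norm ((1 / real N) *\<^sub>R (\<Sum>n<N. r n)) \<le> 1 + 3 * \<tau>" using r N by (rule norm_average_le)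
  moreover have "id_blinfun - H + c *\<^sub>R (x o\<^sub>L H) =
      (1 / real N) *\<^sub>R (\<Sum>n<N. r n) - (1 / real N) *\<^sub>R (\<Sum>n<N. h n - h (Suc n))"
  proof -
    have eq: "(\<Sum>n<N. r n) = real N *\<^sub>R id_blinfun - (\<Sum>n<N. h (Suc n)) + c *\<^sub>R (x o\<^sub>L (\<Sum>n<N. h n))"
      by (simp add: r_def sum.distrib sum_subtractf compose_simps scaleR_sum_right sum_constant_scaleR)
    show ?thesis
      unfolding H_def sum_subtractf eq using N by (simp add: compose_simps(1-6) algebra_simps)
  qed
  moreover have "norm ((1 / real N) *\<^sub>R (\<Sum>n<N. h n - h (Suc n))) \<le> 2 / N"
    using norm_h N by (rule norm_average_telescope_le)
  ultimately show ?thesis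
    using norm_triangle_ineq4[of "(1 / real N) *\<^sub>R (\<Sum>n<N. r n)" "(1 / real N) *\<^sub>R (\<Sum>n<N. h n - h (Suc n))"]
    by simp
qed

lemma norm_corrected_le:
  "norm (u - (E o\<^sub>L u) + c *\<^sub>R (x o\<^sub>L E o\<^sub>L u)) \<le> 1 + 3 * \<tau> + 2 / N + 2 * \<rho>"
proof -
  have "norm (c *\<^sub>R (x o\<^sub>L (E - H))) \<le> c * (norm x * norm (E - H))"
    using c norm_blinfun_compose[of x "E - H"] by (simp add: mult_left_mono)
  also have "\<dots> = (c * norm x) * norm (E - H)" by simp
  also have "\<dots> \<le> 1 * \<rho>" using c(4) norm_E_minus_H by (intro mult_mono) auto
  finally have 1: "norm (c *\<^sub>R (x o\<^sub>L (E - H))) \<le> \<rho>" by simp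
  have eq: "id_blinfun - E + c *\<^sub>R (x o\<^sub>L E)
      = (id_blinfun - H + c *\<^sub>R (x o\<^sub>L H)) - (E - H) + c *\<^sub>R (x o\<^sub>L (E - H))"
    by (simp add: compose_simps algebra_simps)
  have "norm (id_blinfun - E + c *\<^sub>R (x o\<^sub>L E)) \<le> 1 + 3 * \<tau> + 2 / N + 2 * \<rho>"
    unfolding eq
    using norm_triangle_ineq4[of "id_blinfun - H + c *\<^sub>R (x o\<^sub>L H)" "E - H"]
      norm_triangle_ineq[of "(id_blinfun - H + c *\<^sub>R (x o\<^sub>L H)) - (E - H)" "c *\<^sub>R (x o\<^sub>L (E - H))"]
      norm_combination_le norm_E_minus_H 1 by linarith
  then have "norm ((id_blinfun - E + c *\<^sub>R (x o\<^sub>L E)) o\<^sub>L u) \<le> (1 + 3 * \<tau> + 2 / N + 2 * \<rho>) * 1"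
    using u by (intro norm_blinfun_compose_le)
  moreover have "(id_blinfun - E + c *\<^sub>R (x o\<^sub>L E)) o\<^sub>L u = u - (E o\<^sub>L u) + c *\<^sub>R (x o\<^sub>L E o\<^sub>L u)"
    by (rule blinfun_eqI) (simp add: blinfun.bilinear_simps)
  ultimately show ?thesis by simp
qed

abbreviation w where "w n \<equiv> u - (h n o\<^sub>L u)"
abbreviation z where "z n \<equiv> w n - (x o\<^sub>L w n)"

lemma norm_w: "norm (w n) \<le> 1"
proof -
  have "w n = (id_blinfun - h n) o\<^sub>L u"
    by (rule blinfun_eqI) (simp add: blinfun.bilinear_simps)
  then show ?thesis
    using norm_blinfun_compose_le[OF norm_id_minus_positive_le_1[OF e[of n]] u] by (simp add: h_def)
qed

lemma norm_h_z: "norm ((h (Suc n) o\<^sub>L z n) - z n) \<le> 2 * \<tau>"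
proof -
  define s where "s = ((h (Suc n) o\<^sub>L d n) - d n) o\<^sub>L (adj (e n) o\<^sub>L u)"
  have "norm s \<le> \<tau> * (1 * 1)"
    unfolding s_def using fix_d[of n "Suc n"] e[of n] u by (intro norm_blinfun_compose_le) auto
  moreover have "(h (Suc n) o\<^sub>L z n) - z n = ((h (Suc n) o\<^sub>L y) - y) - s"
    by (rule blinfun_eqI)
       (simp add: s_def y_def d_def h_def[of n] blinfun.bilinear_simps algebra_simps)
  ultimately show ?thesis
    using norm_triangle_ineq4[of "(h (Suc n) o\<^sub>L y) - y" s] fix_y[of "Suc n"] by simp
qed

lemma norm_h_w: "norm (w n - w (Suc n) - (h (Suc n) o\<^sub>L w n)) \<le> \<tau>"
proof -
  have "w n - w (Suc n) - (h (Suc n) o\<^sub>L w n) = - ((h n - (h (Suc n) o\<^sub>L h n)) o\<^sub>L u)"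
    by (rule blinfun_eqI) (simp add: blinfun.bilinear_simps)
  moreover have "norm ((h n - (h (Suc n) o\<^sub>L h n)) o\<^sub>L u) \<le> \<tau> * 1"
    using norm_h_h u by (rule norm_blinfun_compose_le)
  ultimately show ?thesis by simp
qed

text \<open>Since \<open>x\<close> agrees with \<open>1\<close> up to the range of \<open>h (n + 1)\<close>, the component of \<open>x w n\<close>
  outside that range has almost the norm of \<open>w (n + 1)\<close>; the bound on \<open>x\<close> leaves little
  room for the component inside.\<close>

lemma norm_h_x_w:
  "(norm ((h (Suc n) o\<^sub>L x o\<^sub>L w n) v))\<^sup>2 \<le>
    (2 * \<epsilon> + \<epsilon>\<^sup>2 + 6 * \<tau> * (1 + \<epsilon>) + 9 * \<tau>\<^sup>2) * (norm v)\<^sup>2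
    + ((norm (w n v))\<^sup>2 - (norm (w (Suc n) v))\<^sup>2)"
proof -
  define s where "s = blinfun_apply x (w n v)"
  define k where "k = s - blinfun_apply (h (Suc n)) s"
  have wv: "norm (w n v) \<le> norm v"
    using norm_blinfun[of "w n" v] mult_right_mono[OF norm_w[of n], of "norm v"] by simp
  have sw: "norm s \<le> (1 + \<epsilon>) * norm (w n v)"
    unfolding s_def using norm_blinfun[of x "w n v"] mult_right_mono[OF x, of "norm (w n v)"] by simp
  also have "\<dots> \<le> (1 + \<epsilon>) * norm v" using wv \<epsilon> by (intro mult_left_mono) auto
  finally have sv: "norm s \<le> (1 + \<epsilon>) * norm v" .
  have part: "(norm (h (Suc n) s))\<^sup>2 + (norm k)\<^sup>2 \<le> (norm s)\<^sup>2"
    unfolding k_def h_def using e by (rule norm_positive_partition)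
  have "(norm k)\<^sup>2 \<le> (norm s)\<^sup>2" using part zero_le_power2[of "norm (h (Suc n) s)"] by linarith
  then have ks: "norm k \<le> norm s" by (rule power2_le_imp_le) simp
  define t where "t = (w n - w (Suc n) - (h (Suc n) o\<^sub>L w n)) + ((h (Suc n) o\<^sub>L z n) - z n)"
  have "norm t \<le> 3 * \<tau>"
    unfolding t_def
    using norm_triangle_ineq[of "w n - w (Suc n) - (h (Suc n) o\<^sub>L w n)" "(h (Suc n) o\<^sub>L z n) - z n"]
      norm_h_w[of n] norm_h_z[of n] by linarith
  then have tv: "norm (t v) \<le> 3 * \<tau> * norm v"
    using norm_blinfun[of t v] mult_right_mono[of "norm t" "3 * \<tau>" "norm v"] by simp
  have "w (Suc n) v = k - t v"
    by (simp add: k_def s_def t_def blinfun.bilinear_simps algebra_simps)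
  then have "norm (w (Suc n) v) \<le> norm k + 3 * \<tau> * norm v"
    using norm_triangle_ineq4[of k "t v"] tv by simp
  then have "(norm (w (Suc n) v))\<^sup>2 \<le> (norm k + 3 * \<tau> * norm v)\<^sup>2"
    by (intro power_mono) auto
  also have "\<dots> = (norm k)\<^sup>2 + 6 * \<tau> * norm v * norm k + 9 * \<tau>\<^sup>2 * (norm v)\<^sup>2"
    by (simp add: power2_eq_square algebra_simps)
  also have "\<dots> \<le> (norm k)\<^sup>2 + 6 * \<tau> * norm v * ((1 + \<epsilon>) * norm v) + 9 * \<tau>\<^sup>2 * (norm v)\<^sup>2"
    using ks sv \<tau> by (intro add_mono mult_left_mono) auto
  finally have w': "(norm (w (Suc n) v))\<^sup>2 \<le>
      (norm k)\<^sup>2 + (6 * \<tau> * (1 + \<epsilon>) + 9 * \<tau>\<^sup>2) * (norm v)\<^sup>2"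
    by (simp add: power2_eq_square algebra_simps)
  have "(norm s)\<^sup>2 \<le> (1 + \<epsilon>)\<^sup>2 * (norm (w n v))\<^sup>2"
    using power_mono[OF sw, of 2] by (simp add: power_mult_distrib)
  also have "\<dots> = (norm (w n v))\<^sup>2 + (2 * \<epsilon> + \<epsilon>\<^sup>2) * (norm (w n v))\<^sup>2"
    by (simp add: power2_eq_square algebra_simps)
  also have "\<dots> \<le> (norm (w n v))\<^sup>2 + (2 * \<epsilon> + \<epsilon>\<^sup>2) * (norm v)\<^sup>2"
    using wv \<epsilon> by (intro add_left_mono mult_left_mono power_mono) auto
  finally have "(norm s)\<^sup>2 \<le> (norm (w n v))\<^sup>2 + (2 * \<epsilon> + \<epsilon>\<^sup>2) * (norm v)\<^sup>2" .
  then have "(norm (h (Suc n) s))\<^sup>2 \<le> (norm (w n v))\<^sup>2 + (2 * \<epsilon> + \<epsilon>\<^sup>2) * (norm v)\<^sup>2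
      + (6 * \<tau> * (1 + \<epsilon>) + 9 * \<tau>\<^sup>2) * (norm v)\<^sup>2 - (norm (w (Suc n) v))\<^sup>2"
    using part w' by linarith
  then show ?thesis by (simp add: s_def algebra_simps)
qed

text \<open>An individual term need not be small, but for every vector the mean of the squares is
  small for small \<open>\<epsilon>\<close> and \<open>\<tau>\<close> and large \<open>N\<close>, as the differences in the preceding bound telescope.\<close>

lemma norm_average_h_x_w:
  "norm ((1 / real N) *\<^sub>R (\<Sum>n<N. h (Suc n) o\<^sub>L x o\<^sub>L w n)) \<le>
    sqrt (2 * \<epsilon> + \<epsilon>\<^sup>2 + 6 * \<tau> * (1 + \<epsilon>) + 9 * \<tau>\<^sup>2 + 1 / real N)"
proof (rule norm_blinfun_bound)
  fix v
  define \<kappa> where "\<kappa> = 2 * \<epsilon> + \<epsilon>\<^sup>2 + 6 * \<tau> * (1 + \<epsilon>) + 9 * \<tau>\<^sup>2"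
  have \<kappa>0: "\<kappa> \<ge> 0" using \<epsilon> \<tau> by (simp add: \<kappa>_def)
  define a where "a n = norm ((h (Suc n) o\<^sub>L x o\<^sub>L w n) v)" for n
  have "(\<Sum>n<N. (a n)\<^sup>2) \<le> (\<Sum>n<N. \<kappa> * (norm v)\<^sup>2 + ((norm (w n v))\<^sup>2 - (norm (w (Suc n) v))\<^sup>2))"
    unfolding a_def \<kappa>_def by (intro sum_mono norm_h_x_w)
  also have "\<dots> = real N * (\<kappa> * (norm v)\<^sup>2) + ((norm (w 0 v))\<^sup>2 - (norm (w N v))\<^sup>2)"
    by (subst sum.distrib) (simp add: sum_subtractf sum_shift_telescope[of "\<lambda>n. (norm (w n v))\<^sup>2"])
  also have "\<dots> \<le> real N * (\<kappa> * (norm v)\<^sup>2) + (norm v)\<^sup>2"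
  proof -
    have "norm (w 0 v) \<le> norm v"
      using norm_blinfun[of "w 0" v] mult_right_mono[OF norm_w[of 0], of "norm v"] by simp
    then have "(norm (w 0 v))\<^sup>2 \<le> (norm v)\<^sup>2" by (intro power_mono) auto
    then show ?thesis using zero_le_power2[of "norm (w N v)"] by linarith
  qed
  finally have sq: "(\<Sum>n<N. (a n)\<^sup>2) \<le> real N * (\<kappa> * (norm v)\<^sup>2) + (norm v)\<^sup>2" .
  have "norm (((1 / real N) *\<^sub>R (\<Sum>n<N. h (Suc n) o\<^sub>L x o\<^sub>L w n)) v) \<le> (\<Sum>n<N. a n) / N"
    unfolding a_def blinfun.scaleR_left blinfun.sum_left norm_scaleR
    using N by (simp add: divide_right_mono norm_sum del: blinfun_apply_blinfun_compose)
  also have "\<dots> \<le> sqrt (\<kappa> + 1 / real N) * norm v"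
  proof (rule power2_le_imp_le)
    have "(\<Sum>n<N. a n)\<^sup>2 \<le> (\<Sum>n<N. (a n)\<^sup>2) * card {..<N}"
      by (rule sum_squared_le_sum_of_squares)
    also have "\<dots> \<le> (real N * (\<kappa> * (norm v)\<^sup>2) + (norm v)\<^sup>2) * N"
      using sq by (simp add: mult_right_mono)
    finally have "((\<Sum>n<N. a n) / N)\<^sup>2 \<le> (real N * (\<kappa> * (norm v)\<^sup>2) + (norm v)\<^sup>2) * N / (real N)\<^sup>2"
      by (simp add: power_divide divide_right_mono)
    also have "\<dots> = (\<kappa> + 1 / real N) * (norm v)\<^sup>2" using N by (simp add: field_simps power2_eq_square)
    finally show "((\<Sum>n<N. a n) / N)\<^sup>2 \<le> (sqrt (\<kappa> + 1 / real N) * norm v)\<^sup>2"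
      using \<kappa>0 by (simp add: power_mult_distrib)
  qed (use \<kappa>0 in simp)
  finally show "norm (((1 / real N) *\<^sub>R (\<Sum>n<N. h (Suc n) o\<^sub>L x o\<^sub>L w n)) v) \<le>
      sqrt (2 * \<epsilon> + \<epsilon>\<^sup>2 + 6 * \<tau> * (1 + \<epsilon>) + 9 * \<tau>\<^sup>2 + 1 / real N) * norm v"
    by (simp add: \<kappa>_def)
qed (use \<epsilon> \<tau> in simp)

lemma norm_correction_le:
  "norm (y - (E o\<^sub>L u) + c *\<^sub>R (x o\<^sub>L E o\<^sub>L u)) \<le>
    \<epsilon> + sqrt (2 * \<epsilon> + \<epsilon>\<^sup>2 + 6 * \<tau> * (1 + \<epsilon>) + 9 * \<tau>\<^sup>2 + 1 / N) + 2 / N + 3 * \<tau> + (2 + \<epsilon>) * \<rho>"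
proof -
  let ?av = "\<lambda>f. (1 / real N) *\<^sub>R (\<Sum>n<N. f n)"
  define Z D P R where "Z = ?av z" and "D = ?av (\<lambda>n. w n - w (Suc n))"
    and "P = ?av (\<lambda>n. h (Suc n) o\<^sub>L x o\<^sub>L w n)"
    and "R = ?av (\<lambda>n. (w n - w (Suc n) - (h (Suc n) o\<^sub>L w n)) + ((h (Suc n) o\<^sub>L z n) - z n))"
  have D: "norm D \<le> 2 / N" unfolding D_def using norm_w N by (rule norm_average_telescope_le)
  have P: "norm P \<le> sqrt (2 * \<epsilon> + \<epsilon>\<^sup>2 + 6 * \<tau> * (1 + \<epsilon>) + 9 * \<tau>\<^sup>2 + 1 / N)"
    unfolding P_def by (rule norm_average_h_x_w)
  have R: "norm R \<le> 3 * \<tau>"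
    unfolding R_def
  proof (rule norm_average_le[OF _ N])
    show "norm ((w n - w (Suc n) - (h (Suc n) o\<^sub>L w n)) + ((h (Suc n) o\<^sub>L z n) - z n)) \<le> 3 * \<tau>" for n
      using norm_triangle_ineq[of "w n - w (Suc n) - (h (Suc n) o\<^sub>L w n)" "(h (Suc n) o\<^sub>L z n) - z n"]
        norm_h_w[of n] norm_h_z[of n] by linarith
  qed
  have "z n = (w n - w (Suc n)) - (h (Suc n) o\<^sub>L x o\<^sub>L w n)
      - ((w n - w (Suc n) - (h (Suc n) o\<^sub>L w n)) + ((h (Suc n) o\<^sub>L z n) - z n))" for n
    by (rule blinfun_eqI) (simp add: blinfun.bilinear_simps algebra_simps)
  then have "(\<Sum>n<N. z n) = (\<Sum>n<N. (w n - w (Suc n)) - (h (Suc n) o\<^sub>L x o\<^sub>L w n)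
      - ((w n - w (Suc n) - (h (Suc n) o\<^sub>L w n)) + ((h (Suc n) o\<^sub>L z n) - z n)))"
    by (rule sum.cong[OF refl])
  then have Z: "Z = D - P - R"
    unfolding Z_def D_def P_def R_def by (simp only: sum_subtractf scaleR_diff_right)
  have "norm ((E - H) o\<^sub>L u) \<le> \<rho> * 1" using norm_E_minus_H u by (rule norm_blinfun_compose_le)
  then have EH: "norm ((E - H) o\<^sub>L u) \<le> \<rho>" by simp
  then have xEH: "norm (x o\<^sub>L (E - H) o\<^sub>L u) \<le> (1 + \<epsilon>) * \<rho>"
    using norm_blinfun_compose_le[OF x EH] by (simp add: blinfun_compose_assoc)
  have "norm (x o\<^sub>L E o\<^sub>L u) \<le> (1 + \<epsilon>) * 1"
    using norm_blinfun_compose_le[OF x norm_E_u] by (simp add: blinfun_compose_assoc)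
  then have "(1 - c) * norm (x o\<^sub>L E o\<^sub>L u) \<le> (1 - c) * (1 + \<epsilon>)"
    using c by (intro mult_left_mono) auto
  also have "\<dots> = \<epsilon>" using c(3) by (simp add: algebra_simps)
  finally have cE: "norm ((1 - c) *\<^sub>R (x o\<^sub>L E o\<^sub>L u)) \<le> \<epsilon>" using c by simp
  have ZH: "Z = y - (H o\<^sub>L u) + (x o\<^sub>L H o\<^sub>L u)"
  proof -
    have "z n = y - (h n o\<^sub>L u) + (x o\<^sub>L h n o\<^sub>L u)" for n
      by (rule blinfun_eqI) (simp add: y_def blinfun.bilinear_simps algebra_simps)
    then have "(\<Sum>n<N. z n) = (\<Sum>n<N. y - (h n o\<^sub>L u) + (x o\<^sub>L h n o\<^sub>L u))"
      by (rule sum.cong[OF refl])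
    also have "\<dots> = real N *\<^sub>R y - ((\<Sum>n<N. h n) o\<^sub>L u) + (x o\<^sub>L (\<Sum>n<N. h n) o\<^sub>L u)"
      by (simp add: sum.distrib sum_subtractf compose_simps sum_constant_scaleR)
    finally show ?thesis unfolding Z_def H_def using N
      by (simp add: compose_simps(1-6) scaleR_add_right scaleR_diff_right)
  qed
  have "y - (E o\<^sub>L u) + c *\<^sub>R (x o\<^sub>L E o\<^sub>L u)
      = D - P - R - ((E - H) o\<^sub>L u) + (x o\<^sub>L (E - H) o\<^sub>L u) - (1 - c) *\<^sub>R (x o\<^sub>L E o\<^sub>L u)"
    unfolding Z[symmetric] ZH by (rule blinfun_eqI) (simp add: blinfun.bilinear_simps algebra_simps)
  also have "norm \<dots> \<le> norm D + norm P + norm R + norm ((E - H) o\<^sub>L u)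
      + norm (x o\<^sub>L (E - H) o\<^sub>L u) + norm ((1 - c) *\<^sub>R (x o\<^sub>L E o\<^sub>L u))"
    by (intro order_trans[OF norm_triangle_ineq4] order_trans[OF norm_triangle_ineq] add_right_mono) simp
  also have "\<dots> \<le> 2 / N + sqrt (2 * \<epsilon> + \<epsilon>\<^sup>2 + 6 * \<tau> * (1 + \<epsilon>) + 9 * \<tau>\<^sup>2 + 1 / N)
      + 3 * \<tau> + \<rho> + (1 + \<epsilon>) * \<rho> + \<epsilon>"
    by (intro add_mono D P R EH xEH cE)
  finally show ?thesis by (simp add: algebra_simps)
qed

end

instance complex_hilbert_space \<subseteq> banach ..

section \<open>Regular r-ideals are 1-regular\<close>

lemma blinfun_apply_scaleC_op [simp]: "blinfun_apply (scaleC_op c T) v = c *\<^sub>C blinfun_apply T v"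
  by (simp add: scaleC_op.rep_eq)

lemma scaleC_op_of_real: "scaleC_op (complex_of_real r) T = r *\<^sub>R T"
  by (rule blinfun_eqI) (simp add: scaleC_of_real blinfun.scaleR_left)

lemma subspace_if_complex_subspace:
  assumes "complex_subspace V"
  shows "subspace V"
  using assms unfolding complex_subspace_def subspace_def by (metis scaleC_op_of_real)

lemma operator_algebraD:
  assumes "operator_algebra A"
  shows "subspace A" "complex_subspace A" "a \<in> A \<Longrightarrow> b \<in> A \<Longrightarrow> a o\<^sub>L b \<in> A" "closed A"
    "A \<subseteq> bounded_operators"
  using assms by (auto simp: operator_algebra_def subspace_if_complex_subspace)

lemma r_idealD:
  assumes "r_ideal A J"
  shows "subspace J" "complex_subspace J" "J \<subseteq> A" "j \<in> J \<Longrightarrow> a \<in> A \<Longrightarrow> j o\<^sub>L a \<in> J" "closed J"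
  using assms by (auto simp: r_ideal_def right_ideal_def subspace_if_complex_subspace)

text \<open>The product equals \<open>(e\<^sup>* s - e e\<^sup>* s) (1 - s\<^sup>*)\<close>. So the operators \<open>e - e e\<^sup>*\<close> have
  asymptotically orthogonal ranges, and \<open>e\<close> may be replaced by \<open>e e\<^sup>*\<close> in averages and in weak
  limits.\<close>

lemma left_cai_defect_tendsto_0:
  assumes F: "left_contractive_approx_identity J F" and s: "s \<in> J"
  shows "((\<lambda>e. adj (e - (e o\<^sub>L adj e)) o\<^sub>L (s - (s o\<^sub>L adj s))) \<longlongrightarrow> 0) F"
proof -
  have "((\<lambda>e. (adj e o\<^sub>L s) - ((e o\<^sub>L adj e) o\<^sub>L s)) \<longlongrightarrow> s - s) F"
    by (rule tendsto_diff[OF left_cai_adj_tendsto[OF F s] left_cai_positive_tendsto[OF F s]])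
  then have "((\<lambda>e. ((adj e o\<^sub>L s) - ((e o\<^sub>L adj e) o\<^sub>L s)) o\<^sub>L (id_blinfun - adj s)) \<longlongrightarrow>
      (s - s) o\<^sub>L (id_blinfun - adj s)) F"
    by (rule bounded_bilinear.tendsto[OF bounded_bilinear_blinfun_compose _ tendsto_const])
  moreover have "((adj e o\<^sub>L s) - ((e o\<^sub>L adj e) o\<^sub>L s)) o\<^sub>L (id_blinfun - adj s)
      = adj (e - (e o\<^sub>L adj e)) o\<^sub>L (s - (s o\<^sub>L adj s))" for e
    by (rule blinfun_eqI) (simp add: adj_diff adj_compose blinfun.bilinear_simps)
  ultimately show ?thesis by simp
qed

text \<open>The property \<open>(1 - x) A \<subseteq> J\<close> survives a change of \<open>x\<close> within \<open>x + J\<close>. The correction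
  \<open>k = y - E u + c x E u\<close> lies in \<open>J\<close>, as \<open>x j = j - (1 - x) j\<close> does for \<open>j\<close> in \<open>J\<close>.\<close>

lemma regular_element_improve:
  fixes A J :: "('h::complex_hilbert_space \<Rightarrow>\<^sub>L 'h) set"
  assumes A: "operator_algebra A" "approximately_unital A" and J: "r_ideal A J"
    and xA: "x \<in> A" and reg: "\<And>a. a \<in> A \<Longrightarrow> a - (x o\<^sub>L a) \<in> J"
    and nx: "norm x \<le> 1 + \<epsilon>" and \<epsilon>: "0 \<le> \<epsilon>" and \<eta>: "0 < \<eta>"
  obtains x' where "x' \<in> A" "\<And>a. a \<in> A \<Longrightarrow> a - (x' o\<^sub>L a) \<in> J" "norm x' \<le> 1 + \<eta>"
    "norm (x' - x) \<le> \<epsilon> + sqrt (2 * \<epsilon> + \<epsilon>\<^sup>2) + \<eta>"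
proof -
  note A' = operator_algebraD[OF A(1)] and J' = r_idealD[OF J]
  obtain F where F: "left_contractive_approx_identity J F" using J by (auto simp: r_ideal_def)
  note F' = left_contractive_approx_identityD[OF F]
  obtain G where G: "contractive_approx_identity A G" using A(2) by (auto simp: approximately_unital_def)
  (* The two estimates for averages of N terms, with tolerance 1 / N. *)
  define B\<^sub>1 B\<^sub>2 where "B\<^sub>1 N = 1 / real N + (1 + 3 * (1 / real N) + 2 / real N + 2 * sqrt (4 / real N + 1 / real N))"
    and "B\<^sub>2 N = \<epsilon> + sqrt (2 * \<epsilon> + \<epsilon>\<^sup>2 + 6 * (1 / real N) * (1 + \<epsilon>) + 9 * (1 / real N)\<^sup>2 + 1 / real N)
      + 2 / real N + 3 * (1 / real N) + (2 + \<epsilon>) * sqrt (4 / real N + 1 / real N)" for N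
  have correct: "\<exists>x'\<in>A. (\<forall>a\<in>A. a - (x' o\<^sub>L a) \<in> J) \<and> norm x' \<le> B\<^sub>1 N \<and> norm (x' - x) \<le> B\<^sub>2 N"
    if N: "0 < N" for N :: nat
  proof -
    define \<tau> where "\<tau> = 1 / real N"
    have \<tau>: "0 < \<tau>" using N by (simp add: \<tau>_def)
    have "eventually (\<lambda>u. u \<in> {u \<in> A. norm u \<le> 1}) G" "G \<noteq> bot" "((\<lambda>u. x o\<^sub>L u) \<longlongrightarrow> x) G"
      using G xA by (auto simp: contractive_approx_identity_def net_in_def le_principal)
    then obtain u where "u \<in> {u \<in> A. norm u \<le> 1} \<and> dist (x o\<^sub>L u) x < \<tau>"
      using eventually_happens'[OF _ eventually_conj[OF _ tendstoD[OF _ \<tau>]]] by blast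
    then have uA: "u \<in> A" "norm u \<le> 1" and xu: "norm ((x o\<^sub>L u) - x) < \<tau>"
      by (auto simp: dist_norm)
    define y where "y = u - (x o\<^sub>L u)"
    have y: "y \<in> J" using reg[OF uA(1)] by (simp add: y_def)
    let ?h = "\<lambda>e. e o\<^sub>L adj e"
    define R where "R s t \<longleftrightarrow> norm ((?h t o\<^sub>L s) - s) < \<tau> \<and>
      norm ((?h t o\<^sub>L (s - (x o\<^sub>L s))) - (s - (x o\<^sub>L s))) < \<tau> \<and>
      norm (adj (t - ?h t) o\<^sub>L (s - ?h s)) < \<tau>" for s t :: "'h \<Rightarrow>\<^sub>L 'h"
    define Y where "Y = {e \<in> J. norm e \<le> 1 \<and> norm ((?h e o\<^sub>L y) - y) < \<tau>}"
    have fix_ev: "eventually (\<lambda>e. norm ((?h e o\<^sub>L j) - j) < \<tau>) F" if "j \<in> J" for j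
      using tendstoD[OF left_cai_positive_tendsto[OF F that] \<tau>] by (simp add: dist_norm)
    have ev: "eventually (\<lambda>e. e \<in> Y) F"
      using eventually_conj[OF F'(2) fix_ev[OF y]] by (simp add: Y_def conj_assoc)
    have "eventually (R s) F" if "s \<in> Y" for s
    proof -
      have s: "s \<in> J" "s - (x o\<^sub>L s) \<in> J" using that J' reg by (auto simp: Y_def)
      show ?thesis
        unfolding R_def using tendstoD[OF left_cai_defect_tendsto_0[OF F s(1)] \<tau>]
        by (intro eventually_conj fix_ev s) simp
    qed
    then have "\<exists>t. \<forall>n::nat. t n \<in> Y \<and> (\<forall>m<n. R (t m) (t n))"
      by (rule sequence_along_filter[OF F'(1) ev])
    then obtain e where eY: "\<And>n::nat. e n \<in> Y" and R: "\<And>m n. m < n \<Longrightarrow> R (e m) (e n)" by blast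
    define E where "E = (1 / real N) *\<^sub>R (\<Sum>n<N. e n)"
    define c where "c = 1 / (1 + \<epsilon>)"
    interpret averaging x u y E "(1 / real N) *\<^sub>R (\<Sum>n<N. ?h (e n))" e "\<lambda>n. ?h (e n)"
      "\<lambda>n. e n - (x o\<^sub>L e n)" N \<epsilon> \<tau> c "sqrt (4 / N + \<tau>)"
    proof
      show "norm (e n) \<le> 1" "norm ((?h (e n) o\<^sub>L y) - y) \<le> \<tau>" for n
        using eY[of n] by (auto simp: Y_def)
    qed (use uA nx \<epsilon> \<tau> N R in \<open>auto simp: y_def E_def c_def R_def intro: less_imp_le\<close>)
    have E: "E \<in> J"
      unfolding E_def using eY by (intro subspace_scale[OF J'(1)] subspace_sum[OF J'(1)]) (auto simp: Y_def)
    then have Eu: "E o\<^sub>L u \<in> J" "E o\<^sub>L u \<in> A" using J' uA by auto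
    define k where "k = y - (E o\<^sub>L u) + c *\<^sub>R (x o\<^sub>L E o\<^sub>L u)"
    have xEu: "x o\<^sub>L (E o\<^sub>L u) \<in> J"
      using subspace_diff[OF J'(1) Eu(1) reg[OF Eu(2)]] by simp
    have k: "k \<in> J"
      unfolding k_def blinfun_compose_assoc
      by (intro subspace_add subspace_diff subspace_scale J'(1) y Eu(1) xEu)
    show ?thesis
    proof (intro bexI[of _ "x + k"] conjI ballI)
      show "x + k \<in> A" using xA k J' A' by (auto intro: subspace_add)
      show "a - ((x + k) o\<^sub>L a) \<in> J" if "a \<in> A" for a
      proof -
        have eq: "a - ((x + k) o\<^sub>L a) = (a - (x o\<^sub>L a)) - (k o\<^sub>L a)" by (simp add: compose_simps)
        show ?thesis unfolding eq by (rule subspace_diff[OF J'(1) reg[OF that] J'(4)[OF k that]])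
      qed
      have "x + k = - ((x o\<^sub>L u) - x) + (u - (E o\<^sub>L u) + c *\<^sub>R (x o\<^sub>L E o\<^sub>L u))"
        by (simp add: k_def y_def)
      then have "norm (x + k) \<le> norm ((x o\<^sub>L u) - x) + norm (u - (E o\<^sub>L u) + c *\<^sub>R (x o\<^sub>L E o\<^sub>L u))"
        by (metis norm_minus_cancel norm_triangle_ineq)
      then show "norm (x + k) \<le> B\<^sub>1 N"
        using xu norm_corrected_le by (simp add: B\<^sub>1_def \<tau>_def)
      show "norm (x + k - x) \<le> B\<^sub>2 N"
        using norm_correction_le by (simp add: k_def B\<^sub>2_def \<tau>_def)
    qed
  qed
  have lim0: "(\<lambda>N. r / real N) \<longlonglongrightarrow> 0" for r by (rule lim_const_over_n)
  have "B\<^sub>1 \<longlonglongrightarrow> 0 + (1 + 3 * 0 + 0 + 2 * sqrt (0 + 0))"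
    unfolding B\<^sub>1_def by (intro tendsto_intros lim0)
  then have 1: "eventually (\<lambda>N. B\<^sub>1 N < 1 + \<eta>) sequentially"
    by (rule order_tendstoD) (use \<eta> in simp)
  have "B\<^sub>2 \<longlonglongrightarrow> \<epsilon> + sqrt (2 * \<epsilon> + \<epsilon>\<^sup>2 + 6 * 0 * (1 + \<epsilon>) + 9 * 0\<^sup>2 + 0) + 0 + 3 * 0 + (2 + \<epsilon>) * sqrt (0 + 0)"
    unfolding B\<^sub>2_def by (intro tendsto_intros lim0)
  then have 2: "eventually (\<lambda>N. B\<^sub>2 N < \<epsilon> + sqrt (2 * \<epsilon> + \<epsilon>\<^sup>2) + \<eta>) sequentially"
    by (rule order_tendstoD) (use \<eta> in simp)
  have "eventually (\<lambda>N. 0 < N \<and> B\<^sub>1 N < 1 + \<eta> \<and> B\<^sub>2 N < \<epsilon> + sqrt (2 * \<epsilon> + \<epsilon>\<^sup>2) + \<eta>) sequentially"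
    by (intro eventually_conj 1 2 eventually_gt_at_top)
  then obtain N where N: "0 < N" "B\<^sub>1 N < 1 + \<eta>" "B\<^sub>2 N < \<epsilon> + sqrt (2 * \<epsilon> + \<epsilon>\<^sup>2) + \<eta>"
    by (auto simp: eventually_sequentially)
  with correct[OF N(1)] that show ?thesis by (meson less_imp_le order_trans)
qed

text \<open>The displacements of successive improvements are summable, and membership of all
  \<open>a - x a\<close> in the closed set \<open>J\<close> passes to the limit.\<close>

lemma one_regular_if_regular:
  fixes A J :: "('h::complex_hilbert_space \<Rightarrow>\<^sub>L 'h) set"
  assumes A: "operator_algebra A" "approximately_unital A" and J: "r_ideal A J"
    and reg: "regular_right_ideal A J"
  shows "one_regular_right_ideal A J"
proof -
  note A' = operator_algebraD[OF A(1)] and J' = r_idealD[OF J]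
  define G where "G x \<longleftrightarrow> x \<in> A \<and> (\<forall>a\<in>A. a - (x o\<^sub>L a) \<in> J)" for x
  obtain x0 where x0: "G x0"
    using reg unfolding regular_right_ideal_def G_def by blast
  (* The n-th displacement is of order sqrt (\<eta> n), so this choice makes the displacements summable. *)
  define \<eta> where "\<eta> n = (1/4::real) ^ n" for n
  have \<eta>: "0 < \<eta> n" "\<eta> n \<le> 1" for n by (auto simp: \<eta>_def power_le_one)
  have \<eta>_Suc: "\<eta> (Suc n) \<le> \<eta> n" for n by (simp add: \<eta>_def)
  have improve: "\<exists>x'. G x' \<and> norm x' \<le> 1 + \<delta> \<and> norm (x' - x) \<le> \<epsilon> + sqrt (2 * \<epsilon> + \<epsilon>\<^sup>2) + \<delta>"
    if "G x" "norm x \<le> 1 + \<epsilon>" "0 \<le> \<epsilon>" "0 < \<delta>" for x \<epsilon> \<delta>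
    using that unfolding G_def by (metis regular_element_improve[OF A J])
  obtain x1 where x1: "G x1" "norm x1 \<le> 1 + \<eta> 0"
    using improve[OF x0, of "norm x0" "\<eta> 0"] \<eta> by auto
  have "\<exists>X. \<forall>n. (G (X n) \<and> norm (X n) \<le> 1 + \<eta> n) \<and> norm (X (Suc n) - X n) \<le> 4 * (1/2) ^ n"
  proof (rule dependent_nat_choice)
    show "\<exists>x. G x \<and> norm x \<le> 1 + \<eta> 0" using x1 by blast
    fix x n assume x: "G x \<and> norm x \<le> 1 + \<eta> n"
    then obtain x' where x': "G x'" "norm x' \<le> 1 + \<eta> (Suc n)"
      "norm (x' - x) \<le> \<eta> n + sqrt (2 * \<eta> n + (\<eta> n)\<^sup>2) + \<eta> (Suc n)"
      using improve[of x "\<eta> n" "\<eta> (Suc n)"] \<eta> by (metis less_imp_le)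
    have "2 * \<eta> n + (\<eta> n)\<^sup>2 \<le> 4 * \<eta> n"
      using mult_left_mono[OF \<eta>(2)[of n], of "\<eta> n"] \<eta>(1)[of n] by (simp add: power2_eq_square)
    also have "\<dots> = (2 * (1/2) ^ n)\<^sup>2"
      by (simp add: \<eta>_def power2_eq_square flip: power_mult_distrib)
    finally have "sqrt (2 * \<eta> n + (\<eta> n)\<^sup>2) \<le> 2 * (1/2) ^ n"
      by (metis abs_of_nonneg mult_nonneg_nonneg real_sqrt_abs real_sqrt_le_mono zero_le_divide_1_iff zero_le_numeral zero_le_power)
    moreover have "\<eta> n \<le> (1/2) ^ n" unfolding \<eta>_def by (intro power_mono) auto
    ultimately have "norm (x' - x) \<le> 4 * (1/2) ^ n" using x'(3) \<eta>_Suc[of n] by linarith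
    with x' show "\<exists>x'. (G x' \<and> norm x' \<le> 1 + \<eta> (Suc n)) \<and> norm (x' - x) \<le> 4 * (1/2) ^ n" by blast
  qed
  then obtain X where X: "\<And>n. G (X n)" "\<And>n. norm (X n) \<le> 1 + \<eta> n"
    and dX: "\<And>n. norm (X (Suc n) - X n) \<le> 4 * (1/2) ^ n"
    by blast
  have "summable (\<lambda>n. X (Suc n) - X n)"
    by (rule summable_comparison_test'[where g = "\<lambda>n. 4 * (1/2) ^ n" and N = 0])
       (auto intro!: summable_mult summable_geometric dX)
  then have "convergent (\<lambda>n. (\<Sum>k<n. X (Suc k) - X k) + X 0)"
    by (intro convergent_add convergent_const) (simp add: summable_iff_convergent)
  then have "convergent X" by (simp add: sum_lessThan_telescope)
  then obtain x where x: "X \<longlonglongrightarrow> x" by (auto simp: convergent_def)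
  have "x \<in> A" using closed_sequentially[OF A'(4) _ x] X by (auto simp: G_def)
  moreover have "norm x \<le> 1"
  proof (rule LIMSEQ_le)
    show "(\<lambda>n. norm (X n)) \<longlonglongrightarrow> norm x" using x by (rule tendsto_norm)
    have "(\<lambda>n. 1 + \<eta> n) \<longlonglongrightarrow> 1 + 0"
      unfolding \<eta>_def by (intro tendsto_intros LIMSEQ_power_zero) simp
    then show "(\<lambda>n. 1 + \<eta> n) \<longlonglongrightarrow> 1" by simp
  qed (use X in blast)
  moreover have "a - (x o\<^sub>L a) \<in> J" if "a \<in> A" for a
  proof (rule closed_sequentially[OF J'(5)])
    show "a - (X n o\<^sub>L a) \<in> J" for n using X that by (simp add: G_def)
    show "(\<lambda>n. a - (X n o\<^sub>L a)) \<longlonglongrightarrow> a - (x o\<^sub>L a)"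
      by (intro tendsto_diff tendsto_const x bounded_bilinear.tendsto[OF bounded_bilinear_blinfun_compose])
  qed
  ultimately show ?thesis
    using J unfolding one_regular_right_ideal_def r_ideal_def by blast
qed

section \<open>Separation of closed subspaces by functionals\<close>

definition sublinear :: "('a::real_vector \<Rightarrow> real) \<Rightarrow> bool" where
  "sublinear p \<longleftrightarrow> (\<forall>x y. p (x + y) \<le> p x + p y) \<and> (\<forall>r\<ge>0. \<forall>x. p (r *\<^sub>R x) = r * p x)"

lemma sublinearI:
  assumes add: "\<And>x y. p (x + y) \<le> p x + p y"
    and scale: "\<And>r x. 0 < r \<Longrightarrow> p (r *\<^sub>R x) \<le> r * p x" and zero: "p 0 = 0"
  shows "sublinear p"
proof -
  have "p (r *\<^sub>R x) = r * p x" if "0 \<le> r" for r x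
  proof (cases "r = 0")
    case False
    then have r: "0 < r" using that by simp
    have "p x \<le> (1 / r) * p (r *\<^sub>R x)" using scale[of "1 / r" "r *\<^sub>R x"] r by simp
    then have "r * p x \<le> p (r *\<^sub>R x)" using r by (simp add: field_simps)
    then show ?thesis using scale[OF r, of x] by simp
  qed (simp add: zero)
  then show ?thesis by (simp add: sublinear_def add)
qed

lemma sublinearD:
  assumes "sublinear p"
  shows "p (x + y) \<le> p x + p y" "0 \<le> r \<Longrightarrow> p (r *\<^sub>R x) = r * p x" "p 0 = 0" "- p (- x) \<le> p x"
proof -
  show a: "p (x + y) \<le> p x + p y" and s: "0 \<le> r \<Longrightarrow> p (r *\<^sub>R x) = r * p x" for x y r
    using assms by (auto simp: sublinear_def)
  show z: "p 0 = 0" using s[of 0 0] by simp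
  show "- p (- x) \<le> p x" using a[of x "- x"] z by simp
qed

text \<open>The functional \<open>q\<close> is the infimal convolution of \<open>p\<close> with \<open>- t y \<mapsto> - t p(y)\<close> on the ray
  through \<open>- y\<close>. The last property makes \<open>q\<close> odd at \<open>y\<close>, since \<open>- p(y) \<le> - q(y) \<le> q(- y)\<close>.\<close>

lemma sublinear_descent:
  assumes p: "sublinear p"
  obtains q where "sublinear q" "\<And>x. q x \<le> p x" "q (- y) \<le> - p y"
proof -
  note p' = sublinearD[OF p]
  define q where "q x = (INF t\<in>{0..}. p (x + t *\<^sub>R y) - t * p y)" for x
  have bdd: "bdd_below ((\<lambda>t. p (x + t *\<^sub>R y) - t * p y) ` {0..})" for x
  proof (rule bdd_belowI2[where m = "- p (- x)"])
    fix t :: real assume "t \<in> {0..}"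
    then show "- p (- x) \<le> p (x + t *\<^sub>R y) - t * p y"
      using p'(1)[of "x + t *\<^sub>R y" "- x"] p'(2)[of t y] by simp
  qed
  have le: "q x \<le> p (x + t *\<^sub>R y) - t * p y" if "0 \<le> t" for x t
    unfolding q_def using bdd that by (intro cINF_lower) auto
  have ge: "m \<le> q x" if "\<And>t. 0 \<le> t \<Longrightarrow> m \<le> p (x + t *\<^sub>R y) - t * p y" for x m
    unfolding q_def using that by (intro cINF_greatest) auto
  have "sublinear q"
  proof (rule sublinearI)
    fix a b
    have "q (a + b) - (p (b + s *\<^sub>R y) - s * p y) \<le> q a" if s: "0 \<le> s" for s
    proof (rule ge)
      fix t :: real assume t: "0 \<le> t"
      have "q (a + b) \<le> p ((a + b) + (t + s) *\<^sub>R y) - (t + s) * p y" using s t by (intro le) simp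
      also have "(a + b) + (t + s) *\<^sub>R y = (a + t *\<^sub>R y) + (b + s *\<^sub>R y)" by (simp add: algebra_simps)
      also have "p \<dots> \<le> p (a + t *\<^sub>R y) + p (b + s *\<^sub>R y)" by (rule p')
      finally show "q (a + b) - (p (b + s *\<^sub>R y) - s * p y) \<le> p (a + t *\<^sub>R y) - t * p y"
        by (simp add: algebra_simps)
    qed
    then have "q (a + b) - q a \<le> q b" by (intro ge) (simp add: algebra_simps)
    then show "q (a + b) \<le> q a + q b" by simp
  next
    fix r :: real and a assume r: "0 < r"
    have "q (r *\<^sub>R a) / r \<le> q a"
    proof (rule ge)
      fix t :: real assume t: "0 \<le> t"
      have "q (r *\<^sub>R a) \<le> p (r *\<^sub>R a + (r * t) *\<^sub>R y) - (r * t) * p y" using r t by (intro le) simp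
      also have "r *\<^sub>R a + (r * t) *\<^sub>R y = r *\<^sub>R (a + t *\<^sub>R y)" by (simp add: algebra_simps)
      also have "p \<dots> = r * p (a + t *\<^sub>R y)" using r by (intro p') simp
      finally show "q (r *\<^sub>R a) / r \<le> p (a + t *\<^sub>R y) - t * p y" using r by (simp add: field_simps)
    qed
    then show "q (r *\<^sub>R a) \<le> r * q a" using r by (simp add: field_simps)
  next
    have "q 0 \<le> 0" using le[of 0 0] p'(3) by simp
    moreover have "0 \<le> q 0" by (rule ge) (simp add: p'(2))
    ultimately show "q 0 = 0" by simp
  qed
  moreover have "q x \<le> p x" for x using le[of 0 x] by simp
  moreover have "q (- y) \<le> - p y" using le[of 1 "- y"] p'(3) by simp
  ultimately show ?thesis by (rule that)
qed

text \<open>A minimal sublinear functional below \<open>p\<close> is odd by the previous lemma, hence linear.\<close>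

lemma linear_functional_below_sublinear:
  fixes p :: "'a::real_vector \<Rightarrow> real"
  assumes p: "sublinear p"
  obtains f where "linear f" "\<And>x. f x \<le> p x"
proof -
  define S where "S = {q. sublinear q \<and> q \<le> p}"
  define P where "P q q' \<longleftrightarrow> q' \<le> q" for q q' :: "'a \<Rightarrow> real"
  have "\<exists>m\<in>S. \<forall>a\<in>S. P m a \<longrightarrow> a = m"
  proof (rule predicate_Zorn)
    show "partial_order_on S (relation_of P S)"
      by (rule partial_order_on_relation_ofI) (auto simp: P_def)
    fix C assume C: "C \<in> Chains (relation_of P S)"
    then have CS: "C \<subseteq> S" by (auto simp: Chains_def relation_of_def)
    show "\<exists>u\<in>S. \<forall>a\<in>C. P a u"
    proof (cases "C = {}")
      case True
      then show ?thesis using p by (auto simp: S_def)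
    next
      case False
      define u where "u x = (INF q\<in>C. q x)" for x
      have bdd: "bdd_below ((\<lambda>q. q x) ` C)" for x
      proof (rule bdd_belowI2[where m = "- p (- x)"])
        fix q assume "q \<in> C"
        then have q: "sublinear q" "q (- x) \<le> p (- x)" using CS by (auto simp: S_def le_fun_def)
        then show "- p (- x) \<le> q x" using sublinearD(4)[OF q(1), of x] by simp
      qed
      have le: "u x \<le> q x" if "q \<in> C" for q x
        unfolding u_def using bdd that by (rule cINF_lower)
      have ge: "m \<le> u x" if "\<And>q. q \<in> C \<Longrightarrow> m \<le> q x" for x m
        unfolding u_def using False that by (rule cINF_greatest)
      have "sublinear u"
      proof (rule sublinearI)
        fix x y
        have "u (x + y) - q' y \<le> u x" if q': "q' \<in> C" for q'
        proof (rule ge)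
          fix q assume q: "q \<in> C"
          have "q \<le> q' \<or> q' \<le> q"
            using C q q' by (auto simp: Chains_def relation_of_def P_def)
          then obtain r where r: "r \<in> C" "r \<le> q" "r \<le> q'" using q q' by auto
          have "u (x + y) \<le> r (x + y)" using r by (intro le)
          also have "\<dots> \<le> r x + r y" using r CS by (intro sublinearD) (auto simp: S_def)
          also have "\<dots> \<le> q x + q' y" using r by (intro add_mono) (auto simp: le_fun_def)
          finally show "u (x + y) - q' y \<le> q x" by simp
        qed
        then have "u (x + y) - u x \<le> u y" by (intro ge) (simp add: algebra_simps)
        then show "u (x + y) \<le> u x + u y" by simp
      next
        fix r :: real and x assume r: "0 < r"
        have "u (r *\<^sub>R x) / r \<le> u x"
        proof (rule ge)
          fix q assume q: "q \<in> C"
          then have "q (r *\<^sub>R x) = r * q x" using r CS by (intro sublinearD) (auto simp: S_def)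
          then show "u (r *\<^sub>R x) / r \<le> q x" using le[OF q, of "r *\<^sub>R x"] r by (simp add: field_simps)
        qed
        then show "u (r *\<^sub>R x) \<le> r * u x" using r by (simp add: field_simps)
      next
        have "q 0 = 0" if "q \<in> C" for q using that CS by (intro sublinearD(3)) (auto simp: S_def)
        then have "(\<lambda>q. q 0) ` C = {0}" using False by force
        then show "u 0 = 0" unfolding u_def by simp
      qed
      moreover have "u \<le> p"
      proof (rule le_funI)
        fix x
        obtain q where q: "q \<in> C" using False by blast
        then have "q x \<le> p x" using CS by (auto simp: S_def le_fun_def)
        then show "u x \<le> p x" using le[OF q, of x] by linarith
      qed
      ultimately have "u \<in> S" by (simp add: S_def)
      then show ?thesis using le by (intro bexI[of _ u]) (auto simp: P_def le_fun_def)
    qed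
  qed
  then obtain f where "f \<in> S" and f_min: "\<And>q. q \<in> S \<Longrightarrow> q \<le> f \<Longrightarrow> q = f"
    unfolding P_def by blast
  then have f: "sublinear f" "f \<le> p" by (auto simp: S_def)
  have min: "q = f" if "sublinear q" "q \<le> f" for q
  proof (rule f_min)
    show "q \<in> S" using that order_trans[OF that(2) f(2)] by (simp add: S_def)
  qed (rule that)
  note f' = sublinearD[OF f(1)]
  have odd: "f (- y) = - f y" for y
  proof -
    obtain q where q: "sublinear q" "\<And>x. q x \<le> f x" "q (- y) \<le> - f y"
      using sublinear_descent[OF f(1)] by metis
    then have "q = f" by (intro min) (auto simp: le_fun_def)
    then show ?thesis using q(3) f'(4)[of y] by simp
  qed
  have "linear f"
  proof (rule linearI)
    show "f (x + y) = f x + f y" for x y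
      using f'(1)[of x y] f'(1)[of "x + y" "- y"] odd[of y] by simp
    show "f (r *\<^sub>R x) = r *\<^sub>R f x" for r x
    proof (cases "0 \<le> r")
      case False
      then have "f ((- r) *\<^sub>R x) = - r * f x" by (intro f') simp
      then show ?thesis using odd[of "r *\<^sub>R x"] by simp
    qed (simp add: f')
  qed
  then show ?thesis using f(2) that by (auto simp: le_fun_def)
qed

lemma sublinear_infdist:
  fixes J :: "'a::real_normed_vector set"
  assumes J: "subspace J"
  shows "sublinear (\<lambda>x. infdist x J)"
proof -
  have ne: "J \<noteq> {}" using subspace_0[OF J] by blast
  have ge: "m \<le> infdist x J" if "\<And>j. j \<in> J \<Longrightarrow> m \<le> dist x j" for x m
    using that ne by (simp add: infdist_notempty cINF_greatest)
  show ?thesis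
  proof (rule sublinearI)
    fix x y
    have "infdist (x + y) J - dist y k \<le> infdist x J" if k: "k \<in> J" for k
    proof (rule ge)
      fix j assume "j \<in> J"
      then have "infdist (x + y) J \<le> dist (x + y) (j + k)"
        using k J by (intro infdist_le subspace_add)
      also have "\<dots> \<le> dist x j + dist y k" by (rule dist_triangle_add)
      finally show "infdist (x + y) J - dist y k \<le> dist x j" by simp
    qed
    then have "infdist (x + y) J - infdist x J \<le> infdist y J"
      by (intro ge) (simp add: algebra_simps)
    then show "infdist (x + y) J \<le> infdist x J + infdist y J" by simp
  next
    fix r :: real and x assume r: "0 < r"
    have "infdist (r *\<^sub>R x) J / r \<le> infdist x J"
    proof (rule ge)
      fix j assume "j \<in> J"
      then have "infdist (r *\<^sub>R x) J \<le> dist (r *\<^sub>R x) (r *\<^sub>R j)"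
        using J by (intro infdist_le subspace_scale)
      also have "\<dots> = r * dist x j"
        using r unfolding dist_norm scaleR_diff_right[symmetric] norm_scaleR by simp
      finally show "infdist (r *\<^sub>R x) J / r \<le> dist x j" using r by (simp add: field_simps)
    qed
    then show "infdist (r *\<^sub>R x) J \<le> r * infdist x J" using r by (simp add: field_simps)
  qed (simp add: subspace_0[OF J])
qed

lemma scaleC_op_decompose: "scaleC_op c a = Re c *\<^sub>R a + Im c *\<^sub>R scaleC_op \<i> a"
proof (rule blinfun_eqI)
  fix v
  have "c *\<^sub>C w = Re c *\<^sub>R w + Im c *\<^sub>R \<i> *\<^sub>C w" for w :: 'a
  proof -
    have "c = complex_of_real (Re c) + complex_of_real (Im c) * \<i>" by (simp add: complex_eq mult.commute)
    then have "c *\<^sub>C w = (complex_of_real (Re c) + complex_of_real (Im c) * \<i>) *\<^sub>C w" by simp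
    then show ?thesis by (simp add: scaleC_add_left scaleC_of_real flip: scaleC_scaleC)
  qed
  then show "blinfun_apply (scaleC_op c a) v = blinfun_apply (Re c *\<^sub>R a + Im c *\<^sub>R scaleC_op \<i> a) v"
    by (simp add: blinfun.bilinear_simps)
qed

lemma scaleC_op_scaleC_op: "scaleC_op c (scaleC_op d a) = scaleC_op (c * d) a"
  by (rule blinfun_eqI) (simp add: scaleC_scaleC)

lemma norm_scaleC_op_le: "norm (scaleC_op c a) \<le> cmod c * norm a"
  by (rule norm_blinfun_bound)
     (auto simp: norm_scaleC mult.assoc intro!: mult_left_mono norm_blinfun)

text \<open>A real-linear functional \<open>f\<close> below the distance to \<open>J\<close> vanishes on \<open>J\<close> and is bounded by
  the norm; \<open>f(a) - \<i> f(\<i> a)\<close> is the complex-linear functional with real part \<open>f\<close>.\<close>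

lemma dual_separation:
  assumes A: "complex_subspace A" and J: "complex_subspace J" "closed J" "J \<subseteq> A"
    and c: "c \<in> A" "c \<notin> J"
  obtains \<phi> where "\<phi> \<in> dual A" "\<And>j. j \<in> J \<Longrightarrow> \<phi> j = 0" "\<phi> c \<noteq> 0"
proof -
  have sJ: "subspace J" using J(1) by (rule subspace_if_complex_subspace)
  let ?p = "\<lambda>x. infdist x J"
  (* The descent at c forces a linear functional below q to attain the distance at c. *)
  obtain q where q: "sublinear q" "\<And>x. q x \<le> ?p x" "q (- c) \<le> - ?p c"
    using sublinear_descent[OF sublinear_infdist[OF sJ]] by metis
  obtain f where f: "linear f" "\<And>x. f x \<le> q x"
    using linear_functional_below_sublinear[OF q(1)] by metis
  note fl = linear_add[OF f(1)] linear_diff[OF f(1)] linear_scale[OF f(1)] linear_neg[OF f(1)]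
  have fp: "f x \<le> ?p x" for x using f(2) q(2) by (rule order_trans)
  have "0 < ?p c" using sJ c J(2) subspace_0 by (intro infdist_pos_not_in_closed) auto
  then have fc: "0 < f c" using f(2)[of "- c"] q(3) by (simp add: fl)
  have fJ: "f j = 0" if "j \<in> J" for j
  proof -
    have "- j \<in> J" using subspace_neg[OF sJ that] .
    then have "f j \<le> 0" "f (- j) \<le> 0" using fp[of j] fp[of "- j"] that by auto
    then show ?thesis by (simp add: fl)
  qed
  have fn: "\<bar>f x\<bar> \<le> norm x" for x
  proof -
    have "?p x \<le> norm x" "?p (- x) \<le> norm x"
      using infdist_le[OF subspace_0[OF sJ], of x] infdist_le[OF subspace_0[OF sJ], of "- x"] by auto
    then show ?thesis using fp[of x] fp[of "- x"] by (simp add: fl abs_le_iff)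
  qed
  define \<phi> where "\<phi> = extend0 A (\<lambda>a. complex_of_real (f a) - \<i> * complex_of_real (f (scaleC_op \<i> a)))"
  have A': "a + b \<in> A" "scaleC_op r a \<in> A" if "a \<in> A" "b \<in> A" for a b r
    using A that by (auto simp: complex_subspace_def)
  have "\<phi> \<in> dual A"
    unfolding dual_def
  proof (intro CollectI conjI ballI allI impI exI)
    fix a b r assume a: "a \<in> A"
    have ii: "scaleC_op \<i> (scaleC_op \<i> a) = - a"
      using scaleC_op_of_real[of "- 1" a] by (simp add: scaleC_op_scaleC_op)
    have "f (scaleC_op r a) = Re r * f a + Im r * f (scaleC_op \<i> a)"
      by (simp add: scaleC_op_decompose[of r] fl)
    moreover have "f (scaleC_op \<i> (scaleC_op r a)) = Re r * f (scaleC_op \<i> a) - Im r * f a"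
    proof -
      have "scaleC_op \<i> (scaleC_op r a) = scaleC_op r (scaleC_op \<i> a)"
        by (simp add: scaleC_op_scaleC_op mult.commute)
      then show ?thesis by (simp add: scaleC_op_decompose[of r] ii fl)
    qed
    ultimately show "\<phi> (scaleC_op r a) = r * \<phi> a"
      using a A'(2)[OF a a] by (simp add: \<phi>_def extend0_def complex_eq_iff algebra_simps)
    show "cmod (\<phi> a) \<le> 2 * norm a"
    proof -
      have "\<phi> a = complex_of_real (f a) - \<i> * complex_of_real (f (scaleC_op \<i> a))"
        using a by (simp add: \<phi>_def extend0_def)
      then have "cmod (\<phi> a) \<le> cmod (complex_of_real (f a)) + cmod (\<i> * complex_of_real (f (scaleC_op \<i> a)))"
        by (simp only: norm_triangle_ineq4)
      also have "\<dots> \<le> norm a + norm (scaleC_op \<i> a)"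
        using fn[of a] fn[of "scaleC_op \<i> a"] by (simp add: norm_mult)
      finally show ?thesis using norm_scaleC_op_le[of \<i> a] by simp
    qed
    assume b: "b \<in> A"
    have "scaleC_op \<i> (a + b) = scaleC_op \<i> a + scaleC_op \<i> b"
      by (rule blinfun_eqI) (simp add: blinfun.add_left scaleC_add_right)
    then show "\<phi> (a + b) = \<phi> a + \<phi> b"
      using a b A'(1)[OF a b] by (simp add: \<phi>_def extend0_def fl algebra_simps)
  qed (simp add: \<phi>_def extend0_def)
  moreover have "\<phi> j = 0" if "j \<in> J" for j
  proof -
    have "scaleC_op \<i> j \<in> J" using J(1) that by (simp add: complex_subspace_def)
    then show ?thesis using fJ that by (simp add: \<phi>_def extend0_def)
  qed
  moreover have "\<phi> c \<noteq> 0"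
    using fc c by (simp add: \<phi>_def extend0_def complex_eq_iff)
  ultimately show ?thesis by (rule that)
qed

section \<open>Functionals along approximate identities\<close>

lemma dualD:
  assumes "\<phi> \<in> dual A"
  shows "a \<in> A \<Longrightarrow> b \<in> A \<Longrightarrow> \<phi> (a + b) = \<phi> a + \<phi> b" "a \<in> A \<Longrightarrow> \<phi> (scaleC_op c a) = c * \<phi> a"
    "a \<notin> A \<Longrightarrow> \<phi> a = 0"
  using assms by (auto simp: dual_def)

lemma dual_bound:
  assumes "\<phi> \<in> dual A"
  obtains K where "0 \<le> K" "\<And>a. a \<in> A \<Longrightarrow> cmod (\<phi> a) \<le> K * norm a"
proof -
  obtain K where K: "\<And>a. a \<in> A \<Longrightarrow> cmod (\<phi> a) \<le> K * norm a" using assms unfolding dual_def by blast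
  have "cmod (\<phi> a) \<le> max K 0 * norm a" if "a \<in> A" for a
    using K[OF that] mult_right_mono[of K "max K 0" "norm a"] by simp
  then show ?thesis using that[of "max K 0"] by simp
qed

lemma dual_scaleR:
  assumes "\<phi> \<in> dual A" "a \<in> A"
  shows "\<phi> (r *\<^sub>R a) = r * \<phi> a"
  using dualD(2)[OF assms, of "complex_of_real r"] by (simp add: scaleC_op_of_real)

lemma dual_diff:
  assumes \<phi>: "\<phi> \<in> dual A" and A: "complex_subspace A" and ab: "a \<in> A" "b \<in> A"
  shows "\<phi> (a - b) = \<phi> a - \<phi> b"
proof -
  have "(- 1) *\<^sub>R b \<in> A" using subspace_if_complex_subspace[OF A] ab by (intro subspace_scale)
  then have "\<phi> (a + (- 1) *\<^sub>R b) = \<phi> a + \<phi> ((- 1) *\<^sub>R b)" using ab by (intro dualD(1)[OF \<phi>])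
  then show ?thesis using dual_scaleR[OF \<phi> ab(2), of "- 1"] by simp
qed

lemma dual_tendsto:
  assumes \<phi>: "\<phi> \<in> dual A" and A: "complex_subspace A" and l: "l \<in> A"
    and g: "(g \<longlongrightarrow> l) F" "eventually (\<lambda>t. g t \<in> A) F"
  shows "((\<lambda>t. \<phi> (g t)) \<longlongrightarrow> \<phi> l) F"
proof -
  obtain K where K: "0 \<le> K" "\<And>a. a \<in> A \<Longrightarrow> cmod (\<phi> a) \<le> K * norm a" using dual_bound[OF \<phi>] by blast
  have "((\<lambda>t. K * norm (g t - l)) \<longlongrightarrow> K * 0) F"
    using g(1) by (intro tendsto_mult tendsto_const tendsto_norm_zero) (simp add: LIM_zero)
  then have "((\<lambda>t. K * norm (g t - l)) \<longlongrightarrow> 0) F" by simp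
  moreover have "eventually (\<lambda>t. norm (\<phi> (g t) - \<phi> l) \<le> K * norm (g t - l)) F"
    using g(2)
  proof (rule eventually_mono)
    fix t assume t: "g t \<in> A"
    have "g t - l \<in> A" using subspace_if_complex_subspace[OF A] t l by (intro subspace_diff)
    then show "norm (\<phi> (g t) - \<phi> l) \<le> K * norm (g t - l)"
      using K(2) dual_diff[OF \<phi> A t l] by metis
  qed
  ultimately have "((\<lambda>t. \<phi> (g t) - \<phi> l) \<longlongrightarrow> 0) F" by (rule Lim_null_comparison[rotated])
  then show ?thesis by (simp add: LIM_zero_iff)
qed

lemma dual_tendsto_0_if_almost_orthogonal:
  assumes \<phi>: "\<phi> \<in> dual A" and A: "complex_subspace A"
    and g: "eventually (\<lambda>t. t \<in> Y) F" "\<And>t. t \<in> Y \<Longrightarrow> g t \<in> A" "\<And>t. t \<in> Y \<Longrightarrow> norm (g t) \<le> M"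
    and orth: "\<And>s. s \<in> Y \<Longrightarrow> ((\<lambda>t. adj (g t) o\<^sub>L g s) \<longlongrightarrow> 0) F"
  shows "((\<lambda>t. \<phi> (g t)) \<longlongrightarrow> 0) F"
proof -
  obtain K where K: "0 \<le> K" "\<And>a. a \<in> A \<Longrightarrow> cmod (\<phi> a) \<le> K * norm a" using dual_bound[OF \<phi>] by blast
  note V = subspace_if_complex_subspace[OF A]
  have "((\<lambda>t. Re (\<phi> (g t))) \<longlongrightarrow> 0) F" "((\<lambda>t. Im (\<phi> (g t))) \<longlongrightarrow> 0) F"
    by (rule functional_tendsto_0_if_almost_orthogonal[OF V _ _ _ g orth, where K = K];
        use K order_trans[OF abs_Re_le_cmod] order_trans[OF abs_Im_le_cmod] in
          \<open>auto simp: dualD[OF \<phi>] dual_scaleR[OF \<phi>]\<close>)+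
  then show ?thesis by (simp add: tendsto_complex_iff)
qed

text \<open>For two left approximate identities \<open>e\<close> and \<open>e'\<close> of \<open>J\<close> the adjoint of \<open>e - e'\<close>
  tends to \<open>0\<close> on \<open>J\<close>, so that \<open>e - e'\<close> tends to \<open>0\<close> weakly. This gives convergence (Cauchy's
  criterion, with \<open>e' = e\<close>) and uniqueness of the limit at once.\<close>

lemma left_cai_difference_tendsto_0:
  assumes A: "operator_algebra A" and J: "r_ideal A J" and \<phi>: "\<phi> \<in> dual A"
    and F: "left_contractive_approx_identity J F" "left_contractive_approx_identity J F'"
  shows "((\<lambda>(e, e'). \<phi> (e - e')) \<longlongrightarrow> 0) (F \<times>\<^sub>F F')"
proof -
  note J' = r_idealD[OF J]
  define B where "B = {e \<in> J. norm e \<le> 1}"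
  have "((\<lambda>t. \<phi> (fst t - snd t)) \<longlongrightarrow> 0) (F \<times>\<^sub>F F')"
  proof (rule dual_tendsto_0_if_almost_orthogonal[OF \<phi> operator_algebraD(2)[OF A], where Y = "B \<times> B" and M = 2])
    show "eventually (\<lambda>t. t \<in> B \<times> B) (F \<times>\<^sub>F F')"
      using left_contractive_approx_identityD(2)[OF F(1)] left_contractive_approx_identityD(2)[OF F(2)]
      unfolding eventually_prod_filter B_def by (intro exI conjI) auto
    show "fst t - snd t \<in> A" if "t \<in> B \<times> B" for t
      using that J'(1,3) by (auto simp: B_def intro!: subspace_diff[OF operator_algebraD(1)[OF A]])
    show "norm (fst t - snd t) \<le> 2" if "t \<in> B \<times> B" for t
      using that norm_triangle_ineq4[of "fst t" "snd t"] by (auto simp: B_def)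
    fix s assume s: "s \<in> B \<times> B"
    define j where "j = fst s - snd s"
    have j: "j \<in> J" using s J'(1) by (auto simp: B_def j_def intro!: subspace_diff)
    have "((\<lambda>t. (adj (fst t) o\<^sub>L j) - (adj (snd t) o\<^sub>L j)) \<longlongrightarrow> j - j) (F \<times>\<^sub>F F')"
      using left_cai_adj_tendsto[OF F(1) j] left_cai_adj_tendsto[OF F(2) j]
      by (intro tendsto_diff) (auto intro: filterlim_compose filterlim_fst filterlim_snd)
    then show "((\<lambda>t. adj (fst t - snd t) o\<^sub>L (fst s - snd s)) \<longlongrightarrow> 0) (F \<times>\<^sub>F F')"
      unfolding j_def[symmetric] adj_diff compose_simps(3) by simp
  qed
  then show ?thesis by (simp add: case_prod_beta')
qed

lemma left_cai_functional_convergent: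
  assumes A: "operator_algebra A" and J: "r_ideal A J" and \<phi>: "\<phi> \<in> dual A"
    and F: "left_contractive_approx_identity J F"
  obtains l where "\<And>F'. left_contractive_approx_identity J F' \<Longrightarrow> (\<phi> \<longlongrightarrow> l) F'"
proof -
  note J' = r_idealD[OF J]
  have diff: "eventually (\<lambda>t. dist (\<phi> (fst t)) (\<phi> (snd t)) < \<epsilon>) (F1 \<times>\<^sub>F F2)"
    if "0 < \<epsilon>" and F12: "left_contractive_approx_identity J F1" "left_contractive_approx_identity J F2" for \<epsilon> F1 F2
  proof -
    have "eventually (\<lambda>t. fst t \<in> J \<and> snd t \<in> J) (F1 \<times>\<^sub>F F2)"
      using left_contractive_approx_identityD(2)[OF F12(1)] left_contractive_approx_identityD(2)[OF F12(2)]
      unfolding eventually_prod_filter by (intro exI conjI) auto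
    with tendstoD[OF left_cai_difference_tendsto_0[OF A J \<phi> F12] that(1)] show ?thesis
    proof eventually_elim
      case (elim t)
      then have "\<phi> (fst t - snd t) = \<phi> (fst t) - \<phi> (snd t)"
        using J'(3) by (intro dual_diff[OF \<phi> operator_algebraD(2)[OF A]]) auto
      then show ?case using elim by (simp add: case_prod_beta dist_norm)
    qed
  qed
  have "cauchy_filter (filtermap \<phi> F)"
    unfolding cauchy_filter_metric_filtermap
  proof (intro allI impI)
    fix \<epsilon> :: real assume "0 < \<epsilon>"
    from diff[OF this F F] show "\<exists>P. eventually P F \<and> (\<forall>x y. P x \<and> P y \<longrightarrow> dist (\<phi> x) (\<phi> y) < \<epsilon>)"
      unfolding eventually_prod_same by auto
  qed
  moreover have "filtermap \<phi> F \<noteq> bot"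
    using left_contractive_approx_identityD(1)[OF F] by (simp add: filtermap_bot_iff)
  ultimately obtain l where "filtermap \<phi> F \<le> nhds l"
    using cauchy_filter_complete_converges[of "filtermap \<phi> F" UNIV] complete_UNIV by auto
  then have l: "(\<phi> \<longlongrightarrow> l) F" by (simp add: filterlim_def)
  show ?thesis
  proof (rule that)
    fix F' assume F': "left_contractive_approx_identity J F'"
    show "(\<phi> \<longlongrightarrow> l) F'"
      unfolding tendsto_iff
    proof (intro allI impI)
      fix \<epsilon> :: real assume \<epsilon>: "0 < \<epsilon>"
      obtain P Q where PQ: "eventually P F" "eventually Q F'"
        and d: "\<And>x y. P x \<Longrightarrow> Q y \<Longrightarrow> dist (\<phi> x) (\<phi> y) < \<epsilon> / 2"
        using diff[OF half_gt_zero[OF \<epsilon>] F F'] unfolding eventually_prod_filter by auto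
      obtain x where x: "P x" "dist (\<phi> x) l < \<epsilon> / 2"
        using eventually_happens'[OF left_contractive_approx_identityD(1)[OF F]
            eventually_conj[OF PQ(1) tendstoD[OF l half_gt_zero[OF \<epsilon>]]]] by blast
      show "eventually (\<lambda>y. dist (\<phi> y) l < \<epsilon>) F'"
        using PQ(2)
      proof (rule eventually_mono)
        fix y assume "Q y"
        then have "dist (\<phi> x) (\<phi> y) < \<epsilon> / 2" using d x by blast
        then show "dist (\<phi> y) l < \<epsilon>"
          using x(2) dist_triangle[of "\<phi> y" l "\<phi> x"] by (simp add: dist_commute)
      qed
    qed
  qed
qed

text \<open>Elements \<open>b - e b\<close> with \<open>b\<close> in the unit ball of \<open>J\<close> have almost orthogonal ranges, whatever
  \<open>b\<close> is chosen along with \<open>e\<close>. So the translates \<open>\<phi>(e \<cdot>)\<close> converge to \<open>\<phi>\<close> in norm on \<open>J\<close>. This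
  norm convergence does the work of the Arens regularity of operator algebras.\<close>

lemma left_cai_functional_uniform:
  assumes A: "operator_algebra A" and J: "r_ideal A J" and \<phi>: "\<phi> \<in> dual A"
    and F: "left_contractive_approx_identity J F" and \<delta>: "0 < \<delta>"
  shows "eventually (\<lambda>e. \<forall>b\<in>J. norm b \<le> 1 \<longrightarrow> cmod (\<phi> (b - (e o\<^sub>L b))) \<le> \<delta>) F"
proof -
  note J' = r_idealD[OF J]
  define bad where "bad e b \<longleftrightarrow> b \<in> J \<and> norm b \<le> 1 \<and> \<not> cmod (\<phi> (b - (e o\<^sub>L b))) \<le> \<delta>" for e b
  define \<beta> where "\<beta> e = (if \<exists>b. bad e b then SOME b. bad e b else 0)" for e
  have \<beta>: "\<beta> e \<in> J \<and> norm (\<beta> e) \<le> 1" for e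
    using someI_ex[of "bad e"] subspace_0[OF J'(1)] unfolding \<beta>_def bad_def by auto
  define g where "g e = \<beta> e - (e o\<^sub>L \<beta> e)" for e
  have gJ: "g e \<in> J" if "e \<in> J" for e
    using \<beta>[of e] J'(3) J'(4)[of e "\<beta> e"] that by (auto simp: g_def intro!: subspace_diff[OF J'(1)])
  have "((\<lambda>e. \<phi> (g e)) \<longlongrightarrow> 0) F"
  proof (rule dual_tendsto_0_if_almost_orthogonal[OF \<phi> operator_algebraD(2)[OF A], where M = 2])
    show "eventually (\<lambda>e. e \<in> {e \<in> J. norm e \<le> 1}) F"
      by (rule left_contractive_approx_identityD(2)[OF F])
    show "g e \<in> A" if "e \<in> {e \<in> J. norm e \<le> 1}" for e using gJ that J'(3) by auto
    show "norm (g e) \<le> 2" if "e \<in> {e \<in> J. norm e \<le> 1}" for e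
      using norm_triangle_ineq4[of "\<beta> e" "e o\<^sub>L \<beta> e"] \<beta>[of e]
        norm_blinfun_compose_le[of e 1 "\<beta> e" 1] that by (simp add: g_def)
    fix s assume "s \<in> {e \<in> J. norm e \<le> 1}"
    then have s: "g s \<in> J" using gJ by simp
    have "((\<lambda>e. g s - (adj e o\<^sub>L g s)) \<longlongrightarrow> g s - g s) F"
      by (intro tendsto_diff tendsto_const left_cai_adj_tendsto[OF F s])
    then have lim: "((\<lambda>e. norm (g s - (adj e o\<^sub>L g s))) \<longlongrightarrow> 0) F"
      by (intro tendsto_norm_zero) simp
    have "norm (adj (g e) o\<^sub>L g s) \<le> norm (g s - (adj e o\<^sub>L g s))" for e
    proof -
      have "adj (g e) o\<^sub>L g s = adj (\<beta> e) o\<^sub>L (g s - (adj e o\<^sub>L g s))"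
        by (rule blinfun_eqI) (simp add: g_def[of e] adj_diff adj_compose blinfun.bilinear_simps)
      moreover have "norm (adj (\<beta> e) o\<^sub>L (g s - (adj e o\<^sub>L g s))) \<le> 1 * norm (g s - (adj e o\<^sub>L g s))"
        using \<beta>[of e] by (intro norm_blinfun_compose_le) auto
      ultimately show ?thesis by simp
    qed
    then show "((\<lambda>e. adj (g e) o\<^sub>L g s) \<longlongrightarrow> 0) F"
      by (intro Lim_null_comparison[OF _ lim]) simp
  qed
  then have "eventually (\<lambda>e. cmod (\<phi> (g e)) < \<delta>) F" using tendstoD[OF _ \<delta>] by (fastforce simp: dist_norm)
  then show ?thesis
  proof (rule eventually_mono)
    fix e assume e: "cmod (\<phi> (g e)) < \<delta>"
    have "\<not> bad e b" for b
    proof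
      assume "bad e b"
      then have "bad e (\<beta> e)" unfolding \<beta>_def by (metis someI)
      then show False using e by (simp add: bad_def g_def)
    qed
    then show "\<forall>b\<in>J. norm b \<le> 1 \<longrightarrow> cmod (\<phi> (b - (e o\<^sub>L b))) \<le> \<delta>" by (auto simp: bad_def)
  qed
qed

section \<open>The bidual\<close>

lemma dual_norm_le:
  assumes A: "0 \<in> A" and le: "\<And>a. a \<in> A \<Longrightarrow> norm a \<le> 1 \<Longrightarrow> cmod (\<phi> a) \<le> \<delta>"
  shows "dual_norm A \<phi> \<le> \<delta>"
proof -
  have "0 \<in> {a \<in> A. norm a \<le> 1}" using A by simp
  then have "(\<lambda>a. cmod (\<phi> a)) ` {a \<in> A. norm a \<le> 1} \<noteq> {}" by blast
  then show ?thesis unfolding dual_norm_def by (rule cSup_least) (auto simp: le)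
qed

lemma le_dual_norm:
  assumes \<phi>: "\<phi> \<in> dual A" and a: "a \<in> A" "norm a \<le> 1"
  shows "cmod (\<phi> a) \<le> dual_norm A \<phi>"
proof -
  obtain K where K: "0 \<le> K" "\<And>a. a \<in> A \<Longrightarrow> cmod (\<phi> a) \<le> K * norm a" using dual_bound[OF \<phi>] by blast
  have "bdd_above ((\<lambda>a. cmod (\<phi> a)) ` {a \<in> A. norm a \<le> 1})"
  proof (rule bdd_aboveI2[where M = K])
    fix a assume "a \<in> {a \<in> A. norm a \<le> 1}"
    then show "cmod (\<phi> a) \<le> K" using K(2)[of a] mult_left_mono[of "norm a" 1 K] K(1) by simp
  qed
  then show ?thesis unfolding dual_norm_def using a by (intro cSUP_upper) auto
qed

lemma extend0_apply [simp]: "a \<in> A \<Longrightarrow> extend0 A f a = f a"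
  by (simp add: extend0_def)

lemma extend0_outside: "a \<notin> A \<Longrightarrow> extend0 A f a = 0"
  by (simp add: extend0_def)

lemma dual_linear_combination:
  assumes "\<phi> \<in> dual A" "\<psi> \<in> dual A"
  shows "(\<lambda>a. \<phi> a + r * \<psi> a) \<in> dual A"
proof -
  obtain K where K: "0 \<le> K" "\<And>a. a \<in> A \<Longrightarrow> cmod (\<phi> a) \<le> K * norm a"
    using dual_bound[OF assms(1)] by blast
  obtain L where L: "0 \<le> L" "\<And>a. a \<in> A \<Longrightarrow> cmod (\<psi> a) \<le> L * norm a"
    using dual_bound[OF assms(2)] by blast
  have "cmod (\<phi> a + r * \<psi> a) \<le> (K + cmod r * L) * norm a" if a: "a \<in> A" for a
  proof -
    have "cmod (\<phi> a + r * \<psi> a) \<le> cmod (\<phi> a) + cmod r * cmod (\<psi> a)"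
      using norm_triangle_ineq[of "\<phi> a" "r * \<psi> a"] by (simp add: norm_mult)
    also have "\<dots> \<le> K * norm a + cmod r * (L * norm a)"
      using K(2)[OF a] L(2)[OF a] by (intro add_mono mult_left_mono) auto
    finally show ?thesis by (simp add: algebra_simps)
  qed
  moreover have "\<phi> (x + y) + r * \<psi> (x + y) = \<phi> x + r * \<psi> x + (\<phi> y + r * \<psi> y)" if "x \<in> A" "y \<in> A" for x y
    using that by (simp add: dualD[OF assms(1)] dualD[OF assms(2)] algebra_simps)
  moreover have "\<phi> (scaleC_op c x) + r * \<psi> (scaleC_op c x) = c * (\<phi> x + r * \<psi> x)" if "x \<in> A" for x c
    using that by (simp add: dualD[OF assms(1)] dualD[OF assms(2)] algebra_simps)
  moreover have "\<phi> x + r * \<psi> x = 0" if "x \<notin> A" for x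
    using that by (simp add: dualD[OF assms(1)] dualD[OF assms(2)])
  ultimately show ?thesis
    unfolding dual_def by blast
qed

lemma dual_scale:
  assumes "\<psi> \<in> dual A"
  shows "(\<lambda>a. r * \<psi> a) \<in> dual A"
proof -
  have "(\<lambda>_. 0) \<in> dual A" unfolding dual_def by (auto intro!: exI[of _ 0])
  from dual_linear_combination[OF this assms, of r] show ?thesis by simp
qed

lemma dual_sub: "\<phi> \<in> dual A \<Longrightarrow> \<psi> \<in> dual A \<Longrightarrow> (\<lambda>a. \<phi> a - \<psi> a) \<in> dual A"
  using dual_linear_combination[of \<phi> A \<psi> "- 1"] by simp

lemma bidualD:
  assumes "\<Phi> \<in> bidual A"
  shows "\<phi> \<in> dual A \<Longrightarrow> \<psi> \<in> dual A \<Longrightarrow> \<Phi> (\<lambda>a. \<phi> a + \<psi> a) = \<Phi> \<phi> + \<Phi> \<psi>"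
    "\<phi> \<in> dual A \<Longrightarrow> \<Phi> (\<lambda>a. c * \<phi> a) = c * \<Phi> \<phi>" "\<phi> \<notin> dual A \<Longrightarrow> \<Phi> \<phi> = 0"
  using assms unfolding bidual_def by blast+

lemma bidual_sub:
  assumes \<Phi>: "\<Phi> \<in> bidual A" and "\<phi> \<in> dual A" "\<psi> \<in> dual A"
  shows "\<Phi> (\<lambda>a. \<phi> a - \<psi> a) = \<Phi> \<phi> - \<Phi> \<psi>"
  using bidualD(1)[OF \<Phi> assms(2) dual_scale[OF assms(3), of "- 1"]] bidualD(2)[OF \<Phi> assms(3), of "- 1"] by simp

lemma dual_norm_nonneg:
  assumes "\<phi> \<in> dual A" "0 \<in> A"
  shows "0 \<le> dual_norm A \<phi>"
proof -
  have "cmod (\<phi> 0) \<le> dual_norm A \<phi>" by (rule le_dual_norm[OF assms]) simp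
  then show ?thesis using norm_ge_zero[of "\<phi> 0"] by linarith
qed

lemma bidual_bound:
  assumes \<Phi>: "\<Phi> \<in> bidual A" and A: "0 \<in> A"
  obtains K where "0 \<le> K" "\<And>\<phi>. \<phi> \<in> dual A \<Longrightarrow> cmod (\<Phi> \<phi>) \<le> K * dual_norm A \<phi>"
proof -
  obtain K where K: "\<And>\<phi>. \<phi> \<in> dual A \<Longrightarrow> cmod (\<Phi> \<phi>) \<le> K * dual_norm A \<phi>"
    using \<Phi> unfolding bidual_def by blast
  have "cmod (\<Phi> \<phi>) \<le> max K 0 * dual_norm A \<phi>" if "\<phi> \<in> dual A" for \<phi>
    using K[OF that] mult_right_mono[of K "max K 0" "dual_norm A \<phi>"] dual_norm_nonneg[OF that A] by simp
  then show ?thesis using that[of "max K 0"] by simp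
qed

lemma bidual_diff:
  assumes \<Phi>: "\<Phi> \<in> bidual A" and \<Psi>: "\<Psi> \<in> bidual A" and A: "0 \<in> A"
  shows "(\<lambda>\<phi>. \<Phi> \<phi> - \<Psi> \<phi>) \<in> bidual A"
proof -
  obtain K where K: "\<And>\<phi>. \<phi> \<in> dual A \<Longrightarrow> cmod (\<Phi> \<phi>) \<le> K * dual_norm A \<phi>" using bidual_bound[OF \<Phi> A] by metis
  obtain L where L: "\<And>\<phi>. \<phi> \<in> dual A \<Longrightarrow> cmod (\<Psi> \<phi>) \<le> L * dual_norm A \<phi>" using bidual_bound[OF \<Psi> A] by metis
  have "cmod (\<Phi> \<phi> - \<Psi> \<phi>) \<le> (K + L) * dual_norm A \<phi>" if "\<phi> \<in> dual A" for \<phi>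
    using norm_triangle_ineq4[of "\<Phi> \<phi>" "\<Psi> \<phi>"] K[OF that] L[OF that] by (simp add: algebra_simps)
  then show ?thesis
    unfolding bidual_def using bidualD[OF \<Phi>] bidualD[OF \<Psi>]
    by (auto simp: algebra_simps intro!: exI[of _ "K + L"])
qed

definition left_translate ::
  "('h::complex_hilbert_space \<Rightarrow>\<^sub>L 'h) set \<Rightarrow> 'h functional \<Rightarrow> ('h \<Rightarrow>\<^sub>L 'h) \<Rightarrow> 'h functional" where
  "left_translate A \<phi> a = extend0 A (\<lambda>b. \<phi> (a o\<^sub>L b))"

definition right_translate ::
  "('h::complex_hilbert_space \<Rightarrow>\<^sub>L 'h) set \<Rightarrow> 'h functional \<Rightarrow> ('h \<Rightarrow>\<^sub>L 'h) \<Rightarrow> 'h functional" where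
  "right_translate A \<phi> a = extend0 A (\<lambda>b. \<phi> (b o\<^sub>L a))"

text \<open>The functional \<open>\<Psi>\<cdot>\<phi>\<close> from the definition of the Arens product.\<close>

definition bidual_action ::
  "('h::complex_hilbert_space \<Rightarrow>\<^sub>L 'h) set \<Rightarrow> ('h functional \<Rightarrow> complex) \<Rightarrow> 'h functional \<Rightarrow> 'h functional" where
  "bidual_action A \<Psi> \<phi> = extend0 A (\<lambda>a. \<Psi> (left_translate A \<phi> a))"

lemma arens_product_apply:
  "\<phi> \<in> dual A \<Longrightarrow> arens_product A \<Phi> \<Psi> \<phi> = \<Phi> (bidual_action A \<Psi> \<phi>)"
  by (simp add: arens_product_def bidual_action_def left_translate_def)

lemma scaleC_op_compose_left: "scaleC_op c a o\<^sub>L b = scaleC_op c (a o\<^sub>L b)"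
  by (rule blinfun_eqI) simp

lemma scaleC_op_compose_right:
  "a \<in> bounded_operators \<Longrightarrow> a o\<^sub>L scaleC_op c b = scaleC_op c (a o\<^sub>L b)"
  by (rule blinfun_eqI) (simp add: bounded_operators_def)

context
  fixes A :: "('h::complex_hilbert_space \<Rightarrow>\<^sub>L 'h) set"
  assumes A: "operator_algebra A"
begin

lemma algebra_mem: "a \<in> A \<Longrightarrow> b \<in> A \<Longrightarrow> a + b \<in> A" "a \<in> A \<Longrightarrow> b \<in> A \<Longrightarrow> a o\<^sub>L b \<in> A"
  "a \<in> A \<Longrightarrow> scaleC_op c a \<in> A" "0 \<in> A" "a \<in> A \<Longrightarrow> b \<in> A \<Longrightarrow> a - b \<in> A" "a \<in> A \<Longrightarrow> a \<in> bounded_operators"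
  using A subspace_diff[OF operator_algebraD(1)[OF A]]
  by (auto simp: operator_algebra_def complex_subspace_def)

lemma left_translate_dual:
  assumes \<phi>: "\<phi> \<in> dual A" and a: "a \<in> A"
  shows "left_translate A \<phi> a \<in> dual A"
proof -
  obtain K where K: "0 \<le> K" "\<And>a. a \<in> A \<Longrightarrow> cmod (\<phi> a) \<le> K * norm a" using dual_bound[OF \<phi>] by blast
  have "cmod (\<phi> (a o\<^sub>L b)) \<le> (K * norm a) * norm b" if "b \<in> A" for b
    using K(2)[of "a o\<^sub>L b"] mult_left_mono[OF norm_blinfun_compose K(1), of a b] algebra_mem(2)[OF a that]
    by (simp add: mult.assoc)
  then show ?thesis
    using a unfolding dual_def left_translate_def
    by (auto simp: algebra_mem extend0_outside compose_simps scaleC_op_compose_right dualD[OF \<phi>])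
qed

lemma right_translate_dual:
  assumes \<phi>: "\<phi> \<in> dual A" and a: "a \<in> A"
  shows "right_translate A \<phi> a \<in> dual A"
proof -
  obtain K where K: "0 \<le> K" "\<And>a. a \<in> A \<Longrightarrow> cmod (\<phi> a) \<le> K * norm a" using dual_bound[OF \<phi>] by blast
  have "cmod (\<phi> (b o\<^sub>L a)) \<le> (K * norm a) * norm b" if "b \<in> A" for b
    using K(2)[of "b o\<^sub>L a"] mult_left_mono[OF norm_blinfun_compose K(1), of b a] algebra_mem(2)[OF that a]
    by (simp add: mult.assoc mult.commute mult.left_commute)
  then show ?thesis
    using a unfolding dual_def right_translate_def
    by (auto simp: algebra_mem extend0_outside compose_simps scaleC_op_compose_left dualD[OF \<phi>])
qed

lemma bidual_action_dual:
  assumes \<Psi>: "\<Psi> \<in> bidual A" and \<phi>: "\<phi> \<in> dual A"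
  shows "bidual_action A \<Psi> \<phi> \<in> dual A"
proof -
  obtain K where K: "0 \<le> K" "\<And>a. a \<in> A \<Longrightarrow> cmod (\<phi> a) \<le> K * norm a" using dual_bound[OF \<phi>] by blast
  obtain L where L: "0 \<le> L" "\<And>\<phi>. \<phi> \<in> dual A \<Longrightarrow> cmod (\<Psi> \<phi>) \<le> L * dual_norm A \<phi>"
    using bidual_bound[OF \<Psi> algebra_mem(4)] by blast
  have add: "left_translate A \<phi> (a + b) = (\<lambda>c. left_translate A \<phi> a c + left_translate A \<phi> b c)"
    if "a \<in> A" "b \<in> A" for a b
    using that by (auto simp: left_translate_def extend0_def compose_simps algebra_mem dualD[OF \<phi>])
  have scale: "left_translate A \<phi> (scaleC_op r a) = (\<lambda>c. r * left_translate A \<phi> a c)" if "a \<in> A" for a r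
    using that by (auto simp: left_translate_def extend0_def scaleC_op_compose_left algebra_mem dualD[OF \<phi>])
  have bound: "cmod (\<Psi> (left_translate A \<phi> a)) \<le> (L * K) * norm a" if a: "a \<in> A" for a
  proof -
    have "dual_norm A (left_translate A \<phi> a) \<le> K * norm a"
    proof (rule dual_norm_le[OF algebra_mem(4)])
      fix b assume b: "b \<in> A" "norm b \<le> 1"
      have "norm (a o\<^sub>L b) \<le> norm a * 1" using b by (intro norm_blinfun_compose_le) auto
      then show "cmod (left_translate A \<phi> a b) \<le> K * norm a"
        using K(2)[OF algebra_mem(2)[OF a b(1)]] mult_left_mono[OF _ K(1), of "norm (a o\<^sub>L b)" "norm a"] b
        by (simp add: left_translate_def)
    qed
    then show ?thesis
      using L(2)[OF left_translate_dual[OF \<phi> a]] mult_left_mono[OF _ L(1)] by (fastforce simp: mult.assoc)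
  qed
  show ?thesis
    unfolding dual_def bidual_action_def
    using bound by (auto simp: algebra_mem extend0_outside add scale bidualD[OF \<Psi>] left_translate_dual[OF \<phi>])
qed

lemma canonical_embedding_bidual:
  assumes x: "x \<in> A"
  shows "canonical_embedding A x \<in> bidual A"
proof -
  have "cmod (\<phi> x) \<le> norm x * dual_norm A \<phi>" if \<phi>: "\<phi> \<in> dual A" for \<phi>
  proof (cases "x = 0")
    case True
    then show ?thesis using dual_scaleR[OF \<phi> x, of 0] by simp
  next
    case False
    have "(1 / norm x) *\<^sub>R x \<in> A" using operator_algebraD(1)[OF A] x by (rule subspace_scale)
    then have "cmod (\<phi> ((1 / norm x) *\<^sub>R x)) \<le> dual_norm A \<phi>" using False by (intro le_dual_norm[OF \<phi>]) auto
    then show ?thesis using False by (simp add: dual_scaleR[OF \<phi> x] norm_mult field_simps norm_divide)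
  qed
  moreover have "(\<lambda>a. \<phi> a + \<psi> a) \<in> dual A" if "\<phi> \<in> dual A" "\<psi> \<in> dual A" for \<phi> \<psi>
    using dual_linear_combination[OF that, of 1] by simp
  moreover have "(\<lambda>a. c * \<phi> a) \<in> dual A" if "\<phi> \<in> dual A" for \<phi> c using that by (rule dual_scale)
  ultimately show ?thesis
    unfolding bidual_def canonical_embedding_def by (auto simp: extend0_def)
qed

lemma bidual_action_canonical_embedding:
  assumes x: "x \<in> A" and \<phi>: "\<phi> \<in> dual A"
  shows "bidual_action A (canonical_embedding A x) \<phi> = right_translate A \<phi> x"
proof (rule ext)
  fix a
  show "bidual_action A (canonical_embedding A x) \<phi> a = right_translate A \<phi> x a"
  proof (cases "a \<in> A")
    case True
    then have "canonical_embedding A x (left_translate A \<phi> a) = left_translate A \<phi> a x"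
      using left_translate_dual[OF \<phi>] by (simp add: canonical_embedding_def)
    then show ?thesis using True x
      by (simp add: bidual_action_def right_translate_def) (simp add: left_translate_def)
  qed (simp add: bidual_action_def right_translate_def extend0_outside)
qed

end

section \<open>Support projections\<close>

lemma weak_star_limit_tendsto:
  assumes "weak_star_limit A F p" "\<phi> \<in> dual A"
  shows "(\<phi> \<longlongrightarrow> p \<phi>) F"
proof -
  have "((\<lambda>x. canonical_embedding A x \<phi>) \<longlongrightarrow> p \<phi>) F" using assms by (simp add: weak_star_limit_def)
  then show ?thesis using assms(2) by (simp add: canonical_embedding_def)
qed

lemma left_cai_weak_star_convergent:
  assumes A: "operator_algebra A" and J: "r_ideal A J"
  obtains p where "\<And>F. left_contractive_approx_identity J F \<Longrightarrow> weak_star_limit A F p"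
proof -
  have "\<exists>l. \<forall>F. left_contractive_approx_identity J F \<longrightarrow> (\<phi> \<longlongrightarrow> l) F" if \<phi>: "\<phi> \<in> dual A" for \<phi>
  proof -
    obtain F where "left_contractive_approx_identity J F" using J by (auto simp: r_ideal_def)
    from left_cai_functional_convergent[OF A J \<phi> this] show ?thesis by blast
  qed
  then obtain p' where p': "\<And>\<phi> F. \<phi> \<in> dual A \<Longrightarrow> left_contractive_approx_identity J F \<Longrightarrow> (\<phi> \<longlongrightarrow> p' \<phi>) F"
    by metis
  define p where "p = extend0 (dual A) p'"
  have lim: "(\<phi> \<longlongrightarrow> p \<phi>) F" if "\<phi> \<in> dual A" "left_contractive_approx_identity J F" for \<phi> F
    using p' that by (simp add: p_def)
  obtain F where F: "left_contractive_approx_identity J F" using J by (auto simp: r_ideal_def)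
  note F' = left_contractive_approx_identityD[OF F]
  have "p \<in> bidual A"
    unfolding bidual_def
  proof (intro CollectI conjI ballI allI impI exI)
    fix \<phi> c assume \<phi>: "\<phi> \<in> dual A"
    show "p (\<lambda>a. c * \<phi> a) = c * p \<phi>"
      by (rule tendsto_unique[OF F'(1) lim[OF dual_scale[OF \<phi>] F]])
         (intro tendsto_mult tendsto_const lim \<phi> F)
    show "cmod (p \<phi>) \<le> 1 * dual_norm A \<phi>"
    proof (rule Lim_norm_ubound[OF F'(1) lim[OF \<phi> F]])
      show "eventually (\<lambda>e. norm (\<phi> e) \<le> 1 * dual_norm A \<phi>) F"
        using F'(2) by (rule eventually_mono) (use r_idealD(3)[OF J] le_dual_norm[OF \<phi>] in auto)
    qed
    fix \<psi> assume \<psi>: "\<psi> \<in> dual A"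
    have "(\<lambda>a. \<phi> a + \<psi> a) \<in> dual A" using dual_linear_combination[OF \<phi> \<psi>, of 1] by simp
    from tendsto_unique[OF F'(1) lim[OF this F] tendsto_add[OF lim[OF \<phi> F] lim[OF \<psi> F]]]
    show "p (\<lambda>a. \<phi> a + \<psi> a) = p \<phi> + p \<psi>" .
  qed (simp add: p_def extend0_outside)
  then show ?thesis
    using lim by (intro that[of p]) (simp add: weak_star_limit_def canonical_embedding_def)
qed

lemma weak_star_limit_support_projection:
  assumes A: "operator_algebra A" and J: "r_ideal A J" and F: "left_contractive_approx_identity J F"
  shows "weak_star_limit A F (support_projection A J)"
proof -
  obtain p where p: "\<And>F. left_contractive_approx_identity J F \<Longrightarrow> weak_star_limit A F p"
    using left_cai_weak_star_convergent[OF A J] by blast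
  have "support_projection A J = p"
    unfolding support_projection_def
  proof (rule the_equality)
    show "\<exists>F. left_contractive_approx_identity J F \<and> weak_star_limit A F p" using F p by blast
    fix p' assume "\<exists>F. left_contractive_approx_identity J F \<and> weak_star_limit A F p'"
    then obtain F' where F': "left_contractive_approx_identity J F'" "weak_star_limit A F' p'" by blast
    show "p' = p"
    proof (rule ext)
      fix \<phi>
      show "p' \<phi> = p \<phi>"
      proof (cases "\<phi> \<in> dual A")
        case True
        show ?thesis
          by (rule tendsto_unique[OF left_contractive_approx_identityD(1)[OF F'(1)]
              weak_star_limit_tendsto[OF F'(2) True] weak_star_limit_tendsto[OF p[OF F'(1)] True]])
      next
        case False
        have "p' \<in> bidual A" "p \<in> bidual A" using F'(2) p[OF F] by (simp_all add: weak_star_limit_def)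
        then show ?thesis using False by (simp add: bidualD(3))
      qed
    qed
  qed
  then show ?thesis using p[OF F] by simp
qed

lemma support_projection_bidual:
  assumes "operator_algebra A" "r_ideal A J"
  shows "support_projection A J \<in> bidual A"
  using assms weak_star_limit_support_projection[OF assms]
  unfolding r_ideal_def weak_star_limit_def by blast

lemma support_projection_tendsto:
  assumes "operator_algebra A" "r_ideal A J" "left_contractive_approx_identity J F" "\<phi> \<in> dual A"
  shows "(\<phi> \<longlongrightarrow> support_projection A J \<phi>) F"
  using weak_star_limit_tendsto[OF weak_star_limit_support_projection[OF assms(1-3)] assms(4)] .

lemma dual_bound_on_ideal_if_ball:
  assumes \<psi>: "\<psi> \<in> dual A" and J: "r_ideal A J"
    and ball: "\<And>b. b \<in> J \<Longrightarrow> norm b \<le> 1 \<Longrightarrow> cmod (\<psi> b) \<le> \<delta>" and j: "j \<in> J"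
  shows "cmod (\<psi> j) \<le> norm j * \<delta>"
proof (cases "j = 0")
  case True
  then show ?thesis using dual_scaleR[OF \<psi>, of j 0] r_idealD(3)[OF J] j by auto
next
  case False
  have "(1 / norm j) *\<^sub>R j \<in> J" using r_idealD(1)[OF J] j by (rule subspace_scale)
  then have "cmod (\<psi> ((1 / norm j) *\<^sub>R j)) \<le> \<delta>" using False by (intro ball) auto
  moreover have "j \<in> A" using r_idealD(3)[OF J] j by blast
  ultimately show ?thesis using False by (simp add: dual_scaleR[OF \<psi>] norm_mult norm_divide field_simps)
qed

text \<open>The hypothesis says that \<open>\<Psi>\<close> is a bounded functional of the restrictions to \<open>J\<close>, that is,
  \<open>\<Psi>\<close> belongs to the weak* closure of \<open>J\<close>. Norm convergence of the translates on \<open>J\<close> then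
  allows the limit along the approximate identity to be taken inside \<open>\<Psi>\<close>.\<close>

lemma support_projection_left_identity:
  assumes A: "operator_algebra A" and J: "r_ideal A J" and \<Psi>: "\<Psi> \<in> bidual A" and K: "0 \<le> K"
    and control: "\<And>\<psi> \<delta>. \<psi> \<in> dual A \<Longrightarrow> (\<And>b. b \<in> J \<Longrightarrow> norm b \<le> 1 \<Longrightarrow> cmod (\<psi> b) \<le> \<delta>)
      \<Longrightarrow> cmod (\<Psi> \<psi>) \<le> K * \<delta>"
  shows "arens_product A (support_projection A J) \<Psi> = \<Psi>"
proof (rule ext)
  fix \<phi>
  show "arens_product A (support_projection A J) \<Psi> \<phi> = \<Psi> \<phi>"
  proof (cases "\<phi> \<in> dual A")
    case False
    then show ?thesis by (simp add: arens_product_def extend0_outside bidualD(3)[OF \<Psi>])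
  next
    case \<phi>: True
    obtain F where F: "left_contractive_approx_identity J F" using J by (auto simp: r_ideal_def)
    note F' = left_contractive_approx_identityD[OF F] and J' = r_idealD[OF J]
    have FA: "eventually (\<lambda>e. e \<in> A) F" using F'(2) by (rule eventually_mono) (use J' in auto)
    have "((\<lambda>e. \<Psi> (left_translate A \<phi> e)) \<longlongrightarrow> \<Psi> \<phi>) F"
      unfolding tendsto_iff
    proof (intro allI impI)
      fix \<epsilon> :: real assume \<epsilon>: "0 < \<epsilon>"
      define \<delta> where "\<delta> = \<epsilon> / (K + 1)"
      have \<delta>: "0 < \<delta>" "K * \<delta> < \<epsilon>" using K \<epsilon> by (simp_all add: \<delta>_def field_simps)
      show "eventually (\<lambda>e. dist (\<Psi> (left_translate A \<phi> e)) (\<Psi> \<phi>) < \<epsilon>) F"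
        using eventually_conj[OF FA left_cai_functional_uniform[OF A J \<phi> F \<delta>(1)]]
      proof (rule eventually_mono)
        fix e assume e: "e \<in> A \<and> (\<forall>b\<in>J. norm b \<le> 1 \<longrightarrow> cmod (\<phi> (b - (e o\<^sub>L b))) \<le> \<delta>)"
        then have lt: "left_translate A \<phi> e \<in> dual A" using left_translate_dual[OF A \<phi>] by blast
        have "cmod (\<Psi> (\<lambda>a. \<phi> a - left_translate A \<phi> e a)) \<le> K * \<delta>"
        proof (rule control[OF dual_sub[OF \<phi> lt]])
          fix b assume b: "b \<in> J" "norm b \<le> 1"
          then have "b \<in> A" "e o\<^sub>L b \<in> A" using J' e algebra_mem[OF A] by auto
          then have "\<phi> b - left_translate A \<phi> e b = \<phi> (b - (e o\<^sub>L b))"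
            using dual_diff[OF \<phi> operator_algebraD(2)[OF A]] by (simp add: left_translate_def)
          then show "cmod (\<phi> b - left_translate A \<phi> e b) \<le> \<delta>" using e b by simp
        qed
        then show "dist (\<Psi> (left_translate A \<phi> e)) (\<Psi> \<phi>) < \<epsilon>"
          using \<delta>(2) by (simp add: bidual_sub[OF \<Psi> \<phi> lt] dist_norm norm_minus_commute)
      qed
    qed
    moreover have "eventually (\<lambda>e. \<Psi> (left_translate A \<phi> e) = bidual_action A \<Psi> \<phi> e) F"
      using FA by (rule eventually_mono) (simp add: bidual_action_def)
    ultimately have "(bidual_action A \<Psi> \<phi> \<longlongrightarrow> \<Psi> \<phi>) F" by (rule Lim_transform_eventually)
    moreover have "(bidual_action A \<Psi> \<phi> \<longlongrightarrow> support_projection A J (bidual_action A \<Psi> \<phi>)) F"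
      by (rule support_projection_tendsto[OF A J F bidual_action_dual[OF A \<Psi> \<phi>]])
    ultimately show ?thesis
      using tendsto_unique[OF F'(1)] by (simp add: arens_product_apply[OF \<phi>])
  qed
qed

lemma support_projection_control:
  assumes A: "operator_algebra A" and J: "r_ideal A J" and \<psi>: "\<psi> \<in> dual A"
    and ball: "\<And>b. b \<in> J \<Longrightarrow> norm b \<le> 1 \<Longrightarrow> cmod (\<psi> b) \<le> \<delta>"
  shows "cmod (support_projection A J \<psi>) \<le> \<delta>"
proof -
  obtain F where F: "left_contractive_approx_identity J F" using J by (auto simp: r_ideal_def)
  note F' = left_contractive_approx_identityD[OF F]
  have "eventually (\<lambda>e. norm (\<psi> e) \<le> \<delta>) F" using F'(2) by (rule eventually_mono) (simp add: ball)
  then show ?thesis by (rule Lim_norm_ubound[OF F'(1) support_projection_tendsto[OF A J F \<psi>]])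
qed

lemma support_projection_idempotent:
  assumes A: "operator_algebra A" and J: "r_ideal A J"
  shows "arens_product A (support_projection A J) (support_projection A J) = support_projection A J"
  by (rule support_projection_left_identity[OF A J support_projection_bidual[OF A J], where K = 1])
     (use support_projection_control[OF A J] in auto)

subsection \<open>The identity of the bidual\<close>

lemma approximately_unital_r_ideal:
  assumes A: "operator_algebra A" and G: "contractive_approx_identity A G"
  shows "left_contractive_approx_identity A G" "r_ideal A A"
proof -
  show "left_contractive_approx_identity A G"
    using G by (auto simp: contractive_approx_identity_def left_contractive_approx_identity_def)
  then show "r_ideal A A"
    using operator_algebraD[OF A] by (auto simp: r_ideal_def right_ideal_def)
qed

text \<open>The limit \<open>E\<close> of an approximate identity \<open>u\<close> is a right identity just because \<open>a u \<rightarrow> a\<close>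
  gives \<open>E\<cdot>\<phi> = \<phi>\<close>. That it is a left identity is the case \<open>J = A\<close> of the lemma on the
  weak* closure of \<open>J\<close>, in which the bound for \<open>\<Phi>\<close> is its continuity.\<close>

lemma bidual_one_eq_support_projection:
  assumes A: "operator_algebra A" "approximately_unital A"
  shows "bidual_one A = support_projection A A"
    and "\<Phi> \<in> bidual A \<Longrightarrow> arens_product A (bidual_one A) \<Phi> = \<Phi>"
    and "\<phi> \<in> dual A \<Longrightarrow> bidual_action A (bidual_one A) \<phi> = \<phi>"
proof -
  obtain G where G: "contractive_approx_identity A G" using A(2) by (auto simp: approximately_unital_def)
  note AA = approximately_unital_r_ideal[OF A(1) G]
  note G' = left_contractive_approx_identityD[OF AA(1)]
  let ?E = "support_projection A A"
  have E: "?E \<in> bidual A" by (rule support_projection_bidual[OF A(1) AA(2)])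
  have left: "arens_product A ?E \<Phi> = \<Phi>" if \<Phi>: "\<Phi> \<in> bidual A" for \<Phi>
  proof -
    obtain K where K: "0 \<le> K" "\<And>\<phi>. \<phi> \<in> dual A \<Longrightarrow> cmod (\<Phi> \<phi>) \<le> K * dual_norm A \<phi>"
      using bidual_bound[OF \<Phi> algebra_mem(4)[OF A(1)]] by blast
    show ?thesis
    proof (rule support_projection_left_identity[OF A(1) AA(2) \<Phi> K(1)])
      fix \<psi> \<delta> assume \<psi>: "\<psi> \<in> dual A" and "\<And>b. b \<in> A \<Longrightarrow> norm b \<le> 1 \<Longrightarrow> cmod (\<psi> b) \<le> \<delta>"
      then have "dual_norm A \<psi> \<le> \<delta>" by (intro dual_norm_le[OF algebra_mem(4)[OF A(1)]])
      then have "K * dual_norm A \<psi> \<le> K * \<delta>" using K(1) by (rule mult_left_mono)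
      then show "cmod (\<Phi> \<psi>) \<le> K * \<delta>" using K(2)[OF \<psi>] by linarith
    qed
  qed
  have action: "bidual_action A ?E \<phi> = \<phi>" if \<phi>: "\<phi> \<in> dual A" for \<phi>
  proof (rule ext)
    fix a
    show "bidual_action A ?E \<phi> a = \<phi> a"
    proof (cases "a \<in> A")
      case True
      have GA: "eventually (\<lambda>u. u \<in> A) G" using G'(2) by (rule eventually_mono) simp
      have "((\<lambda>u. \<phi> (a o\<^sub>L u)) \<longlongrightarrow> \<phi> a) G"
      proof (rule dual_tendsto[OF \<phi> operator_algebraD(2)[OF A(1)] True])
        show "((\<lambda>u. a o\<^sub>L u) \<longlongrightarrow> a) G" using G True by (simp add: contractive_approx_identity_def)
        show "eventually (\<lambda>u. a o\<^sub>L u \<in> A) G"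
          using GA by (rule eventually_mono) (use algebra_mem[OF A(1)] True in blast)
      qed
      moreover have "eventually (\<lambda>u. \<phi> (a o\<^sub>L u) = left_translate A \<phi> a u) G"
        using GA by (rule eventually_mono) (simp add: left_translate_def)
      ultimately have "(left_translate A \<phi> a \<longlongrightarrow> \<phi> a) G" by (rule Lim_transform_eventually)
      then show ?thesis
        using tendsto_unique[OF G'(1)] True
          support_projection_tendsto[OF A(1) AA(2) AA(1) left_translate_dual[OF A(1) \<phi> True]]
        by (simp add: bidual_action_def)
    qed (simp add: bidual_action_def extend0_outside dualD(3)[OF \<phi>])
  qed
  have right: "arens_product A \<Phi> ?E = \<Phi>" if \<Phi>: "\<Phi> \<in> bidual A" for \<Phi>
  proof (rule ext)
    fix \<phi>
    show "arens_product A \<Phi> ?E \<phi> = \<Phi> \<phi>"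
    proof (cases "\<phi> \<in> dual A")
      case True
      then show ?thesis by (simp add: arens_product_apply action)
    qed (simp add: arens_product_def extend0_outside bidualD(3)[OF \<Phi>])
  qed
  show eq: "bidual_one A = ?E"
    unfolding bidual_one_def
  proof (rule the_equality)
    fix E' assume E': "E' \<in> bidual A \<and> (\<forall>\<Phi>\<in>bidual A. arens_product A E' \<Phi> = \<Phi> \<and> arens_product A \<Phi> E' = \<Phi>)"
    then have "E' = arens_product A E' ?E" using right by simp
    also have "\<dots> = ?E" using E' E by blast
    finally show "E' = ?E" .
  qed (use E left right in blast)
  show "\<Phi> \<in> bidual A \<Longrightarrow> arens_product A (bidual_one A) \<Phi> = \<Phi>"
    "\<phi> \<in> dual A \<Longrightarrow> bidual_action A (bidual_one A) \<phi> = \<phi>"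
    unfolding eq by (fact left action)+
qed

subsection \<open>Self-adjointness\<close>

lemma cinner_scaleC_right: "cinner x (c *\<^sub>C y) = cnj c * cinner x y"
proof -
  have "cinner x (c *\<^sub>C y) = cnj (c * cinner y x)"
    by (subst cinner_commute) (simp only: cinner_scaleC_left)
  then show ?thesis by (simp flip: cinner_commute)
qed

lemma cinner_eq_Complex_inner:
  fixes x y :: "'h::complex_hilbert_space"
  shows "cinner x y = Complex (inner x y) (- inner (\<i> *\<^sub>C x) y)"
  by (simp add: complex_eq_iff inner_eq_Re_cinner cinner_scaleC_left)

lemma cinner_adj:
  assumes "T \<in> bounded_operators"
  shows "cinner (blinfun_apply T x) y = cinner x (blinfun_apply (adj T) y)"
proof -
  have "\<i> *\<^sub>C blinfun_apply T x = blinfun_apply T (\<i> *\<^sub>C x)" using assms by (simp add: bounded_operators_def)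
  then show ?thesis by (simp add: cinner_eq_Complex_inner inner_adj)
qed

lemma adj_bounded_operators:
  assumes "T \<in> bounded_operators"
  shows "adj T \<in> bounded_operators"
  unfolding bounded_operators_def
proof (intro CollectI allI, rule inner_eqI)
  fix c x y
  have "cinner y (adj T (c *\<^sub>C x)) = cinner y (c *\<^sub>C adj T x)"
    by (simp add: cinner_scaleC_right flip: cinner_adj[OF assms])
  then show "inner y (adj T (c *\<^sub>C x)) = inner y (c *\<^sub>C adj T x)" by (simp add: inner_eq_Re_cinner)
qed

lemma adjoint_op_eq_adj:
  assumes "T \<in> bounded_operators"
  shows "adjoint_op T = adj T"
  unfolding adjoint_op_def
proof (rule the_equality)
  show "adj T \<in> bounded_operators \<and> (\<forall>x y. cinner (T x) y = cinner x (adj T y))"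
    using assms by (simp add: cinner_adj adj_bounded_operators)
  fix S assume "S \<in> bounded_operators \<and> (\<forall>x y. cinner (T x) y = cinner x (blinfun_apply S y))"
  then have "adj T = S" by (intro adj_unique) (simp add: inner_eq_Re_cinner)
  then show "S = adj T" by simp
qed

lemma complex_subspace_bounded_operators:
  "complex_subspace (bounded_operators :: ('a::complex_hilbert_space \<Rightarrow>\<^sub>L 'a) set)"
proof -
  have "c *\<^sub>C (0 :: 'a) = 0" for c using norm_scaleC[of c "0 :: 'a"] by simp
  moreover have "c *\<^sub>C d *\<^sub>C x = d *\<^sub>C c *\<^sub>C x" for c d and x :: 'a
    by (simp add: scaleC_scaleC mult.commute)
  ultimately show ?thesis
    by (simp add: complex_subspace_def bounded_operators_def blinfun.add_left scaleC_add_right)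
qed

lemma bounded_operators_compose:
  "S \<in> bounded_operators \<Longrightarrow> T \<in> bounded_operators \<Longrightarrow> S o\<^sub>L T \<in> bounded_operators"
  by (simp add: bounded_operators_def)

lemma adj_scaleC_op:
  assumes "T \<in> bounded_operators"
  shows "adj (scaleC_op c T) = scaleC_op (cnj c) (adj T)"
proof (rule adj_unique)
  fix x y
  have "cinner (c *\<^sub>C blinfun_apply T x) y = cinner x (cnj c *\<^sub>C blinfun_apply (adj T) y)"
    by (simp add: cinner_scaleC_left cinner_scaleC_right cinner_adj[OF assms])
  then show "inner (scaleC_op c T x) y = inner x (scaleC_op (cnj c) (adj T) y)" by (simp add: inner_eq_Re_cinner)
qed

lemma dual_adjoint:
  assumes \<psi>: "\<psi> \<in> dual bounded_operators"
  defines "\<psi>' \<equiv> extend0 bounded_operators (\<lambda>T. cnj (\<psi> (adjoint_op T)))"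
  shows "\<psi>' \<in> dual bounded_operators"
proof -
  let ?B = "bounded_operators :: ('a \<Rightarrow>\<^sub>L 'a) set"
  have \<psi>': "\<psi>' T = cnj (\<psi> (adj T))" if "T \<in> ?B" for T
    using that by (simp add: \<psi>'_def adjoint_op_eq_adj)
  have B: "a + b \<in> ?B" "scaleC_op c a \<in> ?B" if "a \<in> ?B" "b \<in> ?B" for a b c
    using complex_subspace_bounded_operators that by (auto simp: complex_subspace_def)
  obtain K where K: "\<And>a. a \<in> ?B \<Longrightarrow> cmod (\<psi> a) \<le> K * norm a" using dual_bound[OF \<psi>] by blast
  show ?thesis
    unfolding dual_def
  proof (intro CollectI conjI ballI allI impI exI)
    fix a b c assume a: "a \<in> ?B"
    show "\<psi>' (scaleC_op c a) = c * \<psi>' a"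
      using a B(2)[OF a a] by (simp add: \<psi>' adj_scaleC_op dualD(2)[OF \<psi>] adj_bounded_operators)
    show "cmod (\<psi>' a) \<le> K * norm a"
      using K[OF adj_bounded_operators[OF a]] by (simp add: \<psi>'[OF a])
    assume b: "b \<in> ?B"
    show "\<psi>' (a + b) = \<psi>' a + \<psi>' b"
      using a b B(1)[OF a b] by (simp add: \<psi>' adj_add dualD(1)[OF \<psi>] adj_bounded_operators)
  qed (simp add: \<psi>'_def extend0_outside)
qed

lemma dual_restrict:
  assumes "\<psi> \<in> dual B" "A \<subseteq> B" "complex_subspace A"
  shows "extend0 A \<psi> \<in> dual A"
proof -
  obtain K where "\<And>a. a \<in> B \<Longrightarrow> cmod (\<psi> a) \<le> K * norm a" using dual_bound[OF assms(1)] by blast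
  then have "\<forall>a\<in>A. cmod (extend0 A \<psi> a) \<le> K * norm a" using assms(2) by auto
  then show ?thesis
    using assms(2,3) dualD(1,2)[OF assms(1)] unfolding dual_def complex_subspace_def
    by (auto simp: extend0_outside subset_iff)
qed

text \<open>Since \<open>e - e e\<^sup>*\<close> tends to \<open>0\<close> weakly in \<open>B(H)\<close>, the limit of \<open>e\<close> is also that of the
  self-adjoint operators \<open>e e\<^sup>*\<close>.\<close>

lemma support_projection_self_adjoint:
  assumes A: "operator_algebra A" and J: "r_ideal A J"
  shows "bidual_adjoint (bidual_inclusion A (support_projection A J))
    = bidual_inclusion A (support_projection A J)"
proof (rule ext)
  fix \<psi> :: "'a functional"
  let ?B = "bounded_operators :: ('a \<Rightarrow>\<^sub>L 'a) set"
  let ?p = "support_projection A J"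
  note AB = operator_algebraD(5,2)[OF A] and J' = r_idealD[OF J]
  note sB = subspace_if_complex_subspace[OF complex_subspace_bounded_operators]
  obtain F where F: "left_contractive_approx_identity J F" using J by (auto simp: r_ideal_def)
  note F' = left_contractive_approx_identityD[OF F]
  have FA: "eventually (\<lambda>e. e \<in> A) F" using F'(2) by (rule eventually_mono) (use J' in auto)
  have lim: "(\<psi> \<longlongrightarrow> ?p (extend0 A \<psi>)) F" if \<psi>: "\<psi> \<in> dual ?B" for \<psi>
  proof (rule Lim_transform_eventually)
    show "(extend0 A \<psi> \<longlongrightarrow> ?p (extend0 A \<psi>)) F"
      by (rule support_projection_tendsto[OF A J F dual_restrict[OF \<psi> AB]])
    show "eventually (\<lambda>e. extend0 A \<psi> e = \<psi> e) F" using FA by (rule eventually_mono) simp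
  qed
  have memB: "e \<in> ?B" "adj e \<in> ?B" "e o\<^sub>L adj e \<in> ?B" "e - (e o\<^sub>L adj e) \<in> ?B" if "e \<in> A" for e
    using AB that by (auto intro!: subspace_diff[OF sB] bounded_operators_compose adj_bounded_operators)
  have defect: "((\<lambda>e. \<psi> e - \<psi> (e o\<^sub>L adj e)) \<longlongrightarrow> 0) F" if \<psi>: "\<psi> \<in> dual ?B" for \<psi>
  proof (rule Lim_transform_eventually)
    show "((\<lambda>e. \<psi> (e - (e o\<^sub>L adj e))) \<longlongrightarrow> 0) F"
    proof (rule dual_tendsto_0_if_almost_orthogonal[OF \<psi> complex_subspace_bounded_operators F'(2), where M = 2])
      show "e - (e o\<^sub>L adj e) \<in> ?B" if "e \<in> {e \<in> J. norm e \<le> 1}" for e using memB that J' by auto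
      show "norm (e - (e o\<^sub>L adj e)) \<le> 2" if "e \<in> {e \<in> J. norm e \<le> 1}" for e
        using norm_triangle_ineq4[of e "e o\<^sub>L adj e"] norm_blinfun_compose_le[of e 1 "adj e" 1] that by simp
      show "((\<lambda>e. adj (e - (e o\<^sub>L adj e)) o\<^sub>L (s - (s o\<^sub>L adj s))) \<longlongrightarrow> 0) F"
        if "s \<in> {e \<in> J. norm e \<le> 1}" for s using left_cai_defect_tendsto_0[OF F] that by simp
    qed
    show "eventually (\<lambda>e. \<psi> (e - (e o\<^sub>L adj e)) = \<psi> e - \<psi> (e o\<^sub>L adj e)) F"
      using FA by (rule eventually_mono) (intro dual_diff[OF \<psi> complex_subspace_bounded_operators] memB)
  qed
  show "bidual_adjoint (bidual_inclusion A ?p) \<psi> = bidual_inclusion A ?p \<psi>"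
  proof (cases "\<psi> \<in> dual ?B")
    case False
    then show ?thesis by (simp add: bidual_adjoint_def bidual_inclusion_def extend0_outside)
  next
    case \<psi>: True
    define \<psi>' where "\<psi>' = extend0 ?B (\<lambda>T. cnj (\<psi> (adjoint_op T)))"
    have \<psi>': "\<psi>' \<in> dual ?B" unfolding \<psi>'_def using \<psi> by (rule dual_adjoint)
    have "((\<lambda>e. \<psi>' e - (\<psi>' e - \<psi>' (e o\<^sub>L adj e))) \<longlongrightarrow> ?p (extend0 A \<psi>') - 0) F"
      by (intro tendsto_diff lim defect \<psi>')
    then have "((\<lambda>e. cnj (\<psi>' (e o\<^sub>L adj e))) \<longlongrightarrow> cnj (?p (extend0 A \<psi>'))) F"
      by (intro tendsto_cnj) simp
    moreover have "eventually (\<lambda>e. cnj (\<psi>' (e o\<^sub>L adj e)) = \<psi> (e o\<^sub>L adj e)) F"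
      using FA
    proof (rule eventually_mono)
      fix e assume "e \<in> A"
      then have "e o\<^sub>L adj e \<in> ?B" by (rule memB)
      then show "cnj (\<psi>' (e o\<^sub>L adj e)) = \<psi> (e o\<^sub>L adj e)"
        by (simp add: \<psi>'_def adjoint_op_eq_adj adj_compose)
    qed
    ultimately have "((\<lambda>e. \<psi> (e o\<^sub>L adj e)) \<longlongrightarrow> cnj (?p (extend0 A \<psi>'))) F"
      by (rule Lim_transform_eventually)
    moreover have "((\<lambda>e. \<psi> e - (\<psi> e - \<psi> (e o\<^sub>L adj e))) \<longlongrightarrow> ?p (extend0 A \<psi>) - 0) F"
      by (intro tendsto_diff lim defect \<psi>)
    ultimately have "cnj (?p (extend0 A \<psi>')) = ?p (extend0 A \<psi>)"
      using tendsto_unique[OF F'(1)] by simp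
    then show ?thesis
      using \<psi> \<psi>' by (simp add: bidual_adjoint_def bidual_inclusion_def \<psi>'_def)
  qed
qed

section \<open>Compactness of the complement\<close>

lemma is_projection_support_projection:
  assumes "operator_algebra A" "r_ideal A J"
  shows "is_projection A (support_projection A J)"
  using assms unfolding is_projection_def
  by (simp add: support_projection_bidual support_projection_idempotent support_projection_self_adjoint)

lemma open_projection_support_projection:
  assumes A: "operator_algebra A" and J: "r_ideal A J"
  shows "open_projection A (support_projection A J)"
proof -
  obtain F where F: "left_contractive_approx_identity J F" using J by (auto simp: r_ideal_def)
  let ?p = "support_projection A J"
  have J': "j \<in> A" if "j \<in> J" for j using r_idealD(3)[OF J] that by blast
  have "arens_product A ?p (canonical_embedding A j) = canonical_embedding A j" if j: "j \<in> J" for j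
  proof (rule support_projection_left_identity[OF A J canonical_embedding_bidual[OF A J'[OF j]], where K = "norm j"])
    show "cmod (canonical_embedding A j \<psi>) \<le> norm j * \<delta>"
      if "\<psi> \<in> dual A" "\<And>b. b \<in> J \<Longrightarrow> norm b \<le> 1 \<Longrightarrow> cmod (\<psi> b) \<le> \<delta>" for \<psi> \<delta>
      using dual_bound_on_ideal_if_ball[OF that(1) J that(2) j] that(1) by (simp add: canonical_embedding_def)
  qed simp
  then have "net_in {x \<in> A. canonical_embedding A x = arens_product A ?p (canonical_embedding A x)} F"
    using left_contractive_approx_identityD(1,2)[OF F] J'
    unfolding net_in_def le_principal by (auto elim!: eventually_mono)
  then show ?thesis
    using is_projection_support_projection[OF A J] weak_star_limit_support_projection[OF A J F]
    unfolding open_projection_def by blast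
qed

lemma bidual_complement_complement: "bidual_complement A (bidual_complement A q) = q"
  by (simp add: bidual_complement_def)

lemma is_projection_complement:
  assumes A: "operator_algebra A" "approximately_unital A" and J: "r_ideal A J"
  shows "is_projection A (bidual_complement A (support_projection A J))"
proof -
  let ?p = "support_projection A J" and ?E = "bidual_one A"
  let ?q = "bidual_complement A ?p"
  note one = bidual_one_eq_support_projection[OF A]
  obtain G where G: "contractive_approx_identity A G" using A(2) by (auto simp: approximately_unital_def)
  note AA = approximately_unital_r_ideal(2)[OF A(1) G]
  have E: "?E \<in> bidual A" unfolding one by (rule support_projection_bidual[OF A(1) AA])
  have p: "?p \<in> bidual A" by (rule support_projection_bidual[OF A(1) J])
  have q: "?q \<in> bidual A"
    unfolding bidual_complement_def by (rule bidual_diff[OF E p algebra_mem(4)[OF A(1)]])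
  have "arens_product A ?q ?q = ?q"
  proof (rule ext)
    fix \<phi>
    show "arens_product A ?q ?q \<phi> = ?q \<phi>"
    proof (cases "\<phi> \<in> dual A")
      case \<phi>: True
      have p\<phi>: "bidual_action A ?p \<phi> \<in> dual A" by (rule bidual_action_dual[OF A(1) p \<phi>])
      have "bidual_action A ?q \<phi> = (\<lambda>a. bidual_action A ?E \<phi> a - bidual_action A ?p \<phi> a)"
        by (auto simp: bidual_action_def bidual_complement_def extend0_def)
      also have "\<dots> = (\<lambda>a. \<phi> a - bidual_action A ?p \<phi> a)" by (simp add: one(3)[OF \<phi>])
      finally have "arens_product A ?q ?q \<phi> = ?q (\<lambda>a. \<phi> a - bidual_action A ?p \<phi> a)"
        by (simp add: arens_product_apply[OF \<phi>])
      also have "\<dots> = (?E \<phi> - arens_product A ?E ?p \<phi>) - (?p \<phi> - arens_product A ?p ?p \<phi>)"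
        unfolding arens_product_apply[OF \<phi>]
        by (simp add: bidual_complement_def bidual_sub[OF E \<phi> p\<phi>] bidual_sub[OF p \<phi> p\<phi>])
      also have "\<dots> = ?q \<phi>"
        by (simp add: one(2)[OF p] support_projection_idempotent[OF A(1) J] bidual_complement_def)
      finally show ?thesis .
    qed (simp add: arens_product_def extend0_outside bidualD(3)[OF q])
  qed
  moreover have "bidual_adjoint (bidual_inclusion A ?q) = bidual_inclusion A ?q"
  proof (rule ext)
    fix \<psi> :: "'a functional"
    have incl: "bidual_inclusion A ?q \<psi> = bidual_inclusion A ?E \<psi> - bidual_inclusion A ?p \<psi>" for \<psi>
      by (simp add: bidual_inclusion_def bidual_complement_def extend0_def)
    have "bidual_adjoint (bidual_inclusion A ?q) \<psi>
        = bidual_adjoint (bidual_inclusion A ?E) \<psi> - bidual_adjoint (bidual_inclusion A ?p) \<psi>"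
      by (simp add: bidual_adjoint_def incl extend0_def)
    then show "bidual_adjoint (bidual_inclusion A ?q) \<psi> = bidual_inclusion A ?q \<psi>"
      unfolding incl one(1) support_projection_self_adjoint[OF A(1) AA]
        support_projection_self_adjoint[OF A(1) J] .
  qed
  ultimately show ?thesis using q by (simp add: is_projection_def)
qed

lemma closed_projection_complement:
  assumes A: "operator_algebra A" "approximately_unital A" and J: "r_ideal A J"
  shows "closed_projection A (bidual_complement A (support_projection A J))"
  unfolding closed_projection_def bidual_complement_complement
  using is_projection_complement[OF A J] open_projection_support_projection[OF A(1) J] by blast

text \<open>If \<open>(1 - x) A \<subseteq> J\<close>, then \<open>1 - x\<close>, as a weak* limit of elements \<open>u - x u\<close>, lies in the
  weak* closure of \<open>J\<close>, so \<open>p (1 - x) = 1 - x\<close>.\<close>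

lemma complement_absorbs_regular_element:
  assumes A: "operator_algebra A" "approximately_unital A" and J: "r_ideal A J"
    and x: "x \<in> A" and reg: "\<And>a. a \<in> A \<Longrightarrow> a - (x o\<^sub>L a) \<in> J"
  shows "arens_product A (bidual_complement A (support_projection A J)) (canonical_embedding A x)
    = bidual_complement A (support_projection A J)"
proof -
  let ?p = "support_projection A J" and ?E = "bidual_one A" and ?x = "canonical_embedding A x"
  note one = bidual_one_eq_support_projection[OF A]
  obtain G where G: "contractive_approx_identity A G" using A(2) by (auto simp: approximately_unital_def)
  note AA = approximately_unital_r_ideal[OF A(1) G]
  note G' = left_contractive_approx_identityD[OF AA(1)]
  have E: "?E \<in> bidual A" unfolding one by (rule support_projection_bidual[OF A(1) AA(2)])
  have p: "?p \<in> bidual A" by (rule support_projection_bidual[OF A(1) J])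
  have xb: "?x \<in> bidual A" by (rule canonical_embedding_bidual[OF A(1) x])
  define \<Psi> where "\<Psi> \<phi> = ?E \<phi> - ?x \<phi>" for \<phi>
  have \<Psi>: "\<Psi> \<in> bidual A" unfolding \<Psi>_def by (rule bidual_diff[OF E xb algebra_mem(4)[OF A(1)]])
  have p\<Psi>: "arens_product A ?p \<Psi> = \<Psi>"
  proof (rule support_projection_left_identity[OF A(1) J \<Psi>, where K = "1 + norm x"])
    fix \<psi> \<delta> assume \<psi>: "\<psi> \<in> dual A" and ball: "\<And>b. b \<in> J \<Longrightarrow> norm b \<le> 1 \<Longrightarrow> cmod (\<psi> b) \<le> \<delta>"
    have GA: "eventually (\<lambda>u. u \<in> A \<and> norm u \<le> 1) G" using G'(2) by simp
    have "((\<lambda>u. \<psi> (x o\<^sub>L u)) \<longlongrightarrow> \<psi> x) G"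
    proof (rule dual_tendsto[OF \<psi> operator_algebraD(2)[OF A(1)] x])
      show "((\<lambda>u. x o\<^sub>L u) \<longlongrightarrow> x) G" using G x by (simp add: contractive_approx_identity_def)
      show "eventually (\<lambda>u. x o\<^sub>L u \<in> A) G"
        using GA by (rule eventually_mono) (use algebra_mem[OF A(1)] x in blast)
    qed
    then have lim: "((\<lambda>u. \<psi> u - \<psi> (x o\<^sub>L u)) \<longlongrightarrow> \<Psi> \<psi>) G"
      unfolding \<Psi>_def one(1) using \<psi> support_projection_tendsto[OF A(1) AA(2) AA(1) \<psi>]
      by (simp add: canonical_embedding_def tendsto_diff)
    have \<delta>: "0 \<le> \<delta>" 
      by (rule order_trans[OF norm_ge_zero ball[OF subspace_0[OF r_idealD(1)[OF J]]]]) simp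
    have "eventually (\<lambda>u. norm (\<psi> u - \<psi> (x o\<^sub>L u)) \<le> (1 + norm x) * \<delta>) G"
      using GA
    proof (rule eventually_mono)
      fix u assume u: "u \<in> A \<and> norm u \<le> 1"
      then have xu: "x o\<^sub>L u \<in> A" using algebra_mem[OF A(1)] x by blast
      have "cmod (\<psi> (u - (x o\<^sub>L u))) \<le> norm (u - (x o\<^sub>L u)) * \<delta>"
        using dual_bound_on_ideal_if_ball[OF \<psi> J ball] reg u by blast
      also have "\<dots> \<le> (1 + norm x) * \<delta>"
        using norm_triangle_ineq4[of u "x o\<^sub>L u"] norm_blinfun_compose_le[of x "norm x" u 1] u \<delta>
        by (intro mult_right_mono) auto
      finally show "norm (\<psi> u - \<psi> (x o\<^sub>L u)) \<le> (1 + norm x) * \<delta>"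
        using dual_diff[OF \<psi> operator_algebraD(2)[OF A(1)] _ xu] u by simp
    qed
    then show "cmod (\<Psi> \<psi>) \<le> (1 + norm x) * \<delta>" by (rule Lim_norm_ubound[OF G'(1) lim])
  qed simp
  show ?thesis
  proof (rule ext)
    fix \<phi>
    show "arens_product A (bidual_complement A ?p) ?x \<phi> = bidual_complement A ?p \<phi>"
    proof (cases "\<phi> \<in> dual A")
      case \<phi>: True
      have x\<phi>: "bidual_action A ?x \<phi> \<in> dual A" by (rule bidual_action_dual[OF A(1) xb \<phi>])
      have "bidual_action A \<Psi> \<phi> = (\<lambda>a. bidual_action A ?E \<phi> a - bidual_action A ?x \<phi> a)"
        by (auto simp: bidual_action_def \<Psi>_def extend0_def)
      also have "\<dots> = (\<lambda>a. \<phi> a - bidual_action A ?x \<phi> a)" by (simp add: one(3)[OF \<phi>])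
      finally have "?p \<phi> - ?p (bidual_action A ?x \<phi>) = arens_product A ?p \<Psi> \<phi>"
        by (simp add: arens_product_apply[OF \<phi>] bidual_sub[OF p \<phi> x\<phi>])
      also have "\<dots> = ?E \<phi> - ?x \<phi>" by (simp add: p\<Psi> \<Psi>_def)
      also have "?x \<phi> = ?E (bidual_action A ?x \<phi>)"
        using one(2)[OF xb] by (simp flip: arens_product_apply[OF \<phi>])
      finally show ?thesis
        by (simp add: arens_product_apply[OF \<phi>] bidual_complement_def algebra_simps)
    next
      case False
      then show ?thesis
        by (simp add: arens_product_def extend0_outside bidual_complement_def bidualD(3)[OF E] bidualD(3)[OF p])
    qed
  qed
qed

text \<open>On translates \<open>a \<mapsto> \<phi>(a d)\<close> of a functional that vanishes on \<open>J\<close>, the complement of the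
  support projection is evaluation of \<open>\<phi>\<close> at \<open>d\<close>, because \<open>\<phi>(e d) = 0\<close> for \<open>e \<in> J\<close>. Thus
  \<open>q = q a\<close> makes such functionals agree at \<open>b\<close> and \<open>a b\<close>, and they separate points from \<open>J\<close>.\<close>

lemma regular_element_if_complement_absorbs:
  assumes A: "operator_algebra A" "approximately_unital A" and J: "r_ideal A J"
    and x: "x \<in> A"
    and absorb: "bidual_complement A (support_projection A J)
      = arens_product A (bidual_complement A (support_projection A J)) (canonical_embedding A x)"
    and b: "b \<in> A"
  shows "b - (x o\<^sub>L b) \<in> J"
proof (rule ccontr)
  let ?p = "support_projection A J" and ?E = "bidual_one A"
  let ?q = "bidual_complement A ?p"
  assume nJ: "b - (x o\<^sub>L b) \<notin> J"
  note J' = r_idealD[OF J]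
  note one = bidual_one_eq_support_projection[OF A]
  obtain G where G: "contractive_approx_identity A G" using A(2) by (auto simp: approximately_unital_def)
  note AA = approximately_unital_r_ideal[OF A(1) G]
  note G' = left_contractive_approx_identityD[OF AA(1)]
  obtain F where F: "left_contractive_approx_identity J F" using J by (auto simp: r_ideal_def)
  note F' = left_contractive_approx_identityD[OF F]
  have xb: "x o\<^sub>L b \<in> A" using x b by (rule algebra_mem(2)[OF A(1)])
  have c: "b - (x o\<^sub>L b) \<in> A" using b xb by (rule algebra_mem(5)[OF A(1)])
  obtain \<phi> where \<phi>: "\<phi> \<in> dual A" and \<phi>J: "\<And>j. j \<in> J \<Longrightarrow> \<phi> j = 0" and \<phi>c: "\<phi> (b - (x o\<^sub>L b)) \<noteq> 0"
    using dual_separation[OF operator_algebraD(2)[OF A(1)] J'(2,5,3) c nJ] by metis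
  have eval: "?q (right_translate A \<phi> d) = \<phi> d" if d: "d \<in> A" for d
  proof -
    have rd: "right_translate A \<phi> d \<in> dual A" by (rule right_translate_dual[OF A(1) \<phi> d])
    have "(right_translate A \<phi> d \<longlongrightarrow> \<phi> d) G"
    proof (rule Lim_transform_eventually)
      have GA: "eventually (\<lambda>u. u \<in> A) G" using G'(2) by (rule eventually_mono) simp
      show "((\<lambda>u. \<phi> (u o\<^sub>L d)) \<longlongrightarrow> \<phi> d) G"
      proof (rule dual_tendsto[OF \<phi> operator_algebraD(2)[OF A(1)] d])
        show "((\<lambda>u. u o\<^sub>L d) \<longlongrightarrow> d) G" using G'(3) d by blast
        show "eventually (\<lambda>u. u o\<^sub>L d \<in> A) G"
          using GA by (rule eventually_mono) (use algebra_mem(2)[OF A(1) _ d] in simp)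
      qed
      show "eventually (\<lambda>u. \<phi> (u o\<^sub>L d) = right_translate A \<phi> d u) G"
        using GA by (rule eventually_mono) (simp add: right_translate_def)
    qed
    from tendsto_unique[OF G'(1) support_projection_tendsto[OF A(1) AA(2) AA(1) rd] this]
    have "?E (right_translate A \<phi> d) = \<phi> d" by (simp add: one(1))
    moreover have "?p (right_translate A \<phi> d) = 0"
    proof (rule tendsto_unique[OF F'(1) support_projection_tendsto[OF A(1) J F rd]])
      have "eventually (\<lambda>e. 0 = right_translate A \<phi> d e) F"
        using F'(2)
      proof (rule eventually_mono)
        fix e assume "e \<in> {e \<in> J. norm e \<le> 1}"
        then show "0 = right_translate A \<phi> d e" using J'(3,4) d \<phi>J by (auto simp: right_translate_def)
      qed
      then show "(right_translate A \<phi> d \<longlongrightarrow> 0) F" by (rule Lim_transform_eventually[OF tendsto_const])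
    qed
    ultimately show ?thesis by (simp add: bidual_complement_def)
  qed
  have rb: "right_translate A \<phi> b \<in> dual A" by (rule right_translate_dual[OF A(1) \<phi> b])
  have "right_translate A (right_translate A \<phi> b) x = right_translate A \<phi> (x o\<^sub>L b)"
    using algebra_mem(2)[OF A(1) _ x] by (auto simp: right_translate_def extend0_def blinfun_compose_assoc)
  then have "?q (right_translate A \<phi> b) = ?q (right_translate A \<phi> (x o\<^sub>L b))"
    using fun_cong[OF absorb, of "right_translate A \<phi> b"]
    by (simp add: arens_product_apply[OF rb] bidual_action_canonical_embedding[OF A(1) x rb])
  then have "\<phi> b = \<phi> (x o\<^sub>L b)" using eval[OF b] eval[OF xb] by simp
  then show False using \<phi>c dual_diff[OF \<phi> operator_algebraD(2)[OF A(1)] b xb] by simp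
qed

theorem proposition6p8:
  fixes A J :: "('h::complex_hilbert_space \<Rightarrow>\<^sub>L 'h) set"
  assumes "operator_algebra A" and "approximately_unital A" and "r_ideal A J"
  shows "(regular_right_ideal A J \<longleftrightarrow> one_regular_right_ideal A J) \<and>
         (one_regular_right_ideal A J \<longleftrightarrow>
            compact_projection A (bidual_complement A (support_projection A J)))"
proof (intro conjI iffI)
  show "regular_right_ideal A J \<Longrightarrow> one_regular_right_ideal A J"
    by (rule one_regular_if_regular[OF assms])
  show "one_regular_right_ideal A J \<Longrightarrow> regular_right_ideal A J"
    unfolding one_regular_right_ideal_def regular_right_ideal_def by blast
next
  assume "one_regular_right_ideal A J"
  then obtain x where x: "x \<in> A" "norm x \<le> 1" "\<And>a. a \<in> A \<Longrightarrow> a - (x o\<^sub>L a) \<in> J"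
    unfolding one_regular_right_ideal_def by blast
  then show "compact_projection A (bidual_complement A (support_projection A J))"
    unfolding compact_projection_def
    using closed_projection_complement[OF assms] complement_absorbs_regular_element[OF assms x(1,3)]
    by (intro conjI bexI[of _ x]) auto
next
  assume "compact_projection A (bidual_complement A (support_projection A J))"
  then obtain x where x: "x \<in> A" "norm x \<le> 1"
    and "bidual_complement A (support_projection A J)
      = arens_product A (bidual_complement A (support_projection A J)) (canonical_embedding A x)"
    unfolding compact_projection_def by blast
  then have "a - (x o\<^sub>L a) \<in> J" if "a \<in> A" for a
    using regular_element_if_complement_absorbs[OF assms x(1)] that by blast
  then show "one_regular_right_ideal A J"
    using x assms(3) unfolding one_regular_right_ideal_def r_ideal_def by blast
qed

end
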